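(* Fix $y\in\mathbb{R}$ and $k,m\in\mathbb{N}$ (positive integers). Assume $p=p(n)\in(0,1)$ is such that, as $n\to\infty$, $$p^k\gg\frac{\ln^3 n}{n},\qquad 1-p\gg\sqrt{\frac{\ln\ln n}{\ln n}}.$$ Let $$a_{k;n}=np^k+\sqrt{2kp^k(1-p^k)n\ln n}\left(1-\frac{\ln[k!]}{2k\ln n}-\frac{\ln[4\pi k\ln n]}{4k\ln n}\right),\qquad \sigma_{k;n}=\sqrt{\frac{p^k(1-p^k)n}{2k\ln n}}.$$ Then $$\mathsf{P}\left(\frac{\Delta^m_{k;n}-a_{k;n}}{\sigma_{k;n}}\leq y\right)\to e^{-e^{-y}}\sum_{i=0}^{m-1}\frac{e^{-yi}}{i!}\quad\text{as }n\to\infty.$$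
   Context: $G(n,p)$ is the binomial random graph on the vertex set $[n]=\{1,\ldots,n\}$: each of the $\binom n2$ possible edges is present independently with probability $p$. For distinct vertices $v_1,\ldots,v_k\in[n]$, $N_n(v_1,\ldots,v_k)\subseteq[n]\setminus\{v_1,\ldots,v_k\}$ is the set of all common neighbors of $v_1,\ldots,v_k$ in $G(n,p)$, i.e. the set of $u$ adjacent to every $v_i$, $i=1,\ldots,k$. The random variable $\Delta^m_{k;n}$ is the $m$-th highest value among the numbers $|N_n(v_1,\ldots,v_k)|$, where $\{v_1,\ldots,v_k\}$ ranges over all $k$-element subsets of $[n]$ (values are counted with multiplicity, one value per $k$-subset; $n$ is large enough that $\binom nk\ge m$). In particular $\Delta^1_{k;n}=\max|N_n(v_1,\ldots,v_k)|$. For sequences $g_1(n),g_2(n)$ of positive numbers, $g_1\gg g_2$ means $g_2/g_1\to0$ as $n\to\infty$. *)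

theory Defs
  imports "HOL-Probability.Probability"
begin

definition all_edges :: "nat \<Rightarrow> nat set set" where
  "all_edges n = {e. e \<subseteq> {1..n} \<and> card e = 2}"

text \<open>A graph on the vertex set \<open>{1..n}\<close> is represented by its set of edges.\<close>

definition binomial_graph :: "nat \<Rightarrow> real \<Rightarrow> nat set set pmf" where
  "binomial_graph n p =
     map_pmf (\<lambda>w. {e \<in> all_edges n. w e})
       (Pi_pmf (all_edges n) False (\<lambda>_. bernoulli_pmf p))"

definition common_nbrs :: "nat \<Rightarrow> nat set set \<Rightarrow> nat set \<Rightarrow> nat set" where
  "common_nbrs n E V = {u \<in> {1..n} - V. \<forall>v\<in>V. {u, v} \<in> E}"

text \<open>Repeated elements of the multiset count separately. The value is meaningful only for
  \<open>1 \<le> m \<le> size M\<close>.\<close>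

definition mth_highest :: "nat \<Rightarrow> 'a::linorder multiset \<Rightarrow> 'a" where
  "mth_highest m M = rev (sorted_list_of_multiset M) ! (m - 1)"

definition Delta :: "nat \<Rightarrow> nat \<Rightarrow> nat \<Rightarrow> nat set set \<Rightarrow> nat" where
  "Delta m k n E =
     mth_highest m (image_mset (\<lambda>V. card (common_nbrs n E V))
                      (mset_set {V. V \<subseteq> {1..n} \<and> card V = k}))"

definition much_greater :: "(nat \<Rightarrow> real) \<Rightarrow> (nat \<Rightarrow> real) \<Rightarrow> bool" where
  "much_greater g1 g2 \<longleftrightarrow> (\<lambda>n. g2 n / g1 n) \<longlonglongrightarrow> 0"

definition a_seq :: "nat \<Rightarrow> nat \<Rightarrow> real \<Rightarrow> real" where
  "a_seq k n p =
     n * p ^ k + sqrt (2 * k * p ^ k * (1 - p ^ k) * n * ln n) *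
       (1 - ln (fact k) / (2 * k * ln n) - ln (4 * pi * k * ln n) / (4 * k * ln n))"

definition sigma_seq :: "nat \<Rightarrow> nat \<Rightarrow> real \<Rightarrow> real" where
  "sigma_seq k n p = sqrt (p ^ k * (1 - p ^ k) * n / (2 * k * ln n))"

end

theory Submission
  imports Defs "HOL-Real_Asymp.Real_Asymp"
begin

text \<open>
  Let \<open>b = a + \<sigma> y\<close>, so that the event is \<open>W < m\<close>, where \<open>W\<close> counts the \<open>k\<close>-sets \<open>V\<close> with more than \<open>b\<close>
  common neighbours. It suffices that \<open>W\<close> is asymptotically Poisson with mean \<open>exp (- y)\<close>, and
  for this that \<open>j P(W = j) - E(W) P(W = j - 1)\<close> tends to \<open>0\<close> for every \<open>j\<close> and that \<open>E(W)\<close> converges.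

  The mean is a moderate deviation probability of a binomial variable, obtained from Stirling's
  formula at the threshold and a geometric comparison of the consecutive weights beyond it.

  For the recursion, \<open>W - 1\<close> on the event that \<open>V\<close> is exceptional is compared with the number of
  exceptional sets disjoint from \<open>V\<close> when common neighbours inside \<open>V\<close> are ignored: the latter does not depend on
  the edges at \<open>V\<close>. The sets meeting \<open>V\<close> in a \<open>j\<close>-set \<open>S\<close> are the difficulty, since for large
  \<open>p\<close> the second moment of \<open>W\<close> diverges. If \<open>V\<close> is exceptional, \<open>S\<close> does not have many more common
  neighbours than the tilted mean given \<open>V\<close>, except with probability \<open>o(n^(-k))\<close>; this is where
  \<open>1 - p \<gg> sqrt (ln ln n / ln n)\<close> is needed. Given such a bound, a second exceptional set through \<open>S\<close> has
  probability \<open>o(n^(j - k))\<close>. Both estimates are exponential moment bounds with a common tilt.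
\<close>

section \<open>Random subsets and their exponential moments\<close>

text \<open>Let r = p^(k-j) (1-p^j) / (1-p^k), the correlation of the counts of two k-sets that
  share j vertices. At the level of sqrt(2 k ln n) standard deviations both are exceptional with
  probability about n^(-2k/(1+r)), and r tends to j/k as p tends to 1. The n^(2k-j) such pairs then
  contribute about n^(j(k-j)/(k+j)), so the second moment diverges. The contribution comes from rare
  shared sets S with far too many common neighbours, hence the truncation at \<open>cut\<close>.
  Below \<open>cut\<close>, a second exceptional set through S costs about
  n^(-k(1-p^(k-j))/(1-p^k)). This exponent exceeds k - j, but only by an amount of order 1 - p
  (\<open>geom_sum_gap\<close>). The gain of order (1-p) ln n limits the slack allowed in
  \<open>cut\<close>, and with such a slack exceeding \<open>cut\<close> costs only (1-p)^2 ln n.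
  Exponential moment bounds miss the Gaussian prefactor and lose \<open>exp (rho n)\<close>, of
  order sqrt(ln n), so (1-p)^2 ln n has to dominate ln ln n. The condition on p^k makes the cubic
  terms of the exponents, of order n p^k tilt^3, vanish.\<close>

definition random_subset :: "'a set \<Rightarrow> real \<Rightarrow> 'a set pmf" where
  "random_subset A q = map_pmf (\<lambda>w. {x \<in> A. w x}) (Pi_pmf A False (\<lambda>_. bernoulli_pmf q))"

lemma binomial_graph_eq: "binomial_graph n p = random_subset (all_edges n) p"
  by (simp add: binomial_graph_def random_subset_def)

lemma set_random_subset: "set_pmf (random_subset A q) \<subseteq> Pow A"
  by (auto simp: random_subset_def)

lemma finite_set_random_subset: "finite A \<Longrightarrow> finite (set_pmf (random_subset A q))"
  by (rule finite_subset[OF set_random_subset]) auto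

lemma random_subset_empty [simp]: "random_subset {} q = return_pmf {}"
  by (simp add: random_subset_def)

lemma random_subset_Un:
  assumes "finite A" "finite B" "A \<inter> B = {}"
  shows "random_subset (A \<union> B) q
           = map_pmf (\<lambda>(X, Y). X \<union> Y) (pair_pmf (random_subset A q) (random_subset B q))"
proof -
  have "random_subset (A \<union> B) q = map_pmf (\<lambda>(f, g). {x \<in> A. f x} \<union> {x \<in> B. g x})
      (pair_pmf (Pi_pmf A False (\<lambda>_. bernoulli_pmf q)) (Pi_pmf B False (\<lambda>_. bernoulli_pmf q)))"
    unfolding random_subset_def Pi_pmf_union[OF assms] map_pmf_comp
    by (rule map_pmf_cong) (use assms(3) in auto)
  also have "\<dots> = map_pmf (\<lambda>(X, Y). X \<union> Y) (pair_pmf (random_subset A q) (random_subset B q))"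
    unfolding random_subset_def
    by (subst map_pair[symmetric]) (simp add: map_pmf_comp case_prod_unfold)
  finally show ?thesis .
qed

text \<open>All independence below comes from this joint law: events that read disjoint classes of
  potential edges are functions of the two traces. The rest \<open>?C\<close> of \<open>F\<close> is
  an independent third component that is projected away.\<close>

lemma random_subset_Int_pair:
  assumes "finite F" "A \<subseteq> F" "B \<subseteq> F" "A \<inter> B = {}"
  shows "map_pmf (\<lambda>E. (E \<inter> A, E \<inter> B)) (random_subset F q)
           = pair_pmf (random_subset A q) (random_subset B q)"
proof -
  let ?C = "F - (A \<union> B)"
  have fin: "finite A" "finite B" "finite ?C" using assms finite_subset by auto
  have F: "F = (A \<union> B) \<union> ?C" using assms by auto
  have "random_subset F q = map_pmf (\<lambda>(X, Y). X \<union> Y)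
          (pair_pmf (random_subset (A \<union> B) q) (random_subset ?C q))"
    by (subst F, rule random_subset_Un) (use fin in auto)
  also have "\<dots> = map_pmf (\<lambda>((X, Y), Z). X \<union> Y \<union> Z)
          (pair_pmf (pair_pmf (random_subset A q) (random_subset B q)) (random_subset ?C q))"
    unfolding random_subset_Un[OF fin(1,2) assms(4)]
    by (subst pair_map_pmf1) (simp add: map_pmf_comp case_prod_unfold)
  finally have eq: "random_subset F q = \<dots>" .
  have "map_pmf (\<lambda>E. (E \<inter> A, E \<inter> B)) (random_subset F q)
      = map_pmf fst (pair_pmf (pair_pmf (random_subset A q) (random_subset B q)) (random_subset ?C q))"
    unfolding eq map_pmf_comp
  proof (rule map_pmf_cong[OF refl])
    fix t assume "t \<in> set_pmf (pair_pmf (pair_pmf (random_subset A q) (random_subset B q)) (random_subset ?C q))"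
    then obtain X Y Z where t: "t = ((X, Y), Z)" and "X \<subseteq> A" "Y \<subseteq> B" "Z \<subseteq> ?C"
      using set_random_subset by (cases t) fastforce
    then show "((case t of (x, xa) \<Rightarrow> (case x of (X, Y) \<Rightarrow> \<lambda>Z. X \<union> Y \<union> Z) xa) \<inter> A,
      (case t of (x, xa) \<Rightarrow> (case x of (X, Y) \<Rightarrow> \<lambda>Z. X \<union> Y \<union> Z) xa) \<inter> B) = fst t"
      using assms(4) by auto
  qed
  then show ?thesis by (simp add: map_fst_pair_pmf)
qed

lemma random_subset_Int:
  assumes "finite F" "A \<subseteq> F"
  shows "map_pmf (\<lambda>E. E \<inter> A) (random_subset F q) = random_subset A q"
  using arg_cong[OF random_subset_Int_pair[OF assms, of "{}" q], of "map_pmf fst"]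
  by (simp add: map_pmf_comp map_fst_pair_pmf)

lemma random_subset_indep:
  assumes "finite F" "A \<subseteq> F" "B \<subseteq> F" "A \<inter> B = {}"
  shows "measure_pmf.prob (random_subset F q) {E. P (E \<inter> A) \<and> Q (E \<inter> B)}
     = measure_pmf.prob (random_subset F q) {E. P (E \<inter> A)}
       * measure_pmf.prob (random_subset F q) {E. Q (E \<inter> B)}"
proof -
  have "measure_pmf.prob (random_subset F q) {E. P (E \<inter> A) \<and> Q (E \<inter> B)}
     = measure_pmf.prob (map_pmf (\<lambda>E. (E \<inter> A, E \<inter> B)) (random_subset F q)) ((Collect P \<inter> Pow A) \<times> (Collect Q \<inter> Pow B))"
    by (simp add: vimage_def)
  also have "\<dots> = measure_pmf.prob (random_subset A q) (Collect P \<inter> Pow A) * measure_pmf.prob (random_subset B q) (Collect Q \<inter> Pow B)"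
    unfolding random_subset_Int_pair[OF assms]
    by (rule measure_pmf_prob_product) (use assms(1-3) in \<open>auto intro!: countable_finite dest: finite_subset\<close>)
  also have "\<dots> = measure_pmf.prob (random_subset F q) {E. P (E \<inter> A)}
       * measure_pmf.prob (random_subset F q) {E. Q (E \<inter> B)}"
    by (simp add: vimage_def random_subset_Int[OF assms(1,2), symmetric]
       random_subset_Int[OF assms(1,3), symmetric])
  finally show ?thesis .
qed

lemma prob_random_subset_superset:
  assumes "finite F" "A \<subseteq> F" "q \<in> {0..1}"
  shows "measure_pmf.prob (random_subset F q) {E. A \<subseteq> E} = q ^ card A"
proof -
  have fA: "finite A" using assms finite_subset by auto
  have "measure_pmf.prob (random_subset F q) {E. A \<subseteq> E}
      = measure_pmf.prob (map_pmf (\<lambda>E. E \<inter> A) (random_subset F q)) {A}"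
    by (simp add: vimage_def) (metis inf.absorb_iff2)
  also have "\<dots> = measure_pmf.prob (Pi_pmf A False (\<lambda>_. bernoulli_pmf q)) (Pi A (\<lambda>_. {True}))"
    unfolding random_subset_Int[OF assms(1,2)] unfolding random_subset_def
    by (auto intro!: arg_cong[where f = "measure_pmf.prob _"])
  also have "\<dots> = q ^ card A"
    using assms(3) by (subst measure_Pi_pmf_Pi[OF fA]) (auto simp: measure_pmf_single)
  finally show ?thesis .
qed

lemma random_subset_insert:
  assumes "finite A" "x \<notin> A"
  shows "random_subset (insert x A) q = map_pmf (\<lambda>(c, Y). if c then insert x Y else Y)
     (pair_pmf (bernoulli_pmf q) (random_subset A q))"
  unfolding random_subset_def Pi_pmf_insert[OF assms] pair_map_pmf2 map_pmf_comp
  by (rule map_pmf_cong) (use assms in \<open>auto split: if_splits\<close>)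

lemma expectation_power_random_subset:
  fixes z :: real
  assumes "finite A" "q \<in> {0..1}" "z \<ge> 0"
  shows "measure_pmf.expectation (random_subset A q) (\<lambda>X. z ^ card X) = (1 + q * (z - 1)) ^ card A"
proof -
  have "measure_pmf.expectation (random_subset A q) (\<lambda>X. z ^ card X)
      = measure_pmf.expectation (Pi_pmf A False (\<lambda>_. bernoulli_pmf q)) (\<lambda>w. \<Prod>x\<in>A. if w x then z else 1)"
    using assms(1) by (simp add: random_subset_def prod.If_cases Int_def)
  also have "\<dots> = (\<Prod>x\<in>A. measure_pmf.expectation (bernoulli_pmf q) (\<lambda>c. if c then z else 1))"
    by (rule expectation_prod_Pi_pmf) (use assms in \<open>auto intro: integrable_measure_pmf_finite\<close>)
  also have "\<dots> = (1 + q * (z - 1)) ^ card A"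
    using assms(2) by (simp add: algebra_simps)
  finally show ?thesis .
qed

lemma card_random_subset:
  assumes "finite A" "q \<in> {0..1}"
  shows "map_pmf card (random_subset A q) = binomial_pmf (card A) q"
  using binomial_pmf_altdef'[OF assms(1) refl assms(2), of False]
  by (simp add: random_subset_def map_pmf_comp)

section \<open>Common neighbourhoods as random vertex sets\<close>

definition edges_between :: "'a set \<Rightarrow> 'a set \<Rightarrow> 'a set set" where
  "edges_between U B = (\<lambda>(u, v). {u, v}) ` (U \<times> B)"

definition nbrs_in :: "'a set \<Rightarrow> 'a set \<Rightarrow> 'a set set \<Rightarrow> 'a set" where
  "nbrs_in U B E = {u \<in> U. \<forall>v\<in>B. {u, v} \<in> E}"

lemma finite_edges_between: "finite U \<Longrightarrow> finite B \<Longrightarrow> finite (edges_between U B)"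
  by (simp add: edges_between_def)

lemma nbrs_in_cong:
  assumes "edges_between U B \<subseteq> F"
  shows "nbrs_in U B (E \<inter> F) = nbrs_in U B E"
  using assms by (auto simp: nbrs_in_def edges_between_def)

text \<open>Since \<open>U\<close> and \<open>B\<close> are disjoint, the stars from different
  \<open>u\<close> to \<open>B\<close> share no edge, so the events that \<open>u\<close> sees all
  of \<open>B\<close> are independent with probability \<open>q ^ card B\<close>. The law of the
  set, not only of its size, is kept because neighbourhoods are intersected later.\<close>

lemma random_subset_nbrs_in_aux:
  assumes "finite U" "finite B" "U \<inter> B = {}" "q \<in> {0..1}"
  shows "map_pmf (nbrs_in U B) (random_subset (edges_between U B) q) = random_subset U (q ^ card B)"
  using assms(1,3)
proof (induction U rule: finite_induct)
  case empty
  then show ?case by (simp add: edges_between_def nbrs_in_def)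
next
  case (insert u U)
  let ?K = "edges_between {u} B" and ?L = "edges_between U B"
  have fin: "finite ?K" "finite ?L"
    using insert assms by (auto intro: finite_edges_between)
  have disj: "?K \<inter> ?L = {}"
    using insert by (auto simp: edges_between_def doubleton_eq_iff)
  have un: "edges_between (insert u U) B = ?K \<union> ?L"
    by (auto simp: edges_between_def)
  have "card ?K = card B"
    unfolding edges_between_def
    by (subst card_image) (use insert in \<open>auto simp: inj_on_def doubleton_eq_iff card_cartesian_product\<close>)
  then have "measure_pmf.prob (random_subset ?K q) {E. ?K \<subseteq> E} = q ^ card B"
    using prob_random_subset_superset[OF fin(1) subset_refl assms(4)] by simp
  then have "pmf (map_pmf (\<lambda>E. ?K \<subseteq> E) (random_subset ?K q)) True = pmf (bernoulli_pmf (q ^ card B)) True"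
    using assms(4) by (simp add: pmf_map vimage_def power_le_one)
  then have bern: "map_pmf (\<lambda>E. ?K \<subseteq> E) (random_subset ?K q) = bernoulli_pmf (q ^ card B)"
    by (intro pmf_eqI) (metis (full_types) pmf_False_conv_True)
  have "map_pmf (nbrs_in (insert u U) B) (random_subset (?K \<union> ?L) q)
      = map_pmf (\<lambda>(X, Y). if ?K \<subseteq> X then insert u (nbrs_in U B Y) else nbrs_in U B Y)
          (pair_pmf (random_subset ?K q) (random_subset ?L q))"
    unfolding random_subset_Un[OF fin disj] map_pmf_comp
  proof (rule map_pmf_cong[OF refl])
    fix t assume "t \<in> set_pmf (pair_pmf (random_subset ?K q) (random_subset ?L q))"
    then obtain X Y where t: "t = (X, Y)" and sub: "X \<subseteq> ?K" "Y \<subseteq> ?L"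
      using set_random_subset by (cases t) fastforce
    have "nbrs_in (insert u U) B (X \<union> Y) = nbrs_in {u} B ((X \<union> Y) \<inter> ?K) \<union> nbrs_in U B ((X \<union> Y) \<inter> ?L)"
      by (auto simp: nbrs_in_cong) (auto simp: nbrs_in_def)
    also have "(X \<union> Y) \<inter> ?K = X" using sub disj by auto
    also have "(X \<union> Y) \<inter> ?L = Y" using sub disj by auto
    also have "nbrs_in {u} B X = (if ?K \<subseteq> X then {u} else {})"
      by (auto simp: nbrs_in_def edges_between_def)
    finally show "nbrs_in (insert u U) B (case t of (X, Y) \<Rightarrow> X \<union> Y) =
      (case t of (X, Y) \<Rightarrow> if ?K \<subseteq> X then insert u (nbrs_in U B Y) else nbrs_in U B Y)"
      by (auto simp: t)
  qed
  also have "\<dots> = map_pmf (\<lambda>(c, Y). if c then insert u Y else Y)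
     (pair_pmf (map_pmf (\<lambda>E. ?K \<subseteq> E) (random_subset ?K q)) (map_pmf (nbrs_in U B) (random_subset ?L q)))"
    by (subst map_pair[symmetric]) (simp add: map_pmf_comp case_prod_unfold cong: if_cong)
  also have "\<dots> = random_subset (insert u U) (q ^ card B)"
    using insert by (simp add: bern random_subset_insert)
  finally show ?case unfolding un .
qed

lemma random_subset_nbrs_in:
  assumes "finite U" "finite B" "U \<inter> B = {}" "q \<in> {0..1}" "finite F" "edges_between U B \<subseteq> F"
  shows "map_pmf (nbrs_in U B) (random_subset F q) = random_subset U (q ^ card B)"
proof -
  have "map_pmf (nbrs_in U B) (random_subset F q)
      = map_pmf (nbrs_in U B) (map_pmf (\<lambda>E. E \<inter> edges_between U B) (random_subset F q))"
    by (simp add: map_pmf_comp nbrs_in_cong)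
  then show ?thesis
    using random_subset_nbrs_in_aux assms by (simp add: random_subset_Int)
qed

section \<open>Exponential Markov inequalities\<close>

lemma prob_random_subset_Markov:
  assumes "finite A" "q \<in> {0..1}" "z \<ge> 1"
  shows "measure_pmf.prob (random_subset A q) {X. real (card X) > c}
     \<le> z powr (- c) * (1 + q * (z - 1)) ^ card A"
proof -
  have fin: "finite (set_pmf (random_subset A q))" by (rule finite_set_random_subset) fact
  have "measure_pmf.prob (random_subset A q) {X. real (card X) > c}
      = measure_pmf.expectation (random_subset A q) (indicator {X. real (card X) > c})"
    by simp
  also have "\<dots> \<le> measure_pmf.expectation (random_subset A q) (\<lambda>X. z powr (- c) * z ^ card X)"
  proof (rule integral_mono)
    fix X :: "'a set"
    have "1 \<le> z powr (real (card X) - c)" if "real (card X) > c"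
      using that assms(3) by (intro ge_one_powr_ge_zero) auto
    also have "z powr (real (card X) - c) = z powr (- c) * z ^ card X"
      using assms(3) by (simp add: powr_diff powr_minus powr_realpow divide_simps)
    finally show "indicat_real {X. real (card X) > c} X \<le> z powr (- c) * z ^ card X"
      using assms(3) by (auto simp: indicator_def)
  qed (use fin in \<open>auto intro: integrable_measure_pmf_finite\<close>)
  also have "\<dots> = z powr (- c) * (1 + q * (z - 1)) ^ card A"
    using assms by (simp add: expectation_power_random_subset)
  finally show ?thesis .
qed

lemma prob_pair_pmf:
  "measure_pmf.prob (pair_pmf M N) {t. R (fst t) (snd t)}
     = measure_pmf.expectation M (\<lambda>x. measure_pmf.prob N {y. R x y})"
proof -
  have "emeasure (measure_pmf (pair_pmf M N)) {t. R (fst t) (snd t)}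
      = (\<integral>\<^sup>+t. indicator {t. R (fst t) (snd t)} t \<partial>pair_pmf M N)"
    by simp
  also have "\<dots> = (\<integral>\<^sup>+x. \<integral>\<^sup>+y. indicator {t. R (fst t) (snd t)} (x, y) \<partial>N \<partial>M)"
    by (rule nn_integral_pair_pmf')
  also have "\<dots> = (\<integral>\<^sup>+x. emeasure (measure_pmf N) {y. R x y} \<partial>M)"
  proof (rule nn_integral_cong)
    fix x
    have "(\<integral>\<^sup>+y. indicator {t. R (fst t) (snd t)} (x, y) \<partial>N) = (\<integral>\<^sup>+y. indicator {y. R x y} y \<partial>N)"
      by (rule nn_integral_cong) (auto simp: indicator_def)
    then show "(\<integral>\<^sup>+y. indicator {t. R (fst t) (snd t)} (x, y) \<partial>N) = emeasure (measure_pmf N) {y. R x y}"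
      by simp
  qed
  also have "\<dots> = ennreal (measure_pmf.expectation M (\<lambda>x. measure_pmf.prob N {y. R x y}))"
    unfolding measure_pmf.emeasure_eq_measure
    by (rule nn_integral_eq_integral) (auto intro!: measure_pmf.integrable_const_bound[where B = 1])
  finally show ?thesis
    by (simp add: measure_pmf.emeasure_eq_measure integral_nonneg_AE)
qed

lemma prob_pair_pmf_le:
  assumes "\<And>x. x \<in> set_pmf M \<Longrightarrow> Q x \<Longrightarrow> measure_pmf.prob N {y. R x y} \<le> c" "c \<ge> 0"
  shows "measure_pmf.prob (pair_pmf M N) {t. Q (fst t) \<and> R (fst t) (snd t)} \<le> measure_pmf.prob M {x. Q x} * c"
proof -
  have "measure_pmf.prob (pair_pmf M N) {t. Q (fst t) \<and> R (fst t) (snd t)}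
      = measure_pmf.expectation M (\<lambda>x. measure_pmf.prob N {y. Q x \<and> R x y})"
    by (rule prob_pair_pmf)
  also have "\<dots> \<le> measure_pmf.expectation M (\<lambda>x. indicator {x. Q x} x * c)"
  proof (rule integral_mono_AE)
    show "AE x in M. measure_pmf.prob N {y. Q x \<and> R x y} \<le> indicator {x. Q x} x * c"
      using assms by (auto simp: AE_measure_pmf_iff indicator_def)
  qed (auto intro!: measure_pmf.integrable_const_bound[where B = 1] integrable_mult_left integrable_real_indicator simp: less_top[symmetric])
  finally show ?thesis by simp
qed

text \<open>Here the first component plays the neighbourhood of a subset S of V, the second that of
  V - S, and the intersection that of V. Given the first set X, the inner Markov bound leaves a
  power of \<open>1 + s * (z - 1)\<close> with exponent \<open>card X\<close>; on the event,
  \<open>v powr (card X - c)\<close> is at least 1 and may be inserted, and the outer moment is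
  again of the form of \<open>expectation_power_random_subset\<close>.\<close>

lemma prob_two_level_Markov:
  assumes U: "finite U" and q: "q \<in> {0..1}" "s \<in> {0..1}" and z: "z \<ge> 1" "v \<ge> 1"
  shows "measure_pmf.prob (pair_pmf (random_subset U q) (random_subset U s))
           {t. real (card (fst t \<inter> snd t)) > b \<and> real (card (fst t)) > c}
     \<le> z powr (- b) * v powr (- c) * (1 + q * (v * (1 + s * (z - 1)) - 1)) ^ card U"
proof -
  have fin: "finite (set_pmf (random_subset U r))" for r by (rule finite_set_random_subset) fact
  let ?w = "1 + s * (z - 1)"
  have w1: "?w \<ge> 1" using q z by simp
  have "measure_pmf.prob (pair_pmf (random_subset U q) (random_subset U s))
           {t. real (card (fst t \<inter> snd t)) > b \<and> real (card (fst t)) > c}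
     = measure_pmf.expectation (random_subset U q)
         (\<lambda>X. measure_pmf.prob (random_subset U s) {Y. real (card (X \<inter> Y)) > b \<and> real (card X) > c})"
    by (rule prob_pair_pmf)
  also have "\<dots> \<le> measure_pmf.expectation (random_subset U q)
         (\<lambda>X. z powr (- b) * v powr (- c) * (v * ?w) ^ card X)"
  proof (rule integral_mono_AE)
    show "AE X in random_subset U q.
        measure_pmf.prob (random_subset U s) {Y. real (card (X \<inter> Y)) > b \<and> real (card X) > c}
        \<le> z powr (- b) * v powr (- c) * (v * ?w) ^ card X"
      unfolding AE_measure_pmf_iff
    proof
      fix X assume "X \<in> set_pmf (random_subset U q)"
      then have X: "X \<subseteq> U" using set_random_subset by auto
      show "measure_pmf.prob (random_subset U s) {Y. real (card (X \<inter> Y)) > b \<and> real (card X) > c}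
        \<le> z powr (- b) * v powr (- c) * (v * ?w) ^ card X"
      proof (cases "real (card X) > c")
        case True
        then have "measure_pmf.prob (random_subset U s) {Y. real (card (X \<inter> Y)) > b \<and> real (card X) > c}
           = measure_pmf.prob (map_pmf (\<lambda>Y. Y \<inter> X) (random_subset U s)) {Y. real (card Y) > b}"
          by (simp add: vimage_def Int_commute)
        also have "\<dots> \<le> z powr (- b) * ?w ^ card X"
          unfolding random_subset_Int[OF U X]
          using prob_random_subset_Markov[OF finite_subset[OF X U] q(2) z(1)] by simp
        also have "\<dots> \<le> v powr (real (card X) - c) * (z powr (- b) * ?w ^ card X)"
          using True z w1
          by (subst mult_le_cancel_right1) (auto intro!: ge_one_powr_ge_zero simp: not_less mult_less_0_iff)
        also have "\<dots> = z powr (- b) * v powr (- c) * (v * ?w) ^ card X"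
          using z by (simp add: powr_diff powr_minus powr_realpow power_mult_distrib divide_simps)
        finally show ?thesis .
      qed (use z w1 in auto)
    qed
  qed (use fin in \<open>auto intro: integrable_measure_pmf_finite\<close>)
  also have "\<dots> = z powr (- b) * v powr (- c) * (1 + q * (v * ?w - 1)) ^ card U"
    using U q z w1 by (simp add: expectation_power_random_subset)
  finally show ?thesis .
qed

section \<open>Poisson limits from a recursion\<close>

lemma prob_le_prob_plus:
  assumes "\<And>x. P x \<Longrightarrow> Q x \<or> R x"
  shows "measure_pmf.prob M {x. P x} \<le> measure_pmf.prob M {x. Q x} + measure_pmf.prob M {x. R x}"
proof -
  have "measure_pmf.prob M {x. P x} \<le> measure_pmf.prob M ({x. Q x} \<union> {x. R x})"
    using assms by (intro measure_pmf.finite_measure_mono) auto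
  also have "\<dots> \<le> measure_pmf.prob M {x. Q x} + measure_pmf.prob M {x. R x}"
    by (rule measure_Un_le) auto
  finally show ?thesis .
qed

lemma prob_diff_le:
  "\<bar>measure_pmf.prob M {x. P x} - measure_pmf.prob M {x. Q x}\<bar> \<le> measure_pmf.prob M {x. P x \<noteq> Q x}"
  using prob_le_prob_plus[of P Q "\<lambda>x. P x \<noteq> Q x" M] prob_le_prob_plus[of Q P "\<lambda>x. P x \<noteq> Q x" M]
  by (auto simp: abs_le_iff)

lemma expectation_card_eq_sum_prob:
  fixes M :: "'a pmf"
  assumes "finite J"
  shows "measure_pmf.expectation M (\<lambda>x. real (card {v\<in>J. I v x})) = (\<Sum>v\<in>J. measure_pmf.prob M {x. I v x})"
proof -
  have *: "real (card {v\<in>J. I v x}) = (\<Sum>v\<in>J. indicator {x. I v x} x)" for x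
    using assms by (simp add: indicator_def sum.If_cases Int_def)
  show ?thesis
    unfolding * by (subst Bochner_Integration.integral_sum)
      (auto intro!: integrable_real_indicator simp: less_top[symmetric])
qed

text \<open>On the event that \<open>W = j\<close> exactly \<open>j\<close> of the indicators hold,
  so exchanging sum and expectation gives the factor \<open>j\<close>.\<close>

lemma sum_prob_conj_card_eq:
  fixes M :: "'a pmf" and I :: "'v \<Rightarrow> 'a \<Rightarrow> bool"
  assumes "finite J"
  defines "W \<equiv> \<lambda>x. card {v\<in>J. I v x}"
  shows "(\<Sum>v\<in>J. measure_pmf.prob M {x. I v x \<and> W x = j}) = real j * measure_pmf.prob M {x. W x = j}"
proof -
  have "(\<Sum>v\<in>J. measure_pmf.prob M {x. I v x \<and> W x = j})
     = measure_pmf.expectation M (\<lambda>x. real (card {v\<in>J. I v x \<and> W x = j}))"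
    using expectation_card_eq_sum_prob[OF assms(1), where M = M and I = "\<lambda>v x. I v x \<and> W x = j"] by simp
  also have "(\<lambda>x. real (card {v\<in>J. I v x \<and> W x = j})) = (\<lambda>x. real j * indicator {x. W x = j} x)"
    by (auto simp: W_def indicator_def fun_eq_iff)
  finally show ?thesis by simp
qed

text \<open>The size-bias identity behind the Stein-Chen method, tested only on the indicator of \<open>{j}\<close>, so that no solution
  of the Stein equation is needed. \<open>Z v\<close> plays the role of \<open>W - 1\<close> given \<open>I v\<close>.\<close>

lemma card_prob_recursion_error:
  fixes M :: "'a pmf" and I :: "'v \<Rightarrow> 'a \<Rightarrow> bool"
  assumes J: "finite J"
  defines "W \<equiv> \<lambda>x. card {v\<in>J. I v x}"
  assumes indep: "\<And>v i. v \<in> J \<Longrightarrow>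
     measure_pmf.prob M {x. I v x \<and> Z v x = i} = measure_pmf.prob M {x. I v x} * measure_pmf.prob M {x. Z v x = i}"
  assumes j: "j \<ge> 1"
  shows "\<bar>real j * measure_pmf.prob M {x. W x = j}
           - (\<Sum>v\<in>J. measure_pmf.prob M {x. I v x}) * measure_pmf.prob M {x. W x = j - 1}\<bar>
     \<le> (\<Sum>v\<in>J. measure_pmf.prob M {x. I v x \<and> W x \<noteq> Z v x + 1}
              + measure_pmf.prob M {x. I v x} * measure_pmf.prob M {x. W x \<noteq> Z v x})"
proof -
  let ?P = "measure_pmf.prob M"
  have "\<bar>real j * ?P {x. W x = j} - (\<Sum>v\<in>J. ?P {x. I v x}) * ?P {x. W x = j - 1}\<bar>
     = \<bar>\<Sum>v\<in>J. ?P {x. I v x \<and> W x = j} - ?P {x. I v x} * ?P {x. W x = j - 1}\<bar>"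
    using sum_prob_conj_card_eq[OF J, where M = M and I = I and j = j] by (simp add: W_def sum_subtractf sum_distrib_right)
  also have "\<dots> \<le> (\<Sum>v\<in>J. \<bar>?P {x. I v x \<and> W x = j} - ?P {x. I v x} * ?P {x. W x = j - 1}\<bar>)"
    by (rule sum_abs)
  also have "\<dots> \<le> (\<Sum>v\<in>J. ?P {x. I v x \<and> W x \<noteq> Z v x + 1} + ?P {x. I v x} * ?P {x. W x \<noteq> Z v x})"
  proof (rule sum_mono)
    fix v assume v: "v \<in> J"
    have "\<bar>?P {x. I v x \<and> W x = j} - ?P {x. I v x \<and> Z v x = j - 1}\<bar>
        \<le> ?P {x. (I v x \<and> W x = j) \<noteq> (I v x \<and> Z v x = j - 1)}"
      by (rule prob_diff_le)
    also have "\<dots> \<le> ?P {x. I v x \<and> W x \<noteq> Z v x + 1}"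
      using j by (intro measure_pmf.finite_measure_mono) auto
    finally have 1: "\<bar>?P {x. I v x \<and> W x = j} - ?P {x. I v x} * ?P {x. Z v x = j - 1}\<bar>
       \<le> ?P {x. I v x \<and> W x \<noteq> Z v x + 1}"
      by (simp add: indep[OF v])
    have "\<bar>?P {x. Z v x = j - 1} - ?P {x. W x = j - 1}\<bar> \<le> ?P {x. (Z v x = j - 1) \<noteq> (W x = j - 1)}"
      by (rule prob_diff_le)
    also have "\<dots> \<le> ?P {x. W x \<noteq> Z v x}"
      by (intro measure_pmf.finite_measure_mono) auto
    finally have "?P {x. I v x} * \<bar>?P {x. Z v x = j - 1} - ?P {x. W x = j - 1}\<bar> \<le> ?P {x. I v x} * ?P {x. W x \<noteq> Z v x}"
      by (rule mult_left_mono) simp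
    then have 2: "\<bar>?P {x. I v x} * ?P {x. Z v x = j - 1} - ?P {x. I v x} * ?P {x. W x = j - 1}\<bar>
        \<le> ?P {x. I v x} * ?P {x. W x \<noteq> Z v x}"
      by (simp add: abs_mult right_diff_distrib[symmetric])
    show "\<bar>?P {x. I v x \<and> W x = j} - ?P {x. I v x} * ?P {x. W x = j - 1}\<bar>
      \<le> ?P {x. I v x \<and> W x \<noteq> Z v x + 1} + ?P {x. I v x} * ?P {x. W x \<noteq> Z v x}"
      using 1 2 by linarith
  qed
  finally show ?thesis .
qed

lemma sum_prob_eq_prob_less:
  "(\<Sum>j<J. measure_pmf.prob M {x. W x = j}) = measure_pmf.prob M {x. (W x :: nat) < J}"
proof -
  have "measure_pmf.prob M (\<Union>j\<in>{..<J}. {x. W x = j}) = (\<Sum>j<J. measure_pmf.prob M {x. W x = j})"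
    by (rule measure_pmf.finite_measure_finite_Union) (auto simp: disjoint_family_on_def)
  also have "(\<Union>j\<in>{..<J}. {x. W x = j}) = {x. W x < J}" by auto
  finally show ?thesis by simp
qed

text \<open>The recursion determines the limit up to the factor \<open>P(W = 0)\<close>; the bounded means give
  tightness, which fixes this factor.\<close>

lemma Poisson_limit_of_recursion:
  fixes M :: "nat \<Rightarrow> 'a pmf" and W :: "nat \<Rightarrow> 'a \<Rightarrow> nat" and l :: "nat \<Rightarrow> real"
  assumes rec: "\<And>j. j \<ge> 1 \<Longrightarrow> (\<lambda>n. real j * measure_pmf.prob (M n) {x. W n x = j}
                 - l n * measure_pmf.prob (M n) {x. W n x = j - 1}) \<longlonglongrightarrow> 0"
    and tail: "\<forall>\<^sub>F n in sequentially. \<forall>J>0. measure_pmf.prob (M n) {x. W n x \<ge> J} \<le> l n / real J"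
    and l: "l \<longlonglongrightarrow> lam"
  shows "(\<lambda>n. measure_pmf.prob (M n) {x. W n x < m}) \<longlonglongrightarrow> exp (- lam) * (\<Sum>i<m. lam ^ i / fact i)"
proof -
  define P where "P n j = measure_pmf.prob (M n) {x. W n x = j}" for n j
  define e where "e J = (\<Sum>i<J. lam ^ i / fact i)" for J
  have P01: "0 \<le> P n j" "P n j \<le> 1" for n j by (auto simp: P_def)
  have lam0: "lam \<ge> 0"
  proof (rule tendsto_lowerbound[OF l])
    show "\<forall>\<^sub>F n in sequentially. 0 \<le> l n"
      using tail by eventually_elim (auto dest!: spec[of _ 1] intro: order_trans[OF measure_nonneg])
  qed simp
  \<comment> \<open>The recursion divided by \<open>j + 1\<close>: each mass is asymptotically the
    Poisson multiple of the mass at 0, whose own limit is still unknown.\<close>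
  have conv: "(\<lambda>n. P n j - lam ^ j / fact j * P n 0) \<longlonglongrightarrow> 0" for j
  proof (induction j)
    case (Suc j)
    have bdd: "(\<lambda>n. (l n - lam) * P n j) \<longlonglongrightarrow> 0"
    proof (rule Lim_null_comparison)
      show "\<forall>\<^sub>F n in sequentially. norm ((l n - lam) * P n j) \<le> \<bar>l n - lam\<bar>"
        using P01 by (auto simp: abs_mult intro!: always_eventually mult_left_le)
      show "(\<lambda>n. \<bar>l n - lam\<bar>) \<longlonglongrightarrow> 0"
        using l by (simp add: tendsto_rabs_zero_iff LIM_zero)
    qed
    let ?g = "\<lambda>n. ((real (Suc j) * P n (Suc j) - l n * P n j) + (l n - lam) * P n j
        + lam * (P n j - lam ^ j / fact j * P n 0)) / real (Suc j)"
    have "?g \<longlonglongrightarrow> (0 + 0 + lam * 0) / real (Suc j)"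
      by (intro tendsto_intros bdd Suc.IH rec[of "Suc j", folded P_def, simplified diff_Suc_1]) auto
    also have "?g
        = (\<lambda>n. P n (Suc j) - lam ^ Suc j / fact (Suc j) * P n 0)"
    proof
      fix n
      have "?g n
        = (real (Suc j) * P n (Suc j) - lam ^ Suc j / fact j * P n 0) / real (Suc j)"
        by (simp add: algebra_simps)
      also have "\<dots> = P n (Suc j) - lam ^ Suc j / (real (Suc j) * fact j) * P n 0"
        by (simp add: diff_divide_distrib del: of_nat_Suc)
      finally show "?g n
        = P n (Suc j) - lam ^ Suc j / fact (Suc j) * P n 0"
        by simp
    qed
    finally show ?case by simp
  qed simp
  have sumconv: "(\<lambda>n. (\<Sum>j<J. P n j) - e J * P n 0) \<longlonglongrightarrow> 0" for J
  proof -
    have "(\<lambda>n. \<Sum>j<J. P n j - lam ^ j / fact j * P n 0) \<longlonglongrightarrow> (\<Sum>j<J. 0)"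
      by (intro tendsto_sum conv)
    then show ?thesis by (simp add: e_def sum_subtractf sum_distrib_right)
  qed
  have e_lim: "e \<longlonglongrightarrow> exp lam"
    using exp_converges[of lam] unfolding sums_def e_def by (simp add: divide_inverse_commute)
  have e_le: "e J \<le> exp lam" for J
    by (rule incseq_le[OF _ e_lim]) (auto simp: incseq_Suc_iff e_def lam0)
  have P0: "(\<lambda>n. P n 0) \<longlonglongrightarrow> exp (- lam)"
  proof (rule tendstoI)
    fix r :: real assume r: "r > 0"
    \<comment> \<open>\<open>J\<close> is fixed so that the tail of the exponential series and the
      Markov bound for the masses beyond \<open>J\<close> together stay below \<open>r / 2\<close>;
      the other half is left for the error in \<open>sumconv\<close>.\<close>
    have small: "(\<lambda>J. exp lam - e J + (lam + 1) / real J) \<longlonglongrightarrow> exp lam - exp lam + 0"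
      by (intro tendsto_intros e_lim tendsto_divide_0[OF tendsto_const] filterlim_at_top_imp_at_infinity[OF filterlim_real_sequentially])
    then have "\<forall>\<^sub>F J in sequentially. exp lam - e J + (lam + 1) / real J < r / 2"
      using r by (intro order_tendstoD(2)[where a = "r / 2"]) auto
    then have "\<forall>\<^sub>F J in sequentially. J > 0 \<and> exp lam - e J + (lam + 1) / real J < r / 2"
      by (intro eventually_conj eventually_gt_at_top)
    then obtain J where J: "J > 0" "exp lam - e J + (lam + 1) / real J < r / 2"
      by (auto simp: eventually_sequentially)
    have "\<forall>\<^sub>F n in sequentially. l n < lam + 1"
      using l by (rule order_tendstoD) simp
    moreover have "\<forall>\<^sub>F n in sequentially. \<bar>(\<Sum>j<J. P n j) - e J * P n 0\<bar> < r / 2"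
      using tendstoD[OF sumconv, of "r / 2" J] r by (simp add: dist_real_def)
    ultimately show "\<forall>\<^sub>F n in sequentially. dist (P n 0) (exp (- lam)) < r"
      using tail
    proof eventually_elim
      case (elim n)
      have "measure_pmf.prob (M n) {x. W n x < J} = 1 - measure_pmf.prob (M n) {x. W n x \<ge> J}"
      proof -
        have "{x. W n x < J} = space (M n) - {x. W n x \<ge> J}" by auto
        then show ?thesis by (metis measure_pmf.prob_compl UNIV_I sets_measure_pmf)
      qed
      then have S: "(\<Sum>j<J. P n j) \<ge> 1 - (lam + 1) / real J" "(\<Sum>j<J. P n j) \<le> 1"
        using elim(3)[rule_format, OF J(1)] elim(1) J(1) divide_strict_right_mono[of "l n" "lam + 1" "real J"]
        by (auto simp: P_def sum_prob_eq_prob_less)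
      have "\<bar>e J * P n 0 - exp lam * P n 0\<bar> = (exp lam - e J) * P n 0"
        using e_le[of J] P01[of n 0] by (simp add: left_diff_distrib[symmetric] abs_mult)
      also have "\<dots> \<le> exp lam - e J"
        using e_le[of J] P01[of n 0] by (intro mult_left_le) auto
      finally have "\<bar>exp lam * P n 0 - 1\<bar> < r"
        using S elim(2) J(2) by linarith
      moreover have "\<bar>P n 0 - exp (- lam)\<bar> = exp (- lam) * \<bar>exp lam * P n 0 - 1\<bar>"
      proof -
        have "P n 0 - exp (- lam) = exp (- lam) * (exp lam * P n 0 - 1)"
          by (simp add: right_diff_distrib mult.assoc[symmetric] exp_minus)
        then show ?thesis by (simp add: abs_mult)
      qed
      moreover have "\<dots> \<le> \<bar>exp lam * P n 0 - 1\<bar>"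
        using lam0 by (intro mult_left_le_one_le) auto
      ultimately show ?case by (simp add: dist_real_def)
    qed
  qed
  have "(\<lambda>n. ((\<Sum>j<m. P n j) - e m * P n 0) + e m * P n 0) \<longlonglongrightarrow> 0 + e m * exp (- lam)"
    by (intro tendsto_intros sumconv P0)
  then show ?thesis
    by (simp add: P_def sum_prob_eq_prob_less e_def mult.commute)
qed

section \<open>Stirling's formula\<close>

text \<open>At \<open>x = 1 / n\<close> the bound becomes (n + 1/2) ln(1 + 1/n) >= 1, which is the
  monotonicity of the Stirling remainder.\<close>

lemma ln_ge_Pade:
  fixes x :: real
  assumes "x \<ge> 0"
  shows "2 * x / (2 + x) \<le> ln (1 + x)"
proof -
  have "ln (1 + 0) - 2 * 0 / (2 + 0) \<le> ln (1 + x) - 2 * x / (2 + x)"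
  proof (rule DERIV_nonneg_imp_nondecreasing[OF assms])
    fix t :: real assume t: "0 \<le> t" "t \<le> x"
    show "\<exists>y. ((\<lambda>x. ln (1 + x) - 2 * x / (2 + x)) has_real_derivative y) (at t) \<and> 0 \<le> y"
    proof (intro exI conjI)
      show "((\<lambda>x. ln (1 + x) - 2 * x / (2 + x)) has_real_derivative
          (1 / (1 + t) - (2 * (2 + t) - 2 * t) / ((2 + t) * (2 + t)))) (at t)"
        using t by (auto intro!: derivative_eq_intros)
      show "0 \<le> 1 / (1 + t) - (2 * (2 + t) - 2 * t) / ((2 + t) * (2 + t))"
        using t by (auto simp: divide_simps) (auto simp: algebra_simps)
    qed
  qed
  then show ?thesis by simp
qed

text \<open>At \<open>t = 1 + 1 / n\<close> this gives (n + 1/2) ln(1 + 1/n) - 1 <= 1/(4n) -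
  1/(4(n+1)), a telescoping upper bound for the decrease of the Stirling remainder.\<close>

lemma ln_le_half_diff_inverse:
  fixes t :: real
  assumes "t \<ge> 1"
  shows "ln t \<le> (t - 1 / t) / 2"
proof -
  have "(1 - 1 / 1) / 2 - ln 1 \<le> (t - 1 / t) / 2 - ln t"
  proof (rule DERIV_nonneg_imp_nondecreasing[OF assms])
    fix s :: real assume s: "1 \<le> s" "s \<le> t"
    show "\<exists>y. ((\<lambda>t. (t - 1 / t) / 2 - ln t) has_real_derivative y) (at s) \<and> 0 \<le> y"
    proof (intro exI conjI)
      show "((\<lambda>t. (t - 1 / t) / 2 - ln t) has_real_derivative ((1 + 1 / s^2) / 2 - 1 / s)) (at s)"
        using s by (auto intro!: derivative_eq_intros simp: power2_eq_square)
      have eq: "(1 + 1 / s^2) / 2 - 1 / s = (1 - 1 / s)^2 / 2"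
        using s by (simp add: power2_eq_square field_simps)
      show "0 \<le> (1 + 1 / s^2) / 2 - 1 / s" unfolding eq by simp
    qed
  qed
  then show ?thesis by simp
qed

lemma wallis_prod_eq:
  "(\<Prod>k=1..n. (4*real k^2) / (4*real k^2 - 1)) = 2 ^ (4 * n) * fact n ^ 4 / (fact (2 * n) ^ 2 * (2 * real n + 1))"
proof (induction n)
  case (Suc n)
  have e: "4 * real (Suc n) ^ 2 - 1 = (2 * real n + 1) * (2 * real n + 3)"
    by (simp add: power2_eq_square algebra_simps)
  have f: "fact (2 * Suc n) = (2 * real n + 2) * ((2 * real n + 1) * fact (2 * n))"
    by (simp add: algebra_simps)
  have "(\<Prod>k=1..Suc n. (4*real k^2) / (4*real k^2 - 1))
     = 2 ^ (4 * n) * fact n ^ 4 / (fact (2 * n) ^ 2 * (2 * real n + 1))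
       * ((4*real (Suc n)^2) / ((2 * real n + 1) * (2 * real n + 3)))"
    using Suc by (simp add: e del: of_nat_Suc)
  also have "\<dots> = 2 ^ (4 * Suc n) * fact (Suc n) ^ 4 / (fact (2 * Suc n) ^ 2 * (2 * real (Suc n) + 1))"
  proof -
    define F where "F = (fact n :: real)"
    define G where "G = (fact (2 * n) :: real)"
    have "F > 0" "G > 0" by (simp_all add: F_def G_def)
    moreover have "fact (Suc n) = (real n + 1) * F" by (simp add: F_def)
    moreover have "2 * real n + 1 \<noteq> 0" "2 * real n + 3 \<noteq> 0" "real n + 1 \<noteq> 0"
      by (simp_all add: add_eq_0_iff)
    ultimately show ?thesis
      unfolding f F_def[symmetric] G_def[symmetric]
      by (simp add: divide_simps power_mult_distrib power_add) (simp add: algebra_simps power2_eq_square power4_eq_xxxx)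
  qed
  finally show ?case .
qed simp

text \<open>The remainder \<open>d\<close> decreases while \<open>d n - 1 / (4 n)\<close> increases,
  so \<open>d\<close> converges. Comparing arguments n and 2n with the Wallis product identifies the
  limit.\<close>

lemma Stirling_ln:
  "(\<lambda>n. ln (fact n) - (real n + 1 / 2) * ln (real n) + real n) \<longlonglongrightarrow> ln (2 * pi) / 2"
proof -
  define d where "d n = ln (fact n) - (real n + 1 / 2) * ln (real n) + real n" for n :: nat
  have step: "d n - d (Suc n) = (real n + 1 / 2) * ln (1 + 1 / real n) - 1" if "n \<ge> 1" for n
  proof -
    have "ln (1 + 1 / real n) = ln (real (Suc n) / real n)"
      using that by (simp add: field_simps)
    also have "\<dots> = ln (real (Suc n)) - ln (real n)"
      using that by (subst ln_div) auto
    finally have "ln (real (Suc n)) = ln (1 + 1 / real n) + ln (real n)" by linarith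
    moreover have "ln (fact (Suc n) :: real) = ln (real (Suc n)) + ln (fact n)"
      by (subst fact_Suc, subst ln_mult) auto
    ultimately have "d n - d (Suc n) = ln (fact n) - (real n + 1 / 2) * ln (real n) + real n
        - (ln (1 + 1 / real n) + ln (real n) + ln (fact n)
           - (real (Suc n) + 1 / 2) * (ln (1 + 1 / real n) + ln (real n)) + real (Suc n))"
      unfolding d_def by (simp only:)
    also have "\<dots> = (real n + 1 / 2) * ln (1 + 1 / real n) - 1"
      by (simp add: algebra_simps)
    finally show ?thesis .
  qed
  have dec: "d (Suc n) \<le> d n" if "n \<ge> 1" for n
  proof -
    have "2 * (1 / real n) / (2 + 1 / real n) \<le> ln (1 + 1 / real n)" by (rule ln_ge_Pade) simp
    then have "(real n + 1 / 2) * (2 * (1 / real n) / (2 + 1 / real n)) \<le> (real n + 1 / 2) * ln (1 + 1 / real n)"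
      by (rule mult_left_mono) simp
    moreover have "(real n + 1 / 2) * (2 * (1 / real n) / (2 + 1 / real n)) = 1"
      using that by (simp add: field_simps)
    ultimately show ?thesis using step[OF that] by linarith
  qed
  have inc: "d n - 1 / (4 * real n) \<le> d (Suc n) - 1 / (4 * real (Suc n))" if "n \<ge> 1" for n
  proof -
    have "ln (1 + 1 / real n) \<le> ((1 + 1 / real n) - 1 / (1 + 1 / real n)) / 2"
      by (rule ln_le_half_diff_inverse) simp
    then have "(real n + 1 / 2) * ln (1 + 1 / real n) \<le> (real n + 1 / 2) * (((1 + 1 / real n) - 1 / (1 + 1 / real n)) / 2)"
      by (rule mult_left_mono) simp
    also have "\<dots> = 1 + 1 / (4 * real n) - 1 / (4 * real (Suc n))"
      using that by (simp add: divide_simps) (simp add: algebra_simps)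
    finally show ?thesis using step[OF that] by linarith
  qed
  have low: "d 1 - 1 / 4 \<le> d (Suc n) - 1 / (4 * real (Suc n))" for n
  proof (induction n)
    case (Suc n)
    then show ?case using inc[of "Suc n"] by linarith
  qed simp
  have "decseq (\<lambda>n. d (Suc n))" using dec by (simp add: decseq_Suc_iff)
  moreover have "\<forall>n. d 1 - 1 / 4 \<le> d (Suc n)"
    using low by (smt (verit) divide_nonneg_nonneg of_nat_0_le_iff)
  ultimately obtain c where "(\<lambda>n. d (Suc n)) \<longlonglongrightarrow> c"
    using decseq_convergent[of "\<lambda>n. d (Suc n)" "d 1 - 1 / 4"] by metis
  then have c: "d \<longlonglongrightarrow> c" by (rule LIMSEQ_imp_Suc)
  have "(\<lambda>n. d (2 * n)) \<longlonglongrightarrow> c"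
    using LIMSEQ_subseq_LIMSEQ[OF c, of "\<lambda>n. 2 * n"] by (simp add: strict_mono_def o_def)
  \<comment> \<open>In this combination the terms of order n ln n and n cancel except for a power of
    2, and the factor n / (2 (2n + 1)) turns the exponential into the Wallis product exactly. Hence
    exp(2c) / 4 = pi / 2.\<close>
  with c have "(\<lambda>n. exp (4 * d n - 2 * d (2 * n))) \<longlonglongrightarrow> exp (4 * c - 2 * c)"
    by (intro tendsto_intros)
  moreover have "(\<lambda>n. real n / (2 * (2 * real n + 1))) \<longlonglongrightarrow> 1 / 4"
    by real_asymp
  ultimately have "(\<lambda>n. exp (4 * d n - 2 * d (2 * n)) * (real n / (2 * (2 * real n + 1)))) \<longlonglongrightarrow> exp (4 * c - 2 * c) * (1 / 4)"
    by (rule tendsto_mult)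
  moreover have "\<forall>\<^sub>F n in sequentially. exp (4 * d n - 2 * d (2 * n)) * (real n / (2 * (2 * real n + 1)))
      = (\<Prod>k=1..n. (4*real k^2) / (4*real k^2 - 1))"
    using eventually_gt_at_top[of 0]
  proof eventually_elim
    case (elim n)
    have ln2: "ln (real (2 * n)) = ln 2 + ln (real n)" using elim by (simp add: ln_mult)
    have "4 * d n - 2 * d (2 * n) = 4 * ln (fact n) - 2 * ln (fact (2 * n)) - ln (real n) + (4 * real n + 1) * ln 2"
      unfolding d_def ln2 by (simp add: algebra_simps)
    also have "exp \<dots> = fact n ^ 4 / fact (2 * n) ^ 2 / real n * (2 ^ (4 * n + 1))"
    proof -
      have "exp (4 * ln (fact n :: real)) = fact n ^ 4" "exp (2 * ln (fact (2 * n) :: real)) = fact (2 * n) ^ 2"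
        using exp_of_nat_mult[of 4 "ln (fact n :: real)"] exp_of_nat_mult[of 2 "ln (fact (2 * n) :: real)"] by simp_all
      moreover have "exp ((4 * real n + 1) * ln 2) = (2::real) ^ (4 * n + 1)"
        using exp_of_nat_mult[of "4 * n + 1" "ln 2 :: real"] by (simp add: algebra_simps)
      ultimately show ?thesis using elim by (simp add: exp_diff exp_add)
    qed
    finally have E: "exp (4 * d n - 2 * d (2 * n)) = fact n ^ 4 / fact (2 * n) ^ 2 / real n * (2 ^ (4 * n + 1))" .
    have "2 * real n + 1 \<noteq> 0" by linarith
    then show ?case using elim unfolding E wallis_prod_eq by (simp add: divide_simps power_add)
  qed
  ultimately have "(\<lambda>n. \<Prod>k=1..n. (4*real k^2) / (4*real k^2 - 1)) \<longlonglongrightarrow> exp (2 * c) / 4"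
    by (simp add: filterlim_cong)
  then have "exp (2 * c) / 4 = pi / 2" using LIMSEQ_unique wallis by blast
  then have "exp (2 * c) = 2 * pi" by simp
  then have "2 * c = ln (2 * pi)" by (metis ln_exp)
  then have "c = ln (2 * pi) / 2" by simp
  with c show ?thesis unfolding d_def by simp
qed

text \<open>The cubic coefficient is -1/6, so the constant 1 has room to spare near 0; at 0 itself
  both sides vanish.\<close>

lemma eventually_entropy_Taylor:
  "\<forall>\<^sub>F u in nhds (0::real). \<bar>(1 + u) * ln (1 + u) - u - u^2 / 2\<bar> \<le> \<bar>u\<bar>^3"
proof -
  have "((\<lambda>u::real. ((1 + u) * ln (1 + u) - u - u^2 / 2) / u^3) \<longlongrightarrow> - 1 / 6) (at 0)"
    by real_asymp
  then have "\<forall>\<^sub>F u in at (0::real). dist (((1 + u) * ln (1 + u) - u - u^2 / 2) / u^3) (- 1 / 6) < 1 / 2"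
    by (rule tendstoD) simp
  then have "\<forall>\<^sub>F u in at (0::real). \<bar>(1 + u) * ln (1 + u) - u - u^2 / 2\<bar> \<le> \<bar>u\<bar>^3"
    using eventually_neq_at_within[of "0::real" 0 UNIV]
  proof eventually_elim
    case (elim u)
    have "\<bar>((1 + u) * ln (1 + u) - u - u^2 / 2) / u^3\<bar> \<le> 1"
      using elim(1) unfolding dist_real_def by linarith
    then show ?case using elim(2) by (simp add: abs_divide power_abs abs_mult divide_simps split: if_splits)
  qed
  then show ?thesis by (auto simp: eventually_nhds_conv_at)
qed

section \<open>Ratios of consecutive binomial weights\<close>

text \<open>A real formula for every \<open>i\<close>: it is 0 at \<open>i = N\<close> and negative
  beyond, where the weights vanish anyway. Thus neither the recursion for the weights nor the
  monotonicity in \<open>i\<close> needs a range condition.\<close>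

definition binomial_ratio :: "nat \<Rightarrow> real \<Rightarrow> nat \<Rightarrow> real" where
  "binomial_ratio N q i = (real N - real i) * q / ((real i + 1) * (1 - q))"

lemma pmf_binomial_Suc:
  assumes "0 < q" "q < 1"
  shows "pmf (binomial_pmf N q) (Suc i) = binomial_ratio N q i * pmf (binomial_pmf N q) i"
proof (cases "i < N")
  case True
  have "(real i + 1) * real (N choose Suc i) = (real N - real i) * real (N choose i)"
  proof -
    have "Suc i * (N choose Suc i) = (N - i) * (N choose i)"
      using binomial_absorb_comp[of N i] binomial_absorption[of i N] True
      by (metis binomial_absorption mult.commute binomial_absorb_comp)
    then have "real (Suc i * (N choose Suc i)) = real ((N - i) * (N choose i))" by simp
    moreover have "real i + 1 = real (Suc i)" by simp
    ultimately show ?thesis using True by (simp only: of_nat_mult) (simp add: of_nat_diff)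
  qed
  moreover have "real (N choose Suc i) = (real i + 1) * real (N choose Suc i) / (real i + 1)" by simp
  ultimately have "real (N choose Suc i) = (real N - real i) / (real i + 1) * real (N choose i)"
    by simp
  moreover have "N - i = Suc (N - Suc i)" using True by simp
  ultimately show ?thesis
    using assms by (simp add: binomial_ratio_def)
next
  case False
  then show ?thesis using assms by (cases "i = N") (auto simp: binomial_ratio_def binomial_eq_0)
qed

lemma binomial_ratio_antimono:
  assumes "0 < q" "q < 1" "i \<le> j"
  shows "binomial_ratio N q j \<le> binomial_ratio N q i"
proof -
  have "(real N - real j) / (real j + 1) = (real N + 1) / (real j + 1) - 1"
    by (simp add: field_simps)
  also have "\<dots> \<le> (real N + 1) / (real i + 1) - 1"
    using assms(3) by (simp add: frac_le)
  also have "\<dots> = (real N - real i) / (real i + 1)"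
    by (simp add: field_simps)
  finally have "(real N - real j) / (real j + 1) * (q / (1 - q)) \<le> (real N - real i) / (real i + 1) * (q / (1 - q))"
    using assms by (intro mult_right_mono) auto
  then show ?thesis by (simp add: binomial_ratio_def)
qed

lemma prob_binomial_ge_eq_sum:
  assumes "0 < q" "q < 1" "j \<le> N"
  shows "measure_pmf.prob (binomial_pmf N q) {i. i \<ge> j} = (\<Sum>i\<le>N - j. pmf (binomial_pmf N q) (j + i))"
proof -
  have "measure_pmf.prob (binomial_pmf N q) {i. i \<ge> j} = measure_pmf.prob (binomial_pmf N q) {j..N}"
    using assms by (intro measure_prob_cong_0) (auto simp: not_le binomial_eq_0)
  also have "\<dots> = (\<Sum>i\<in>{j..N}. pmf (binomial_pmf N q) i)"
    by (simp add: measure_measure_pmf_finite)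
  also have "\<dots> = (\<Sum>i\<le>N - j. pmf (binomial_pmf N q) (j + i))"
    using assms(3) by (intro sum.reindex_bij_witness[of _ "\<lambda>i. j + i" "\<lambda>i. i - j"]) auto
  finally show ?thesis .
qed

text \<open>The ratios decrease, so beyond \<open>j\<close> the weights are dominated by a geometric
  series with the ratio at \<open>j\<close>.\<close>

lemma prob_binomial_ge_upper:
  assumes "0 < q" "q < 1" "j \<le> N" "binomial_ratio N q j < 1"
  shows "measure_pmf.prob (binomial_pmf N q) {i. i \<ge> j}
     \<le> pmf (binomial_pmf N q) j / (1 - binomial_ratio N q j)"
proof -
  let ?r = "binomial_ratio N q j" and ?P = "pmf (binomial_pmf N q)"
  have r0: "?r \<ge> 0" using assms by (simp add: binomial_ratio_def)
  have le: "?P (j + i) \<le> ?r ^ i * ?P j" for i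
  proof (induction i)
    case (Suc i)
    have "?P (j + Suc i) = binomial_ratio N q (j + i) * ?P (j + i)"
      using pmf_binomial_Suc[OF assms(1,2), of N "j + i"] by simp
    also have "\<dots> \<le> ?r * ?P (j + i)"
      by (intro mult_right_mono binomial_ratio_antimono) (use assms in auto)
    also have "\<dots> \<le> ?r * (?r ^ i * ?P j)" by (rule mult_left_mono[OF Suc r0])
    finally show ?case by (simp add: mult.assoc)
  qed simp
  have "(\<Sum>i\<le>N - j. ?P (j + i)) \<le> (\<Sum>i\<le>N - j. ?r ^ i * ?P j)" by (rule sum_mono[OF le])
  also have "\<dots> = (\<Sum>i\<le>N - j. ?r ^ i) * ?P j" by (simp add: sum_distrib_right)
  also have "\<dots> \<le> 1 / (1 - ?r) * ?P j"
  proof (rule mult_right_mono)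
    have "(\<Sum>i<Suc (N - j). ?r ^ i) \<le> (\<Sum>i. ?r ^ i)"
      by (rule sum_le_suminf) (use r0 assms in \<open>auto intro: summable_geometric\<close>)
    then show "(\<Sum>i\<le>N - j. ?r ^ i) \<le> 1 / (1 - ?r)"
      using r0 assms by (simp add: suminf_geometric lessThan_Suc_atMost)
  qed simp
  finally show ?thesis using prob_binomial_ge_eq_sum[OF assms(1-3)] by simp
qed

text \<open>Among the first \<open>M\<close> terms every ratio is at least the one at
  \<open>j + M\<close>. The truncated series loses only the \<open>M\<close>-th power of that ratio,
  so \<open>M\<close> must be long enough to make it small and short enough to keep the ratio close
  to that at \<open>j\<close>.\<close>

lemma prob_binomial_ge_lower:
  assumes "0 < q" "q < 1" "j + M \<le> N" "binomial_ratio N q (j + M) < 1"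
  shows "pmf (binomial_pmf N q) j * (1 - binomial_ratio N q (j + M) ^ M) / (1 - binomial_ratio N q (j + M))
     \<le> measure_pmf.prob (binomial_pmf N q) {i. i \<ge> j}"
proof -
  let ?r = "binomial_ratio N q (j + M)" and ?P = "pmf (binomial_pmf N q)"
  have r0: "?r \<ge> 0"
    unfolding binomial_ratio_def using assms by (intro divide_nonneg_nonneg mult_nonneg_nonneg) auto
  have le: "i \<le> M \<Longrightarrow> ?r ^ i * ?P j \<le> ?P (j + i)" for i
  proof (induction i)
    case (Suc i)
    have "?r * (?r ^ i * ?P j) \<le> ?r * ?P (j + i)" by (rule mult_left_mono) (use Suc r0 in auto)
    also have "\<dots> \<le> binomial_ratio N q (j + i) * ?P (j + i)"
      by (intro mult_right_mono binomial_ratio_antimono) (use assms Suc in auto)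
    also have "\<dots> = ?P (j + Suc i)"
      using pmf_binomial_Suc[OF assms(1,2), of N "j + i"] by simp
    finally show ?case by (simp add: mult.assoc)
  qed simp
  have "?P j * (1 - ?r ^ M) / (1 - ?r) = (\<Sum>i<M. ?r ^ i * ?P j)"
    using assms(4) by (simp add: sum_distrib_right[symmetric] sum_gp_strict)
  also have "\<dots> \<le> (\<Sum>i<M. ?P (j + i))" by (rule sum_mono) (use le in auto)
  also have "\<dots> \<le> (\<Sum>i\<le>N - j. ?P (j + i))"
    by (rule sum_mono2) (use assms in auto)
  finally show ?thesis using prob_binomial_ge_eq_sum[OF assms(1,2), of j N] assms(3) by simp
qed

text \<open>An exact identity: \<open>u\<close> and \<open>v\<close> are the relative deviations of
  the numbers of successes and failures from their means, so A (1 + u) = j and B (1 + v) = N - j.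
  Each term on the right can then be passed to the limit separately.\<close>

lemma pmf_binomial_ln:
  assumes "0 < q" "q < 1" "0 < j" "j < N"
  defines "d \<equiv> \<lambda>n::nat. ln (fact n) - (real n + 1 / 2) * ln (real n) + real n"
  defines "A \<equiv> real N * q" and "B \<equiv> real N * (1 - q)"
  defines "u \<equiv> (real j - A) / A" and "v \<equiv> (A - real j) / B"
  shows "ln (pmf (binomial_pmf N q) j) = d N - d j - d (N - j) - ln (A * B / real N) / 2
     - ln (1 + u) / 2 - ln (1 + v) / 2 - A * ((1 + u) * ln (1 + u)) - B * ((1 + v) * ln (1 + v))"
proof -
  have N0: "real N > 0" and AB: "A > 0" "B > 0" using assms by (auto simp: A_def B_def)
  have u: "1 + u = real j / A" using AB by (simp add: u_def field_simps)
  have "1 + v = (B + A - real j) / B" using AB by (simp add: v_def field_simps)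
  also have "B + A - real j = real (N - j)"
    using assms(4) by (simp add: A_def B_def of_nat_diff algebra_simps)
  finally have v: "1 + v = real (N - j) / B" .
  have j: "real j > 0" "real (N - j) > 0" using assms by auto
  have lu: "ln (1 + u) = ln (real j) - ln A" using u AB j by (simp add: ln_div)
  have lv: "ln (1 + v) = ln (real (N - j)) - ln B" using v AB j by (simp add: ln_div)
  have Au: "A * (1 + u) = real j" "B * (1 + v) = real (N - j)" using u v AB by auto
  have lA: "ln A = ln (real N) + ln q" "ln B = ln (real N) + ln (1 - q)"
    using assms by (auto simp: A_def B_def ln_mult)
  have lAB: "ln (A * B / real N) = ln A + ln B - ln (real N)"
    using AB N0 by (simp add: ln_div ln_mult)
  have "real (N choose j) = fact N / (fact j * fact (N - j))"
    using assms(4) by (simp add: binomial_fact)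
  then have "ln (pmf (binomial_pmf N q) j) = ln (fact N / (fact j * fact (N - j)) * q ^ j * (1 - q) ^ (N - j))"
    using assms by simp
  also have "\<dots> = ln (fact N) - ln (fact j) - ln (fact (N - j)) + real j * ln q + real (N - j) * ln (1 - q)"
    using assms by (simp add: ln_mult ln_div ln_realpow)
  finally have L: "ln (pmf (binomial_pmf N q) j) = \<dots>" .
  have dN: "d N - d j - d (N - j) = ln (fact N) - ln (fact j) - ln (fact (N - j))
      - (real N + 1/2) * ln (real N) + (real j + 1/2) * ln (real j) + (real (N - j) + 1 / 2) * ln (real (N - j))"
    using assms(4) by (simp add: d_def of_nat_diff)
  have A1: "A * ((1 + u) * ln (1 + u)) = real j * (ln (real j) - ln A)"
    unfolding mult.assoc[symmetric] Au lu ..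
  have B1: "B * ((1 + v) * ln (1 + v)) = real (N - j) * (ln (real (N - j)) - ln B)"
    unfolding mult.assoc[symmetric] Au lv ..
  have Nj: "real N = real j + real (N - j)" using assms(4) by simp
  show ?thesis
    unfolding L dN A1 B1 unfolding lAB lu lv lA unfolding Nj
    by (simp add: algebra_simps add_divide_distrib diff_divide_distrib)
qed

section \<open>Moderate deviations of the binomial distribution\<close>

lemma Lim_null_le:
  fixes f g :: "nat \<Rightarrow> real"
  assumes "g \<longlonglongrightarrow> 0" "\<forall>\<^sub>F n in sequentially. \<bar>f n\<bar> \<le> g n"
  shows "f \<longlonglongrightarrow> 0"
  using assms(2) by (intro Lim_null_comparison[OF _ assms(1)]) simp

text \<open>The deviation is \<open>x\<close> standard deviations \<open>s\<close>. The assumptions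
  \<open>xA\<close> and \<open>xB\<close> bound the cubic Taylor terms of the entropies of successes
  and failures, which is what a Gaussian tail with relative error o(1) requires.\<close>

locale binomial_moderate =
  fixes N j :: "nat \<Rightarrow> nat" and q :: "nat \<Rightarrow> real"
  fixes A B s x u v :: "nat \<Rightarrow> real"
  defines "A \<equiv> \<lambda>n. real (N n) * q n"
    and "B \<equiv> \<lambda>n. real (N n) * (1 - q n)"
    and "s \<equiv> \<lambda>n. sqrt (real (N n) * q n * (1 - q n))"
    and "x \<equiv> \<lambda>n. (real (j n) - real (N n) * q n) / sqrt (real (N n) * q n * (1 - q n))"
    and "u \<equiv> \<lambda>n. (real (j n) - real (N n) * q n) / (real (N n) * q n)"
    and "v \<equiv> \<lambda>n. (real (N n) * q n - real (j n)) / (real (N n) * (1 - q n))"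
  assumes q01: "\<forall>\<^sub>F n in sequentially. 0 < q n \<and> q n < 1"
    and x_top: "filterlim x at_top sequentially"
    and xA: "(\<lambda>n. x n ^ 3 / sqrt (A n)) \<longlonglongrightarrow> 0"
    and xB: "(\<lambda>n. x n ^ 3 / sqrt (B n)) \<longlonglongrightarrow> 0"
begin

lemma basic:
  "\<forall>\<^sub>F n in sequentially. 0 < q n \<and> q n < 1 \<and> x n \<ge> 1 \<and> A n > 0 \<and> B n > 0 \<and> s n > 0
     \<and> real (N n) > 0 \<and> A n * B n / real (N n) = s n ^ 2 \<and> real (j n) - A n = x n * s n
     \<and> u n = x n * s n / A n \<and> v n = - (x n * s n / B n) \<and> s n \<le> sqrt (A n) \<and> s n \<le> sqrt (B n)
     \<and> 1 / s n \<le> 1 / sqrt (A n) + 1 / sqrt (B n) \<and> s n ^ 2 = A n * (1 - q n)"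
proof -
  have "\<forall>\<^sub>F n in sequentially. x n \<ge> 1"
    using x_top by (simp add: filterlim_at_top)
  with q01 show ?thesis
  proof eventually_elim
    case (elim n)
    \<comment> \<open>For \<open>N n = 0\<close> the quotient defining \<open>x n\<close> has
      denominator 0 and equals 0, against \<open>x n >= 1\<close>.\<close>
    have "N n \<noteq> 0"
      using elim by (intro notI) (simp add: x_def)
    then have N0: "real (N n) > 0" by simp
    have A0: "A n > 0" "B n > 0" using N0 elim by (auto simp: A_def B_def)
    have s0: "s n > 0" using N0 elim by (auto simp: s_def)
    have s2: "s n ^ 2 = A n * (1 - q n)" "s n ^ 2 = B n * q n"
      using N0 elim by (auto simp: s_def A_def B_def)
    have 1: "A n * B n / real (N n) = s n ^ 2"
      using N0 s2(1) by (simp add: A_def B_def)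
    have 2: "real (j n) - A n = x n * s n"
      using s0 unfolding x_def A_def s_def by (metis eq_divide_eq less_irrefl)
    have "A n * (1 - q n) \<le> A n" "B n * q n \<le> B n"
      using elim A0 by (auto intro!: mult_left_le)
    then have "s n ^ 2 \<le> A n" "s n ^ 2 \<le> B n"
      using s2 by simp_all
    then have 3: "s n \<le> sqrt (A n)" "s n \<le> sqrt (B n)"
      by (auto intro: real_le_rsqrt)
    \<comment> \<open>As A + B = N and s^2 = A B / N, the inverse variance splits as 1/A +
      1/B.\<close>
    have "1 / s n = sqrt (1 / A n + 1 / B n)"
    proof (rule real_sqrt_unique[symmetric])
      have "(1 / s n)^2 = real (N n) / (A n * B n)"
        using 1 by (simp add: power_divide flip: 1)
      also have "\<dots> = 1 / A n + 1 / B n"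
        using A0 by (simp add: field_simps) (simp add: A_def B_def algebra_simps)
      finally show "(1 / s n)^2 = 1 / A n + 1 / B n" .
    qed (use s0 in auto)
    also have "\<dots> \<le> sqrt (1 / A n) + sqrt (1 / B n)"
      using A0 by (intro sqrt_add_le_add_sqrt) auto
    also have "\<dots> = 1 / sqrt (A n) + 1 / sqrt (B n)"
      by (simp add: real_sqrt_divide)
    finally have 4: "1 / s n \<le> \<dots>" .
    have "u n = (real (j n) - A n) / A n" "v n = - ((real (j n) - A n) / B n)"
      by (simp_all add: u_def v_def A_def B_def minus_divide_left)
    then have 5: "u n = x n * s n / A n" "v n = - (x n * s n / B n)"
      unfolding 2 by auto
    show ?case
      using elim N0 A0 s0 s2(1) 1 2 3 4 5 by blast
  qed
qed

lemma x_div_sqrt: "(\<lambda>n. x n / sqrt (A n)) \<longlonglongrightarrow> 0" "(\<lambda>n. x n / sqrt (B n)) \<longlonglongrightarrow> 0"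
  "(\<lambda>n. 1 / sqrt (A n)) \<longlonglongrightarrow> 0" "(\<lambda>n. 1 / sqrt (B n)) \<longlonglongrightarrow> 0"
proof -
  have pow: "x n \<le> x n ^ 3" "1 \<le> x n ^ 3" if "x n \<ge> 1" for n
    using that self_le_power[of "x n" 3] by auto
  show "(\<lambda>n. x n / sqrt (A n)) \<longlonglongrightarrow> 0" "(\<lambda>n. 1 / sqrt (A n)) \<longlonglongrightarrow> 0"
    using basic by (intro Lim_null_le[OF xA]; force elim!: eventually_mono simp: pow divide_right_mono)+
  show "(\<lambda>n. x n / sqrt (B n)) \<longlonglongrightarrow> 0" "(\<lambda>n. 1 / sqrt (B n)) \<longlonglongrightarrow> 0"
    using basic by (intro Lim_null_le[OF xB]; force elim!: eventually_mono simp: pow divide_right_mono)+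
qed

lemma inverse_lims: "(\<lambda>n. 1 / A n) \<longlonglongrightarrow> 0" "(\<lambda>n. 1 / B n) \<longlonglongrightarrow> 0" "(\<lambda>n. 1 / s n) \<longlonglongrightarrow> 0"
  "(\<lambda>n. 1 / x n) \<longlonglongrightarrow> 0" "(\<lambda>n. 1 / (x n * s n)) \<longlonglongrightarrow> 0" "(\<lambda>n. s n / A n) \<longlonglongrightarrow> 0"
proof -
  have "(\<lambda>n. 1 / sqrt (A n) * (1 / sqrt (A n))) \<longlonglongrightarrow> 0 * 0"
    by (intro tendsto_mult x_div_sqrt)
  then show A: "(\<lambda>n. 1 / A n) \<longlonglongrightarrow> 0"
    by (rule Lim_null_le[OF tendsto_eq_rhs]) (use basic in \<open>auto elim!: eventually_mono\<close>)
  have "(\<lambda>n. 1 / sqrt (B n) * (1 / sqrt (B n))) \<longlonglongrightarrow> 0 * 0"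
    by (intro tendsto_mult x_div_sqrt)
  then show "(\<lambda>n. 1 / B n) \<longlonglongrightarrow> 0"
    by (rule Lim_null_le[OF tendsto_eq_rhs]) (use basic in \<open>auto elim!: eventually_mono\<close>)
  have "(\<lambda>n. 1 / sqrt (A n) + 1 / sqrt (B n)) \<longlonglongrightarrow> 0 + 0"
    by (intro tendsto_add x_div_sqrt)
  then show S: "(\<lambda>n. 1 / s n) \<longlonglongrightarrow> 0"
    by (rule Lim_null_le[OF tendsto_eq_rhs]) (use basic in \<open>auto elim!: eventually_mono\<close>)
  show X: "(\<lambda>n. 1 / x n) \<longlonglongrightarrow> 0"
    by (intro tendsto_divide_0[OF tendsto_const] filterlim_at_top_imp_at_infinity x_top)
  have "(\<lambda>n. 1 / x n * (1 / s n)) \<longlonglongrightarrow> 0 * 0" by (intro tendsto_mult S X)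
  then show "(\<lambda>n. 1 / (x n * s n)) \<longlonglongrightarrow> 0" by simp
  show "(\<lambda>n. s n / A n) \<longlonglongrightarrow> 0"
  proof (rule Lim_null_le[OF x_div_sqrt(3)])
    show "\<forall>\<^sub>F n in sequentially. \<bar>s n / A n\<bar> \<le> 1 / sqrt (A n)"
      using basic
    proof eventually_elim
      case (elim n)
      then have "s n / A n \<le> sqrt (A n) / A n" by (intro divide_right_mono) auto
      also have "\<dots> = 1 / sqrt (A n)" using elim by (simp add: field_simps)
      finally show ?case using elim by simp
    qed
  qed
qed

lemma u_lim: "u \<longlonglongrightarrow> 0" and v_lim: "v \<longlonglongrightarrow> 0"
proof -
  show "u \<longlonglongrightarrow> 0"
  proof (rule Lim_null_le[OF x_div_sqrt(1)])
    show "\<forall>\<^sub>F n in sequentially. \<bar>u n\<bar> \<le> x n / sqrt (A n)"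
      using basic
    proof eventually_elim
      case (elim n)
      then have "x n * s n / A n \<le> x n * sqrt (A n) / A n" by (intro divide_right_mono mult_left_mono) auto
      also have "\<dots> = x n / sqrt (A n)" using elim by (simp add: field_simps)
      finally show ?case using elim by simp
    qed
  qed
  show "v \<longlonglongrightarrow> 0"
  proof (rule Lim_null_le[OF x_div_sqrt(2)])
    show "\<forall>\<^sub>F n in sequentially. \<bar>v n\<bar> \<le> x n / sqrt (B n)"
      using basic
    proof eventually_elim
      case (elim n)
      then have "x n * s n / B n \<le> x n * sqrt (B n) / B n" by (intro divide_right_mono mult_left_mono) auto
      also have "\<dots> = x n / sqrt (B n)" using elim by (simp add: field_simps)
      finally show ?case using elim by simp
    qed
  qed
qed

text \<open>As |u| = x s / A and s <= sqrt A, the Taylor error A |u|^3 is at most x^3 / sqrt A;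
  likewise for the failures.\<close>

lemma entropy_error:
  "(\<lambda>n. A n * ((1 + u n) * ln (1 + u n) - u n - u n ^ 2 / 2)) \<longlonglongrightarrow> 0"
  "(\<lambda>n. B n * ((1 + v n) * ln (1 + v n) - v n - v n ^ 2 / 2)) \<longlonglongrightarrow> 0"
proof -
  have cube: "a * (x n * s n / a) ^ 3 \<le> x n ^ 3 / sqrt a" if "x n \<ge> 1" "a > 0" "s n \<le> sqrt a" "s n > 0" for a n
  proof -
    have "a * (x n * s n / a) ^ 3 \<le> a * (x n * sqrt a / a) ^ 3"
      using that by (intro mult_left_mono power_mono divide_right_mono) auto
    also have "x n * sqrt a / a = x n / sqrt a" using that by (simp add: field_simps)
    also have "a * (x n / sqrt a) ^ 3 = x n ^ 3 / sqrt a"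
      using that by (simp add: power_divide power3_eq_cube)
    finally show ?thesis .
  qed
  have err: "\<bar>a * ((1 + z) * ln (1 + z) - z - z ^ 2 / 2)\<bar> \<le> x n ^ 3 / sqrt a"
    if "\<bar>(1 + z) * ln (1 + z) - z - z ^ 2 / 2\<bar> \<le> \<bar>z\<bar> ^ 3" "\<bar>z\<bar> = x n * s n / a"
      "x n \<ge> 1" "a > 0" "s n \<le> sqrt a" "s n > 0" for a z n
  proof -
    have "\<bar>a * ((1 + z) * ln (1 + z) - z - z ^ 2 / 2)\<bar> \<le> a * \<bar>z\<bar> ^ 3"
      using that by (simp add: abs_mult)
    also have "\<dots> \<le> x n ^ 3 / sqrt a" unfolding that(2) by (rule cube) (use that in auto)
    finally show ?thesis .
  qed
  show "(\<lambda>n. A n * ((1 + u n) * ln (1 + u n) - u n - u n ^ 2 / 2)) \<longlonglongrightarrow> 0"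
  proof (rule Lim_null_le[OF xA])
    show "\<forall>\<^sub>F n in sequentially. \<bar>A n * ((1 + u n) * ln (1 + u n) - u n - u n ^ 2 / 2)\<bar> \<le> x n ^ 3 / sqrt (A n)"
      using basic eventually_compose_filterlim[OF eventually_entropy_Taylor u_lim]
    proof eventually_elim
      case (elim n)
      show ?case by (rule err) (use elim in auto)
    qed
  qed
  show "(\<lambda>n. B n * ((1 + v n) * ln (1 + v n) - v n - v n ^ 2 / 2)) \<longlonglongrightarrow> 0"
  proof (rule Lim_null_le[OF xB])
    show "\<forall>\<^sub>F n in sequentially. \<bar>B n * ((1 + v n) * ln (1 + v n) - v n - v n ^ 2 / 2)\<bar> \<le> x n ^ 3 / sqrt (B n)"
      using basic eventually_compose_filterlim[OF eventually_entropy_Taylor v_lim]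
    proof eventually_elim
      case (elim n)
      show ?case by (rule err) (use elim in auto)
    qed
  qed
qed

text \<open>Relative deviations below 1/2 leave at least half of either mean, so all three arguments
  of Stirling's formula tend to infinity.\<close>

lemma j_bounds:
  "\<forall>\<^sub>F n in sequentially. 0 < j n \<and> j n < N n \<and> A n / 2 \<le> real (j n) \<and> B n / 2 \<le> real (N n - j n)"
proof -
  have "\<forall>\<^sub>F n in sequentially. \<bar>u n\<bar> < 1 / 2" "\<forall>\<^sub>F n in sequentially. \<bar>v n\<bar> < 1 / 2"
    using tendstoD[OF u_lim, of "1/2"] tendstoD[OF v_lim, of "1/2"] by (simp_all add: dist_real_def)
  with basic show ?thesis
  proof eventually_elim
    case (elim n)
    have "A n * (1 + u n) = real (j n)" using elim by (simp add: field_simps)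
    moreover have "A n * (1 / 2) \<le> A n * (1 + u n)" using elim by (intro mult_left_mono) auto
    ultimately have 1: "A n / 2 \<le> real (j n)" by simp
    have "B n * (1 + v n) = B n - (real (j n) - A n)" using elim by (simp add: field_simps)
    also have "\<dots> = real (N n) - real (j n)" by (simp add: A_def B_def algebra_simps)
    finally have "B n * (1 + v n) = real (N n) - real (j n)" .
    moreover have "B n * (1 / 2) \<le> B n * (1 + v n)" using elim by (intro mult_left_mono) auto
    ultimately have 2: "B n / 2 \<le> real (N n) - real (j n)" by simp
    have "j n > 0" using 1 elim by (cases "j n") auto
    moreover have "j n < N n" using 2 elim by linarith
    ultimately show ?case using 1 2 by (auto simp: of_nat_diff)
  qed
qed

lemma lims_top: "filterlim j at_top sequentially" "filterlim (\<lambda>n. N n - j n) at_top sequentially" "filterlim N at_top sequentially"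
proof -
  have top: "filterlim f at_top sequentially"
    if "(\<lambda>n. 1 / f n) \<longlonglongrightarrow> 0" "\<forall>\<^sub>F n in sequentially. f n > 0" for f :: "nat \<Rightarrow> real"
    using filterlim_inverse_at_top[OF that(1)] that(2) by (simp add: eventually_mono)
  have A: "filterlim A at_top sequentially" "filterlim B at_top sequentially"
    using basic by (auto intro!: top inverse_lims elim!: eventually_mono)
  have half: "filterlim (\<lambda>n. f n / 2) at_top sequentially" if "filterlim f at_top sequentially" for f :: "nat \<Rightarrow> real"
    using filterlim_tendsto_pos_mult_at_top[OF tendsto_const[of "1/2"] _ that] by simp
  show j: "filterlim j at_top sequentially"
    unfolding filterlim_sequentially_iff_filterlim_real
    by (rule filterlim_at_top_mono[OF half[OF A(1)]]) (use j_bounds in \<open>auto elim!: eventually_mono\<close>)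
  show "filterlim (\<lambda>n. N n - j n) at_top sequentially"
    unfolding filterlim_sequentially_iff_filterlim_real
    by (rule filterlim_at_top_mono[OF half[OF A(2)]]) (use j_bounds in \<open>auto elim!: eventually_mono\<close>)
  show "filterlim N at_top sequentially"
    by (rule filterlim_at_top_mono[OF j]) (use j_bounds in \<open>auto elim!: eventually_mono\<close>)
qed

text \<open>The linear entropy terms cancel because A u + B v = 0, and the quadratic ones add up to
  x^2 / 2 because 1/A + 1/B = 1/s^2. One Stirling constant survives of the three, which gives the
  factor sqrt(2 pi).\<close>

lemma pmf_asymp:
  "(\<lambda>n. pmf (binomial_pmf (N n) (q n)) (j n) * (sqrt (2 * pi) * s n * exp (x n ^ 2 / 2))) \<longlonglongrightarrow> 1"
proof -
  define d where "d n = ln (fact n) - (real n + 1 / 2) * ln (real n) + real n" for n :: nat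
  define c where "c = ln (2 * pi) / 2"
  have d: "d \<longlonglongrightarrow> c" using Stirling_ln by (simp add: d_def[abs_def] c_def)
  note dc = filterlim_compose[OF d]
  let ?E = "\<lambda>n. d (N n) - d (j n) - d (N n - j n) + c - ln (1 + u n) / 2 - ln (1 + v n) / 2
     - A n * ((1 + u n) * ln (1 + u n) - u n - u n ^ 2 / 2) - B n * ((1 + v n) * ln (1 + v n) - v n - v n ^ 2 / 2)"
  have "?E \<longlonglongrightarrow> c - c - c + c - ln (1 + 0) / 2 - ln (1 + 0) / 2 - 0 - 0"
    by (intro tendsto_diff tendsto_add dc lims_top tendsto_const tendsto_divide tendsto_ln u_lim v_lim entropy_error) auto
  then have "(\<lambda>n. exp (?E n)) \<longlonglongrightarrow> exp 0"
    by (intro tendsto_exp) simp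
  moreover have "\<forall>\<^sub>F n in sequentially. exp (?E n) =
      pmf (binomial_pmf (N n) (q n)) (j n) * (sqrt (2 * pi) * s n * exp (x n ^ 2 / 2))"
    using basic j_bounds
  proof eventually_elim
    case (elim n)
    let ?p = "pmf (binomial_pmf (N n) (q n)) (j n)"
    have p0: "?p > 0" using elim by simp
    have s2: "A n * B n / real (N n) = s n ^ 2" using elim by blast
    have "ln ?p = d (N n) - d (j n) - d (N n - j n) - ln (A n * B n / real (N n)) / 2
     - ln (1 + u n) / 2 - ln (1 + v n) / 2 - A n * ((1 + u n) * ln (1 + u n)) - B n * ((1 + v n) * ln (1 + v n))"
      unfolding d_def A_def B_def u_def v_def by (intro pmf_binomial_ln) (use elim in auto)
    note lnp = this[unfolded s2]
    have "ln (s n ^ 2) / 2 = ln (s n)" if "s n > 0" using that by (simp add: ln_realpow)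
    then have "ln (s n ^ 2) / 2 = ln (s n)" using elim by blast
    moreover have "A n * (u n + u n ^ 2 / 2) + B n * (v n + v n ^ 2 / 2) = x n ^ 2 / 2"
    proof -
      have AB: "A n > 0" "B n > 0" using elim by auto
      have quad: "a * (h / a + (h / a) ^ 2 / 2) + b * (- (h / b) + (- (h / b)) ^ 2 / 2) = h ^ 2 / 2 * ((a + b) / (a * b))"
        if "a > 0" "b > 0" for a b h :: real
        using that by (simp add: field_simps power2_eq_square)
      have "u n = x n * s n / A n" "v n = - (x n * s n / B n)" using elim by blast+
      then have "A n * (u n + u n ^ 2 / 2) + B n * (v n + v n ^ 2 / 2) = (x n * s n) ^ 2 / 2 * ((A n + B n) / (A n * B n))"
        using quad[OF AB] by simp
      also have "A n + B n = real (N n)" by (simp add: A_def B_def algebra_simps)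
      also have "real (N n) / (A n * B n) = 1 / s n ^ 2"
        by (simp flip: s2)
      finally show ?thesis using elim by (simp add: power_mult_distrib)
    qed
    ultimately have "?E n = ln ?p + c + ln (s n) + x n ^ 2 / 2"
      using lnp
      by (simp add: algebra_simps)
    also have "exp \<dots> = ?p * exp c * s n * exp (x n ^ 2 / 2)"
    proof -
      have "s n > 0" using elim by blast
      then show ?thesis using p0 by (simp add: exp_add del: pmf_binomial)
    qed
    also have "exp c = sqrt (2 * pi)"
    proof -
      have "exp c = exp (ln (2 * pi) / 2)" by (simp add: c_def)
      also have "\<dots> = sqrt (2 * pi)"
        by (simp flip: ln_sqrt)
      finally show ?thesis .
    qed
    finally show ?case by (simp add: mult_ac)
  qed
  ultimately show ?thesis by (simp add: filterlim_cong)
qed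

text \<open>Exactly, 1 - ratio = (x s + K + 1 - q) / ((j + K + 1)(1 - q)). With s^2 = A (1 - q) and
  j close to A this is asymptotic to x / s, and a shift \<open>K\<close> of smaller order than both
  x s and A does not matter.\<close>

lemma ratio_asymp:
  fixes K :: "nat \<Rightarrow> nat"
  assumes "(\<lambda>n. real (K n) / (x n * s n)) \<longlonglongrightarrow> 0" "(\<lambda>n. real (K n) / A n) \<longlonglongrightarrow> 0"
  shows "(\<lambda>n. (1 - binomial_ratio (N n) (q n) (j n + K n)) * s n / x n) \<longlonglongrightarrow> 1"
proof -
  have "(\<lambda>n. (1 - q n) / (x n * s n)) \<longlonglongrightarrow> 0"
  proof (rule Lim_null_le[OF inverse_lims(5)])
    show "\<forall>\<^sub>F n in sequentially. \<bar>(1 - q n) / (x n * s n)\<bar> \<le> 1 / (x n * s n)"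
      using basic by (auto elim!: eventually_mono intro!: divide_right_mono)
  qed
  then have "(\<lambda>n. (1 + real (K n) / (x n * s n) + (1 - q n) / (x n * s n))
       * (1 / (1 + u n + real (K n) / A n + 1 / A n))) \<longlonglongrightarrow> (1 + 0 + 0) * (1 / (1 + 0 + 0 + 0))"
    by (intro tendsto_intros assms u_lim inverse_lims) auto
  moreover have "\<forall>\<^sub>F n in sequentially. (1 + real (K n) / (x n * s n) + (1 - q n) / (x n * s n))
       * (1 / (1 + u n + real (K n) / A n + 1 / A n)) = (1 - binomial_ratio (N n) (q n) (j n + K n)) * s n / x n"
    using basic
  proof eventually_elim
    case (elim n)
    let ?h = "x n * s n" and ?J = "real (j n) + real (K n) + 1"
    have J: "?J > 0" by (simp add: add_nonneg_pos)
    have h: "?h > 0" using elim by simp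
    have "binomial_ratio (N n) (q n) (j n + K n) = (real (N n) - real (j n) - real (K n)) * q n / (?J * (1 - q n))"
      by (simp add: binomial_ratio_def diff_diff_eq)
    moreover have "?J * (1 - q n) \<noteq> 0" using J elim by simp
    ultimately have "1 - binomial_ratio (N n) (q n) (j n + K n) = (?J * (1 - q n) - (real (N n) - real (j n) - real (K n)) * q n) / (?J * (1 - q n))"
      by (simp add: diff_divide_distrib)
    also have "?J * (1 - q n) - (real (N n) - real (j n) - real (K n)) * q n = (real (j n) - A n) + real (K n) + (1 - q n)"
      by (simp add: A_def algebra_simps)
    also have "real (j n) - A n = ?h" using elim by simp
    finally have eq: "1 - binomial_ratio (N n) (q n) (j n + K n) = (?h + real (K n) + (1 - q n)) / (?J * (1 - q n))" .
    have "(1 - binomial_ratio (N n) (q n) (j n + K n)) * s n / x n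
        = (?h + real (K n) + (1 - q n)) / (?J * (1 - q n)) * (s n ^ 2 / ?h)"
    proof -
      have "s n > 0" "x n > 0" using elim by auto
      then show ?thesis using eq by (simp add: power2_eq_square)
    qed
    also have "s n ^ 2 = A n * (1 - q n)" using elim by blast
    also have "(?h + real (K n) + (1 - q n)) / (?J * (1 - q n)) * (A n * (1 - q n) / ?h) = (?h + real (K n) + (1 - q n)) / ?h * (A n / ?J)"
    proof -
      have "1 - q n \<noteq> 0" using elim by simp
      then show ?thesis by simp
    qed
    also have "(?h + real (K n) + (1 - q n)) / ?h = 1 + real (K n) / (x n * s n) + (1 - q n) / (x n * s n)"
    proof -
      have "x n \<noteq> 0" "s n \<noteq> 0" using elim by auto
      then show ?thesis by (simp add: add_divide_distrib)
    qed
    also have "A n / ?J = 1 / (?J / A n)" by simp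
    also have "?J / A n = 1 + u n + real (K n) / A n + 1 / A n"
      using elim by (simp add: field_simps)
    finally show ?case by simp
  qed
  ultimately show ?thesis by (simp add: filterlim_cong)
qed

lemma tail_ratio:
  "(\<lambda>n. measure_pmf.prob (binomial_pmf (N n) (q n)) {i. i \<ge> j n} * x n
         / (pmf (binomial_pmf (N n) (q n)) (j n) * s n)) \<longlonglongrightarrow> 1"
proof -
  \<comment> \<open>A window of one standard deviation fits both demands: \<open>K\<close> is o(x
    s), so the ratio stays asymptotically 1 - x / s, while its \<open>K\<close>-th power is about
    exp(-x) and vanishes.\<close>
  define K where "K n = nat \<lceil>s n\<rceil>" for n
  let ?P = "\<lambda>n. measure_pmf.prob (binomial_pmf (N n) (q n)) {i. i \<ge> j n}"
  let ?p = "\<lambda>n. pmf (binomial_pmf (N n) (q n)) (j n)"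
  let ?rz = "\<lambda>n. binomial_ratio (N n) (q n) (j n)"
  let ?r = "\<lambda>n. binomial_ratio (N n) (q n) (j n + K n)"
  have K: "s n \<le> real (K n)" "s n > 0 \<Longrightarrow> real (K n) \<le> s n + 1" for n
    unfolding K_def by linarith+
  have "(\<lambda>n. 1 / x n + 1 / (x n * s n)) \<longlonglongrightarrow> 0 + 0"
    by (intro tendsto_add inverse_lims)
  then have K1: "(\<lambda>n. real (K n) / (x n * s n)) \<longlonglongrightarrow> 0"
  proof (rule Lim_null_le[OF tendsto_eq_rhs])
    show "\<forall>\<^sub>F n in sequentially. \<bar>real (K n) / (x n * s n)\<bar> \<le> 1 / x n + 1 / (x n * s n)"
      using basic
    proof eventually_elim
      case (elim n)
      then have "real (K n) / (x n * s n) \<le> (s n + 1) / (x n * s n)"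
        using K(2)[of n] by (intro divide_right_mono) auto
      also have "\<dots> = 1 / x n + 1 / (x n * s n)"
        using elim by (simp add: add_divide_distrib)
      finally show ?case using elim by simp
    qed
  qed simp
  have "(\<lambda>n. s n / A n + 1 / A n) \<longlonglongrightarrow> 0 + 0"
    by (intro tendsto_add inverse_lims)
  then have K2: "(\<lambda>n. real (K n) / A n) \<longlonglongrightarrow> 0"
  proof (rule Lim_null_le[OF tendsto_eq_rhs])
    show "\<forall>\<^sub>F n in sequentially. \<bar>real (K n) / A n\<bar> \<le> s n / A n + 1 / A n"
      using basic
    proof eventually_elim
      case (elim n)
      then have "real (K n) / A n \<le> (s n + 1) / A n"
        using K(2)[of n] by (intro divide_right_mono) auto
      then show ?case using elim by (simp add: add_divide_distrib)
    qed
  qed simp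
  have R0: "(\<lambda>n. (1 - ?rz n) * s n / x n) \<longlonglongrightarrow> 1" by (rule ratio_asymp[of "\<lambda>_. 0", simplified])
  have R: "(\<lambda>n. (1 - ?r n) * s n / x n) \<longlonglongrightarrow> 1" by (rule ratio_asymp[OF K1 K2])
  have pos: "\<forall>\<^sub>F n in sequentially. 1 / 2 < (1 - ?rz n) * s n / x n" "\<forall>\<^sub>F n in sequentially. 1 / 2 < (1 - ?r n) * s n / x n"
    using order_tendstoD(1)[OF R0, of "1/2"] order_tendstoD(1)[OF R, of "1/2"] by auto
  have JK: "\<forall>\<^sub>F n in sequentially. j n + K n \<le> N n"
  proof -
    have "(\<lambda>n. 1 / sqrt (B n)) \<longlonglongrightarrow> 0" by (rule x_div_sqrt)
    then have "\<forall>\<^sub>F n in sequentially. 1 / sqrt (B n) < 1 / 4"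
      by (rule order_tendstoD) simp
    with basic j_bounds show ?thesis
    proof eventually_elim
      case (elim n)
      then have b: "sqrt (B n) > 4" by (simp add: field_simps)
      have "real (K n) \<le> sqrt (B n) + 1" using K(2)[of n] elim by linarith
      also have "\<dots> \<le> sqrt (B n) * sqrt (B n) / 2"
      proof -
        have "4 * sqrt (B n) \<le> sqrt (B n) * sqrt (B n)" using b elim by (intro mult_right_mono) auto
        then show ?thesis using b by linarith
      qed
      also have "\<dots> = B n / 2" using elim by simp
      also have "\<dots> \<le> real (N n - j n)" using elim by blast
      finally show ?case using elim by linarith
    qed
  qed
  have rK: "(\<lambda>n. ?r n ^ K n) \<longlonglongrightarrow> 0"
  proof (rule Lim_null_le)
    have "filterlim (\<lambda>n. (1 - ?r n) * s n / x n * x n) at_top sequentially"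
      by (rule filterlim_tendsto_pos_mult_at_top[OF R _ x_top]) simp
    then have "filterlim (\<lambda>n. - ((1 - ?r n) * s n / x n * x n)) at_bot sequentially"
      by (simp add: filterlim_uminus_at_bot)
    then show "(\<lambda>n. exp (- ((1 - ?r n) * s n / x n * x n))) \<longlonglongrightarrow> 0"
      by (rule filterlim_compose[OF exp_at_bot])
    show "\<forall>\<^sub>F n in sequentially. \<bar>?r n ^ K n\<bar> \<le> exp (- ((1 - ?r n) * s n / x n * x n))"
      using basic pos(2) JK
    proof eventually_elim
      case (elim n)
      have "(1 - ?r n) * s n / x n > 0" using elim(2) by linarith
      then have r1: "1 - ?r n > 0" using elim(1) by (simp add: zero_less_divide_iff zero_less_mult_iff)
      have r0: "?r n \<ge> 0"
        unfolding binomial_ratio_def using elim by (intro divide_nonneg_nonneg mult_nonneg_nonneg) auto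
      have "?r n ^ K n \<le> exp (- (1 - ?r n)) ^ K n"
        using exp_ge_add_one_self[of "- (1 - ?r n)"] r0 by (intro power_mono) auto
      also have "\<dots> = exp (- ((1 - ?r n) * real (K n)))"
        by (subst exp_of_nat_mult[symmetric]) (simp add: algebra_simps)
      also have "\<dots> \<le> exp (- ((1 - ?r n) * s n))"
        using K(1)[of n] r1 by (simp del: minus_diff_eq)
      finally show ?case using r0 elim by simp
    qed
  qed
  have cancel: "a * b / c * (d / (a * e)) = b / (c * e / d)" if "a > 0" for a b c d e :: real
    using that by simp
  show ?thesis
  proof (rule real_tendsto_sandwich)
    show "(\<lambda>n. (1 - ?r n ^ K n) / ((1 - ?r n) * s n / x n)) \<longlonglongrightarrow> 1"
      using tendsto_divide[OF tendsto_diff[OF tendsto_const[of 1] rK] R] by simp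
    show "(\<lambda>n. 1 / ((1 - ?rz n) * s n / x n)) \<longlonglongrightarrow> 1"
      using tendsto_divide[OF tendsto_const[of 1] R0] by simp
    show "\<forall>\<^sub>F n in sequentially. (1 - ?r n ^ K n) / ((1 - ?r n) * s n / x n) \<le> ?P n * x n / (?p n * s n)"
      using basic j_bounds pos(2) JK
    proof eventually_elim
      case (elim n)
      have "(1 - ?r n) * s n / x n > 0" using elim(3) by linarith
      then have r1: "1 - ?r n > 0" using elim(1) by (simp add: zero_less_divide_iff zero_less_mult_iff)
      have p0: "?p n > 0" using elim by simp
      have "?p n * (1 - ?r n ^ K n) / (1 - ?r n) \<le> ?P n"
        by (rule prob_binomial_ge_lower) (use elim r1 in auto)
      then have "?p n * (1 - ?r n ^ K n) / (1 - ?r n) * (x n / (?p n * s n)) \<le> ?P n * (x n / (?p n * s n))"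
        by (rule mult_right_mono) (use elim p0 in auto)
      also have "?p n * (1 - ?r n ^ K n) / (1 - ?r n) * (x n / (?p n * s n)) = (1 - ?r n ^ K n) / ((1 - ?r n) * s n / x n)"
        using cancel[OF p0] by simp
      finally show ?case by simp
    qed
    show "\<forall>\<^sub>F n in sequentially. ?P n * x n / (?p n * s n) \<le> 1 / ((1 - ?rz n) * s n / x n)"
      using basic j_bounds pos(1)
    proof eventually_elim
      case (elim n)
      have "(1 - ?rz n) * s n / x n > 0" using elim(3) by linarith
      then have r1: "1 - ?rz n > 0" using elim(1) by (simp add: zero_less_divide_iff zero_less_mult_iff)
      have p0: "?p n > 0" using elim by simp
      have "?P n \<le> ?p n / (1 - ?rz n)"
        by (rule prob_binomial_ge_upper) (use elim r1 in auto)
      then have "?P n * (x n / (?p n * s n)) \<le> ?p n / (1 - ?rz n) * (x n / (?p n * s n))"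
        by (rule mult_right_mono) (use elim p0 in auto)
      also have "?p n / (1 - ?rz n) * (x n / (?p n * s n)) = 1 / ((1 - ?rz n) * s n / x n)"
        using cancel[OF p0, of 1] by simp
      finally show ?case by simp
    qed
  qed
qed

lemma binomial_tail_asymp:
  "(\<lambda>n. measure_pmf.prob (binomial_pmf (N n) (q n)) {i. i \<ge> j n} * (x n * sqrt (2 * pi) * exp (x n ^ 2 / 2))) \<longlonglongrightarrow> 1"
proof -
  let ?P = "\<lambda>n. measure_pmf.prob (binomial_pmf (N n) (q n)) {i. i \<ge> j n}" and ?p = "\<lambda>n. pmf (binomial_pmf (N n) (q n)) (j n)"
  have "(\<lambda>n. ?P n * x n
         / (?p n * s n)
      * (?p n * (sqrt (2 * pi) * s n * exp (x n ^ 2 / 2)))) \<longlonglongrightarrow> 1 * 1"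
    by (intro tendsto_mult tail_ratio pmf_asymp)
  moreover have "\<forall>\<^sub>F n in sequentially. ?P n * x n
         / (?p n * s n)
      * (?p n * (sqrt (2 * pi) * s n * exp (x n ^ 2 / 2)))
     = ?P n * (x n * sqrt (2 * pi) * exp (x n ^ 2 / 2))"
    using basic j_bounds
  proof eventually_elim
    case (elim n)
    have cancel: "a / (b * c) * (b * (d * c * e)) = a * (d * e)" if "b > 0" "c > 0" for a b c d e :: real
      using that by simp
    have p0: "?p n > 0" using elim by simp
    have s0: "s n > 0" using elim by blast
    show ?case unfolding cancel[OF p0 s0] by (simp only: mult.assoc)
  qed
  ultimately show ?thesis by (simp add: filterlim_cong)
qed

end

section \<open>The threshold and the tilting parameters\<close>

text \<open>With G i = 1 + p + ... + p^(i-1), the claim follows from k G m - m G k >= (k - m)(G m -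
  m p^m) and from the first summand of G m - m p^m = sum of (p^l - p^m), which is 1 - p^m >= 1 - p.
  For m = k - j it compares the exponent of a second exceptional set with the n^(k-j) candidates; at
  p = 1 the two would tie.\<close>

lemma geom_sum_gap:
  fixes p :: real
  assumes p: "0 < p" "p < 1" and m: "0 < m" "m < k"
  shows "real m + (1 - p) / real k \<le> real k * (1 - p ^ m) / (1 - p ^ k)"
proof -
  define G where "G i = (\<Sum>l<i. p ^ l)" for i
  have G: "1 - p ^ i = (1 - p) * G i" for i
    by (simp add: G_def one_diff_power_eq)
  have G_le: "G i \<le> real i" for i
    unfolding G_def using sum_bounded_above[of "{..<i}" "\<lambda>l. p ^ l" 1] p by (simp add: power_le_one)
  have Gk: "G k = G m + p ^ m * G (k - m)"
  proof -
    have "G k = (\<Sum>l<m. p ^ l) + (\<Sum>l\<in>{m..<k}. p ^ l)"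
      unfolding G_def using m by (subst sum.union_disjoint[symmetric]) (auto intro!: sum.cong)
    also have "(\<Sum>l\<in>{m..<k}. p ^ l) = (\<Sum>l<k - m. p ^ (m + l))"
      by (rule sum.reindex_bij_witness[of _ "\<lambda>l. m + l" "\<lambda>l. l - m"]) (use m in auto)
    finally show ?thesis by (simp add: G_def power_add sum_distrib_left)
  qed
  have Gpos: "G k > 0"
    unfolding G_def using m p by (intro sum_pos) auto
  have "1 - p \<le> 1 - p ^ m" using p m power_decreasing[of 1 m p] by simp
  also have "\<dots> = p ^ 0 - p ^ m" by simp
  also have "\<dots> \<le> (\<Sum>l<m. p ^ l - p ^ m)"
    by (rule member_le_sum) (use m p in \<open>auto intro!: power_decreasing\<close>)
  also have "\<dots> = G m - real m * p ^ m" by (simp add: G_def sum_subtractf)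
  finally have gap: "1 - p \<le> G m - real m * p ^ m" .
  have "real m * G k + (1 - p) / real k * G k \<le> real m * G k + (1 - p)"
  proof -
    have "(1 - p) * (G k / real k) \<le> (1 - p) * 1"
      using G_le[of k] p m by (intro mult_left_mono) auto
    then show ?thesis by simp
  qed
  also have "real m * G k \<le> real m * (G m + p ^ m * real (k - m))"
    unfolding Gk using p G_le[of "k - m"] by (intro mult_left_mono add_left_mono) auto
  also have "(1 - p) \<le> real (k - m) * (G m - real m * p ^ m)"
  proof -
    have "1 * (1 - p) \<le> real (k - m) * (G m - real m * p ^ m)"
      using gap p m by (intro mult_mono) auto
    then show ?thesis by simp
  qed
  also have "real m * (G m + p ^ m * real (k - m)) + real (k - m) * (G m - real m * p ^ m) = real k * G m"
    using m by (simp add: of_nat_diff algebra_simps)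
  finally have "(real m + (1 - p) / real k) * G k \<le> real k * G m"
    by (simp add: algebra_simps)
  then have "real m + (1 - p) / real k \<le> real k * G m / G k"
    using Gpos by (simp add: pos_le_divide_eq)
  also have "\<dots> = real k * (1 - p ^ m) / (1 - p ^ k)"
    unfolding G using p by simp
  finally show ?thesis .
qed

lemma exp_le_cubic:
  fixes y :: real
  assumes "\<bar>y\<bar> \<le> 1"
  shows "exp y \<le> 1 + y + y^2 / 2 + \<bar>y\<bar>^3"
proof -
  obtain t where t: "\<bar>t\<bar> \<le> \<bar>y\<bar>" "exp y = (\<Sum>m<3. y ^ m / fact m) + exp t / fact 3 * y ^ 3"
    using Maclaurin_exp_le[of y 3] by blast
  have "exp t \<le> exp 1" using t(1) assms by simp
  also have "\<dots> \<le> 3" using exp_le by simp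
  finally have "exp t \<le> 6" by simp
  have "exp t / fact 3 * y ^ 3 \<le> \<bar>exp t / fact 3 * y ^ 3\<bar>" by (rule abs_ge_self)
  also have "\<dots> = exp t / 6 * \<bar>y\<bar> ^ 3" by (simp add: abs_mult power_abs fact_numeral)
  also have "\<dots> \<le> 1 * \<bar>y\<bar> ^ 3"
    using \<open>exp t \<le> 6\<close> by (intro mult_right_mono) auto
  finally show ?thesis
    using t(2) by (simp add: numeral_3_eq_3 power2_eq_square)
qed

text \<open>Comparing with the exponential moment of the centred three-valued variable keeps the
  variance in the exponent exact; a bound through \<open>ln (1 + x) \<le> x\<close> would be too lossy.\<close>

lemma mgf_two_level:
  fixes P S a c :: real
  assumes P: "0 < P" "P \<le> 1" and S: "0 < S" "S \<le> 1" and c: "0 \<le> c" "c \<le> S * a" and a: "0 \<le> a" "a \<le> 1 / 2"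
  shows "1 + P * (exp c * (1 + S * (exp a - 1)) - 1)
     \<le> exp (a * (P * S) + c * P
         + (a^2 * (P * S) * (1 - P * S) + 2 * a * c * (P * S) * (1 - P) + c^2 * P * (1 - P)) / 2
         + 10 * a^3 * (P * S))"
proof -
  define m where "m = a * (P * S) + c * P"
  define V where "V = a^2 * (P * S) * (1 - P * S) + 2 * a * c * (P * S) * (1 - P) + c^2 * P * (1 - P)"
  have "S * a \<le> 1 * a" using a S by (intro mult_right_mono) auto
  then have ca: "c \<le> a" using c by simp
  have PS: "0 < P * S" "P * S \<le> 1" using P S by (auto intro: mult_le_one)
  have "a * (P * S) \<le> a * 1" "c * P \<le> c * 1" using a c P PS by (intro mult_left_mono; simp)+
  then have m: "0 \<le> m" "m \<le> a + c" using a c P PS by (auto simp: m_def)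
  \<comment> \<open>Weights of the three cases for one vertex: outside the first set, in the first
    only, in both. The centred values of the exponent in these cases are \<open>y1\<close>,
    \<open>y2\<close>, \<open>y3\<close>.\<close>
  define w1 w2 w3 where "w1 = 1 - P" and "w2 = P * (1 - S)" and "w3 = P * S"
  define y1 y2 y3 where "y1 = - m" and "y2 = c - m" and "y3 = a + c - m"
  have w: "w1 \<ge> 0" "w2 \<ge> 0" "w3 \<ge> 0" "w1 + w2 + w3 = 1"
    using P S by (auto simp: w1_def w2_def w3_def algebra_simps)
  have y: "\<bar>y1\<bar> \<le> 2 * a" "\<bar>y2\<bar> \<le> 2 * a" "\<bar>y3\<bar> \<le> 2 * a"
    using m ca c a by (auto simp: y1_def y2_def y3_def)
  have mean: "w1 * y1 + w2 * y2 + w3 * y3 = 0"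
    by (simp add: w1_def w2_def w3_def y1_def y2_def y3_def m_def algebra_simps)
  have var: "w1 * y1^2 + w2 * y2^2 + w3 * y3^2 = V"
    by (simp add: w1_def w2_def w3_def y1_def y2_def y3_def m_def V_def algebra_simps power2_eq_square)
  \<comment> \<open>The assumption \<open>c <= S * a\<close> bounds \<open>P * c^2\<close> by
    \<open>(P * S) * a^2\<close>, and \<open>a + c <= 2 * a\<close> gives the other 4. So the error
    keeps the small factor \<open>P * S\<close>; the factor \<open>p n ^ (k - j)\<close> in
    \<open>codeg_tilt\<close> ensures this assumption.\<close>
  have V_le: "V \<le> 5 * a^2 * (P * S)"
  proof -
    have "V = w2 * c^2 + w3 * (a + c)^2 - m^2"
      by (simp add: w2_def w3_def m_def V_def algebra_simps power2_eq_square)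
    also have "\<dots> \<le> P * c^2 + (P * S) * (2 * a)^2 - 0"
      using P S c a ca PS
      by (intro diff_mono add_mono mult_mono power_mono) (auto simp: w2_def w3_def mult_left_le)
    also have "P * c^2 \<le> P * (S * a)^2"
      using c P by (intro mult_left_mono power_mono) auto
    also have "P * (S * a)^2 \<le> (P * S) * a^2"
    proof -
      have "S * (P * S * a^2) \<le> 1 * (P * S * a^2)" using S PS by (intro mult_right_mono) auto
      then show ?thesis by (simp add: power2_eq_square mult_ac)
    qed
    finally show ?thesis by (simp add: algebra_simps)
  qed
  have e: "exp z \<le> 1 + z + z^2 / 2 + 2 * a * z^2" if "\<bar>z\<bar> \<le> 2 * a" for z
  proof -
    have "\<bar>z\<bar> ^ 3 = \<bar>z\<bar> * z^2" by (simp add: power3_eq_cube power2_eq_square)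
    also have "\<dots> \<le> 2 * a * z^2" using that by (rule mult_right_mono) simp
    finally show ?thesis using exp_le_cubic[of z] that a by linarith
  qed
  have "1 + P * (exp c * (1 + S * (exp a - 1)) - 1) = w1 + w2 * exp c + w3 * exp (a + c)"
    by (simp add: w1_def w2_def w3_def exp_add algebra_simps)
  also have "\<dots> = exp m * (w1 * exp y1 + w2 * exp y2 + w3 * exp y3)"
    by (simp add: y1_def y2_def y3_def exp_diff exp_minus field_simps)
  also have "\<dots> \<le> exp m * (w1 * (1 + y1 + y1^2 / 2 + 2 * a * y1^2) + w2 * (1 + y2 + y2^2 / 2 + 2 * a * y2^2)
      + w3 * (1 + y3 + y3^2 / 2 + 2 * a * y3^2))"
    by (intro mult_left_mono add_mono e y w) auto
  also have "w1 * (1 + y1 + y1^2 / 2 + 2 * a * y1^2) + w2 * (1 + y2 + y2^2 / 2 + 2 * a * y2^2)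
      + w3 * (1 + y3 + y3^2 / 2 + 2 * a * y3^2)
     = (w1 + w2 + w3) + (w1 * y1 + w2 * y2 + w3 * y3) + (w1 * y1^2 + w2 * y2^2 + w3 * y3^2) / 2
       + 2 * a * (w1 * y1^2 + w2 * y2^2 + w3 * y3^2)"
    by (simp add: algebra_simps add_divide_distrib)
  also have "\<dots> = 1 + (V / 2 + 2 * a * V)" unfolding mean var w(4) by simp
  also have "exp m * \<dots> \<le> exp m * exp (V / 2 + 2 * a * V)"
    by (intro mult_left_mono exp_ge_add_one_self) auto
  also have "\<dots> = exp (m + (V / 2 + 2 * a * V))" by (simp add: exp_add)
  also have "\<dots> \<le> exp (m + V / 2 + 10 * a^3 * (P * S))"
  proof -
    have "2 * a * V \<le> 2 * a * (5 * a^2 * (P * S))" by (rule mult_left_mono[OF V_le]) (use a in auto)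
    then show ?thesis by (simp add: power2_eq_square power3_eq_cube mult_ac)
  qed
  finally show ?thesis by (simp add: m_def V_def)
qed

locale threshold =
  fixes k :: nat and y :: real and p :: "nat \<Rightarrow> real"
  assumes k1: "k \<ge> 1"
    and p01: "\<And>n. n \<ge> 1 \<Longrightarrow> 0 < p n \<and> p n < 1"
    and H1: "much_greater (\<lambda>n. p n ^ k) (\<lambda>n. ln n ^ 3 / n)"
    and H2: "much_greater (\<lambda>n. 1 - p n) (\<lambda>n. sqrt (ln (ln n) / ln n))"
begin

text \<open>\<open>tilt\<close> is the saddle point for the level \<open>b\<close>, equal to \<open>1 / sigma_seq\<close>; every exponential moment below uses
  it. \<open>rho\<close> collects the corrections in \<open>a_seq\<close>: \<open>exp (- rho)\<close> cancels the Gaussian prefactor.\<close>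

definition L :: "nat \<Rightarrow> real" where "L n = ln (real n)"
definition q :: "nat \<Rightarrow> real" where "q n = p n ^ k"
definition s :: "nat \<Rightarrow> real" where "s n = sqrt (real n * q n * (1 - q n))"
definition tilt :: "nat \<Rightarrow> real" where "tilt n = sqrt (2 * real k * L n) / s n"
definition rho :: "nat \<Rightarrow> real" where "rho n = ln (fact k) + ln (4 * pi * real k * L n) / 2 - y"
definition err :: "nat \<Rightarrow> real" where "err n = L n ^ 3 / (real n * q n * (1 - q n) ^ 3)"
definition b :: "nat \<Rightarrow> real" where "b n = a_seq k n (p n) + sigma_seq k n (p n) * y"

lemma L_top: "filterlim L at_top sequentially"
  unfolding L_def by real_asymp

lemma basic: "\<forall>\<^sub>F n in sequentially. n > 0 \<and> L n \<ge> 1 \<and> ln (L n) \<ge> 1 \<and> 0 < p n \<and> p n < 1 \<and> 0 < q n \<and> q n < 1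
   \<and> 1 - p n \<le> 1 - q n \<and> s n > 0 \<and> tilt n > 0 \<and> s n ^ 2 = real n * q n * (1 - q n)
   \<and> tilt n ^ 2 * (real n * q n) * (1 - q n) = 2 * real k * L n \<and> tilt n * s n = sqrt (2 * real k * L n)"
proof -
  have "\<forall>\<^sub>F n in sequentially. L n \<ge> 1" "\<forall>\<^sub>F n in sequentially. ln (L n) \<ge> 1"
    unfolding L_def by real_asymp+
  with eventually_gt_at_top[of 0] show ?thesis
  proof eventually_elim
    case (elim n)
    have p: "0 < p n" "p n < 1" using p01[of n] elim by auto
    have q: "0 < q n" "q n < 1" "q n \<le> p n"
      using p k1 power_decreasing[of 1 k "p n"] by (auto simp: q_def power_less_one_iff)
    have s: "s n > 0" "s n ^ 2 = real n * q n * (1 - q n)" using elim q by (auto simp: s_def)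
    have kL: "2 * real k * L n > 0" using k1 elim by auto
    have tilt: "tilt n > 0" "tilt n * s n = sqrt (2 * real k * L n)" using s(1) kL by (auto simp: tilt_def)
    have "(tilt n * s n) ^ 2 = 2 * real k * L n" unfolding tilt(2) using kL by simp
    then have "tilt n ^ 2 * (real n * q n) * (1 - q n) = 2 * real k * L n"
      by (simp add: power_mult_distrib s(2) mult_ac)
    then show ?case using elim p q s tilt by auto
  qed
qed

lemma sigma_eq: "\<forall>\<^sub>F n in sequentially. sigma_seq k n (p n) = 1 / tilt n"
  using basic
proof eventually_elim
  case (elim n)
  have "sigma_seq k n (p n) = sqrt (real n * q n * (1 - q n) / (2 * real k * L n))"
    by (simp add: sigma_seq_def q_def L_def mult_ac)
  also have "\<dots> = 1 / tilt n" by (simp add: real_sqrt_divide tilt_def s_def)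
  finally show ?case .
qed

text \<open>Multiplying out \<open>a_seq\<close>: since tilt^2 s^2 = 2 k L, the relative corrections
  of size 1/L become the shift \<open>rho / tilt\<close>. Thus b is the mean plus tilt times the
  variance, lowered by \<open>rho / tilt\<close>, the form needed in exponents.\<close>

lemma b_eq: "\<forall>\<^sub>F n in sequentially. b n = real n * q n + tilt n * (real n * q n * (1 - q n)) - rho n / tilt n"
  using basic sigma_eq
proof eventually_elim
  case (elim n)
  define K where "K = 2 * real k * L n"
  have K: "K > 0" "tilt n > 0" "s n > 0" using elim k1 by (auto simp: K_def)
  have K2: "tilt n ^ 2 * s n ^ 2 = K" using elim by (simp add: K_def mult_ac)
  have sq: "sqrt (2 * real k * p n ^ k * (1 - p n ^ k) * real n * ln (real n)) = tilt n * s n ^ 2"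
  proof -
    have "2 * real k * p n ^ k * (1 - p n ^ k) * real n * ln (real n) = (2 * real k * L n) * (real n * q n * (1 - q n))"
      by (simp add: q_def L_def mult_ac)
    also have "sqrt \<dots> = (tilt n * s n) * s n"
      using elim unfolding real_sqrt_mult[of "2 * real k * L n"] by (simp add: s_def)
    finally show ?thesis by (simp add: power2_eq_square)
  qed
  have "a_seq k n (p n) = real n * q n + tilt n * s n ^ 2 * (1 - ln (fact k) / K - ln (4 * pi * real k * L n) / (2 * K))"
    unfolding a_seq_def sq by (simp add: q_def L_def K_def)
  also have "\<dots> = real n * q n + tilt n * s n ^ 2 - tilt n * s n ^ 2 / K * (ln (fact k) + ln (4 * pi * real k * L n) / 2)"
    using K(1) by (simp add: field_simps)
  also have "tilt n * s n ^ 2 / K = 1 / tilt n"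
    using K unfolding K2[symmetric] by (simp add: power2_eq_square)
  finally have "b n = real n * q n + tilt n * s n ^ 2 - rho n / tilt n"
    unfolding b_def elim(2) by (simp add: rho_def add_divide_distrib diff_divide_distrib)
  then show ?case using elim by simp
qed

text \<open>For q <= 1/2 the factor (1 - q)^3 is bounded below and the first hypothesis suffices.
  For q > 1/2 the second gives 1 - q >= 1 - p >= 1/L eventually, and \<open>err\<close> is at most 2
  L^6 / n.\<close>

lemma err_lim: "err \<longlonglongrightarrow> 0"
proof -
  have h1: "(\<lambda>n. L n ^ 3 / real n / q n) \<longlonglongrightarrow> 0"
    using H1 by (simp add: much_greater_def L_def q_def)
  have h2: "(\<lambda>n. L n ^ 6 / real n) \<longlonglongrightarrow> 0"
    unfolding L_def by real_asymp
  have "(\<lambda>n. sqrt (ln (L n) / L n) / (1 - p n)) \<longlonglongrightarrow> 0"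
    using H2 by (simp add: much_greater_def L_def)
  then have ev: "\<forall>\<^sub>F n in sequentially. sqrt (ln (L n) / L n) / (1 - p n) < 1"
    by (rule order_tendstoD) simp
  have "(\<lambda>n. 8 * (L n ^ 3 / real n / q n) + 2 * (L n ^ 6 / real n)) \<longlonglongrightarrow> 8 * 0 + 2 * 0"
    by (intro tendsto_intros h1 h2)
  then show ?thesis
  proof (rule Lim_null_le[OF tendsto_eq_rhs])
    show "\<forall>\<^sub>F n in sequentially. \<bar>err n\<bar>
        \<le> 8 * (L n ^ 3 / real n / q n) + 2 * (L n ^ 6 / real n)"
      using basic ev
    proof eventually_elim
      case (elim n)
      have L: "L n \<ge> 1" using elim by simp
      have q: "0 < q n" "q n < 1" using elim by auto
      have n: "real n > 0" using elim by simp
      have "1 / L n \<le> sqrt (1 / L n)"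
        using L by (intro real_le_rsqrt) (simp add: power2_eq_square field_simps)
      also have "\<dots> \<le> sqrt (ln (L n) / L n)"
        using elim L by (intro real_sqrt_le_mono divide_right_mono) auto
      also have "\<dots> \<le> 1 - p n" using elim by (simp add: divide_simps split: if_splits)
      also have "\<dots> \<le> 1 - q n" using elim by simp
      finally have "(1 / L n) ^ 3 \<le> (1 - q n) ^ 3"
        using L by (intro power_mono) auto
      then have a: "1 / (1 - q n) ^ 3 \<le> L n ^ 3"
        using L q by (simp add: power_divide field_simps)
      have "1 / (q n * (1 - q n) ^ 3) \<le> 8 / q n + 2 * (1 / (1 - q n) ^ 3)"
      proof (cases "q n \<le> 1 / 2")
        case True
        then have "(1 / 2) ^ 3 \<le> (1 - q n) ^ 3" by (intro power_mono) auto
        then have "1 / (1 - q n) ^ 3 \<le> 8" using q by (simp add: field_simps)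
        then have "1 / q n * (1 / (1 - q n) ^ 3) \<le> 1 / q n * 8" using q by (intro mult_left_mono) auto
        moreover have "0 \<le> 2 * (1 / (1 - q n) ^ 3)" using q by simp
        moreover have "1 / (q n * (1 - q n) ^ 3) = 1 / q n * (1 / (1 - q n) ^ 3)" "1 / q n * 8 = 8 / q n" by simp_all
        ultimately show ?thesis by linarith
      next
        case False
        then have "1 / q n \<le> 2" using q by (simp add: field_simps)
        then have "1 / q n * (1 / (1 - q n) ^ 3) \<le> 2 * (1 / (1 - q n) ^ 3)" using q by (intro mult_right_mono) auto
        moreover have "0 \<le> 8 / q n" using q by simp
        moreover have "1 / (q n * (1 - q n) ^ 3) = 1 / q n * (1 / (1 - q n) ^ 3)" by simp
        ultimately show ?thesis by linarith
      qed
      also have "\<dots> \<le> 8 / q n + 2 * L n ^ 3" using a by simp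
      finally have "L n ^ 3 / real n * (1 / (q n * (1 - q n) ^ 3)) \<le> L n ^ 3 / real n * (8 / q n + 2 * L n ^ 3)"
        using L n by (intro mult_left_mono) auto
      also have "\<dots> = 8 * (L n ^ 3 / real n / q n) + 2 * (L n ^ 6 / real n)"
        using n by (simp add: field_simps flip: power_add)
      finally show ?case using L q n by (simp add: err_def)
    qed
  qed simp
qed

text \<open>This is the third-order error of an n-fold product of the moments in
  \<open>mgf_two_level\<close>. Its square is (2k)^3 \<open>err\<close>, which explains the shape of
  \<open>err\<close>.\<close>

lemma cubic_lim: "(\<lambda>n. real n * q n * tilt n ^ 3) \<longlonglongrightarrow> 0"
proof -
  have "(\<lambda>n. sqrt ((2 * real k) ^ 3 * err n)) \<longlonglongrightarrow> sqrt ((2 * real k) ^ 3 * 0)"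
    by (intro tendsto_intros err_lim)
  moreover have "\<forall>\<^sub>F n in sequentially. sqrt ((2 * real k) ^ 3 * err n) = real n * q n * tilt n ^ 3"
    using basic
  proof eventually_elim
    case (elim n)
    have pos: "real n * q n > 0" "1 - q n > 0" using elim by auto
    have "(real n * q n * tilt n ^ 3) ^ 2 * (real n * q n * (1 - q n) ^ 3) = (tilt n ^ 2 * (real n * q n) * (1 - q n)) ^ 3"
      by (simp add: power2_eq_square power3_eq_cube)
    also have "\<dots> = (2 * real k) ^ 3 * L n ^ 3"
      using elim by (simp add: power_mult_distrib)
    finally have "(real n * q n * tilt n ^ 3) ^ 2 = (2 * real k) ^ 3 * err n"
    proof -
      assume "(real n * q n * tilt n ^ 3) ^ 2 * (real n * q n * (1 - q n) ^ 3) = (2 * real k) ^ 3 * L n ^ 3"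
      moreover have "real n * q n * (1 - q n) ^ 3 \<noteq> 0" using pos elim by auto
      ultimately show ?thesis unfolding err_def by (metis nonzero_eq_divide_eq times_divide_eq_right)
    qed
    then show ?case using elim by (intro real_sqrt_unique) auto
  qed
  ultimately show ?thesis by (simp add: filterlim_cong)
qed

lemma tilt_lim: "tilt \<longlonglongrightarrow> 0"
proof -
  have "(\<lambda>n. sqrt (2 * real k * err n)) \<longlonglongrightarrow> sqrt (2 * real k * 0)"
    by (intro tendsto_intros err_lim)
  then show ?thesis
  proof (rule Lim_null_le[OF tendsto_eq_rhs])
    show "\<forall>\<^sub>F n in sequentially. \<bar>tilt n\<bar> \<le> sqrt (2 * real k * err n)"
      using basic
    proof eventually_elim
      case (elim n)
      have pos: "real n * q n > 0" "1 - q n > 0" using elim by auto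
      have "tilt n ^ 2 = 2 * real k * (L n / (real n * q n * (1 - q n)))"
        using elim pos by (simp add: field_simps)
      also have "\<dots> \<le> 2 * real k * err n"
        unfolding err_def
      proof (intro mult_left_mono frac_le)
        show "L n \<le> L n ^ 3" using elim self_le_power[of "L n" 3] by auto
        have "(1 - q n) ^ 3 \<le> (1 - q n) ^ 1" using elim by (intro power_decreasing) auto
        then show "(1 - q n) ^ 3 \<le> 1 - q n" by simp
      qed (use elim pos in auto)
      finally show ?case using elim by (intro real_le_rsqrt) auto
    qed
  qed simp
qed

text \<open>The only place where the strength of the lower bound on \<open>1 - p\<close> matters.\<close>

lemma decay:
  assumes c: "c > 0"
  shows "filterlim (\<lambda>n. C * ln (L n) - c * ((1 - p n)^2 * L n)) at_bot sequentially"
proof -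
  have "(\<lambda>n. (sqrt (ln (L n) / L n) / (1 - p n)) ^ 2) \<longlonglongrightarrow> 0 ^ 2"
    using H2 by (intro tendsto_power) (simp add: much_greater_def L_def)
  \<comment> \<open>With this threshold c (1-p)^2 L exceeds (|C| + 1) ln L, so -ln L is left over
    after the term with \<open>C\<close> is paid.\<close>
  then have "\<forall>\<^sub>F n in sequentially. (sqrt (ln (L n) / L n) / (1 - p n)) ^ 2 < c / (\<bar>C\<bar> + 1)"
    by (rule order_tendstoD) (use c in auto)
  with basic have ev: "\<forall>\<^sub>F n in sequentially. C * ln (L n) - c * ((1 - p n)^2 * L n) \<le> - ln (L n)"
  proof eventually_elim
    case (elim n)
    have "(sqrt (ln (L n) / L n) / (1 - p n)) ^ 2 = ln (L n) / (L n * (1 - p n)^2)"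
      using elim by (simp add: power_divide)
    with elim have "ln (L n) / (L n * (1 - p n)^2) < c / (\<bar>C\<bar> + 1)" by simp
    moreover have "L n * (1 - p n)^2 > 0" using elim by auto
    ultimately have "ln (L n) * (\<bar>C\<bar> + 1) < c * (L n * (1 - p n)^2)"
    proof -
      have "ln (L n) / (L n * (1 - p n)^2) * (\<bar>C\<bar> + 1) < c"
        using \<open>ln (L n) / (L n * (1 - p n)^2) < c / (\<bar>C\<bar> + 1)\<close> by (subst (asm) pos_less_divide_eq) auto
      then show ?thesis
        using \<open>L n * (1 - p n)^2 > 0\<close> by (simp add: pos_divide_less_eq)
    qed
    moreover have "C * ln (L n) \<le> \<bar>C\<bar> * ln (L n)" using elim by (intro mult_right_mono) auto
    ultimately show ?case by (simp add: algebra_simps)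
  qed
  have "filterlim (\<lambda>n. - ln (L n)) at_bot sequentially"
    unfolding L_def by real_asymp
  then show ?thesis by (rule filterlim_at_bot_mono[OF _ ev])
qed

lemma rho_eq: "\<forall>\<^sub>F n in sequentially. rho n = ln (L n) / 2 + (ln (fact k) + ln (4 * pi * real k) / 2 - y)"
  using basic
proof eventually_elim
  case (elim n)
  have "ln (4 * pi * real k * L n) = ln (4 * pi * real k) + ln (L n)"
    using elim k1 by (intro ln_mult_pos) auto
  then show ?case by (simp add: rho_def add_divide_distrib)
qed

text \<open>The common end of both moment estimates. As \<open>rho\<close> is ln L / 2 plus a
  constant, the lost prefactor \<open>exp (rho n)\<close> is of order sqrt L, and
  \<open>decay\<close> with coefficient 1/2 absorbs it.\<close>

lemma exp_decay:
  assumes c: "c > 0" and f: "\<forall>\<^sub>F n in sequentially. 0 \<le> f n \<and> f n \<le> exp (rho n - c * ((1 - p n)^2 * L n) + r n)" and r: "r \<longlonglongrightarrow> 0"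
  shows "f \<longlonglongrightarrow> 0"
proof (rule Lim_null_le)
  define K where "K = ln (fact k) + ln (4 * pi * real k) / 2 - y"
  have "filterlim (\<lambda>n. (r n + K) + (1 / 2 * ln (L n) - c * ((1 - p n)^2 * L n))) at_bot sequentially"
    using filterlim_tendsto_add_at_top[OF tendsto_minus[OF tendsto_add[OF r tendsto_const[of K]]]
        filterlim_uminus_at_bot[THEN iffD1, OF decay[OF c, of "1 / 2"]]]
    by (subst filterlim_uminus_at_bot) (simp add: algebra_simps)
  then show "(\<lambda>n. exp ((r n + K) + (1 / 2 * ln (L n) - c * ((1 - p n)^2 * L n)))) \<longlonglongrightarrow> 0"
    by (rule filterlim_compose[OF exp_at_bot])
  show "\<forall>\<^sub>F n in sequentially. \<bar>f n\<bar> \<le> exp ((r n + K) + (1 / 2 * ln (L n) - c * ((1 - p n)^2 * L n)))"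
    using f rho_eq
  proof eventually_elim
    case (elim n)
    then show ?case by (simp add: K_def algebra_simps)
  qed
qed

lemma nq_large: "\<forall>\<^sub>F n in sequentially. L n ^ 3 \<le> real n * q n" "\<forall>\<^sub>F n in sequentially. C \<le> real n * q n"
proof -
  have "\<forall>\<^sub>F n in sequentially. err n < 1"
    by (rule order_tendstoD[OF err_lim]) simp
  with basic show 1: "\<forall>\<^sub>F n in sequentially. L n ^ 3 \<le> real n * q n"
  proof eventually_elim
    case (elim n)
    have "real n * q n * (1 - q n) ^ 3 > 0" using elim by auto
    then have "L n ^ 3 \<le> real n * q n * (1 - q n) ^ 3"
      using elim(2) by (simp add: err_def pos_divide_less_eq)
    also have "\<dots> \<le> real n * q n * 1"
      using elim by (intro mult_left_mono power_le_one) auto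
    finally show ?case by simp
  qed
  have "\<forall>\<^sub>F n in sequentially. L n \<ge> C" using L_top by (simp add: filterlim_at_top)
  with 1 basic show "\<forall>\<^sub>F n in sequentially. C \<le> real n * q n"
  proof eventually_elim
    case (elim n)
    have "L n \<le> L n ^ 3" using elim self_le_power[of "L n" 3] by auto
    then show ?case using elim by linarith
  qed
qed

lemma ell_lims:
  "filterlim (\<lambda>n. tilt n * s n) at_top sequentially" "(\<lambda>n. rho n / (tilt n * s n)) \<longlonglongrightarrow> 0"
  "(\<lambda>n. 1 / s n) \<longlonglongrightarrow> 0"
proof -
  have k: "real k > 0" using k1 by simp
  have "filterlim (\<lambda>n. sqrt (2 * real k * L n)) at_top sequentially"
    unfolding L_def using k by real_asymp
  moreover have ev: "\<forall>\<^sub>F n in sequentially. sqrt (2 * real k * L n) = tilt n * s n"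
    using basic by eventually_elim simp
  ultimately show top: "filterlim (\<lambda>n. tilt n * s n) at_top sequentially"
    by (rule filterlim_cong[OF refl refl, THEN iffD1, rotated])
  define K where "K = ln (fact k) + ln (4 * pi * real k) / 2 - y"
  have "(\<lambda>n. (ln (L n) / 2 + K) / sqrt (2 * real k * L n)) \<longlonglongrightarrow> 0"
    unfolding L_def using k by real_asymp
  moreover have "\<forall>\<^sub>F n in sequentially. (ln (L n) / 2 + K) / sqrt (2 * real k * L n) = rho n / (tilt n * s n)"
    using ev rho_eq by eventually_elim (simp add: K_def)
  ultimately show "(\<lambda>n. rho n / (tilt n * s n)) \<longlonglongrightarrow> 0"
    by (rule filterlim_cong[OF refl refl, THEN iffD1, rotated])
  have "(\<lambda>n. tilt n * (1 / (tilt n * s n))) \<longlonglongrightarrow> 0 * 0"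
    by (intro tendsto_mult tilt_lim tendsto_divide_0[OF tendsto_const] filterlim_at_top_imp_at_infinity top)
  moreover have "\<forall>\<^sub>F n in sequentially. tilt n * (1 / (tilt n * s n)) = 1 / s n"
    using basic
  proof eventually_elim
    case (elim n)
    then have "tilt n \<noteq> 0" by auto
    then show ?case by simp
  qed
  ultimately show "(\<lambda>n. 1 / s n) \<longlonglongrightarrow> 0"
    by (rule Lim_transform_eventually[THEN tendsto_eq_rhs]) simp
qed

text \<open>It makes the rounding of \<open>b n - c'\<close> to a natural number harmless, since
  \<open>nat\<close> then cuts off nothing.\<close>

lemma b_large: "\<forall>\<^sub>F n in sequentially. C \<le> b n"
proof -
  have "\<forall>\<^sub>F n in sequentially. rho n / (tilt n * s n) < 1"
    by (rule order_tendstoD[OF ell_lims(2)]) simp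
  moreover have "\<forall>\<^sub>F n in sequentially. tilt n * s n \<ge> 1"
    using ell_lims(1) by (simp add: filterlim_at_top)
  ultimately show ?thesis using basic b_eq nq_large(2)[of C]
  proof eventually_elim
    case (elim n)
    have "b n = real n * q n + s n * (tilt n * s n - rho n / (tilt n * s n))"
    proof -
      have "tilt n * (real n * q n * (1 - q n)) = s n * (tilt n * s n)"
      proof -
        have "tilt n * s n ^ 2 = s n * (tilt n * s n)" by (simp add: power2_eq_square)
        moreover have "s n ^ 2 = real n * q n * (1 - q n)" using elim by blast
        ultimately show ?thesis by simp
      qed
      moreover have "rho n / tilt n = s n * (rho n / (tilt n * s n))"
      proof -
        have "s n > 0" using elim by blast
        then show ?thesis by simp
      qed
      ultimately show ?thesis using elim by (simp add: right_diff_distrib)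
    qed
    moreover have "s n * (tilt n * s n - rho n / (tilt n * s n)) \<ge> 0"
      using elim by (intro mult_nonneg_nonneg) linarith+
    ultimately show ?case using elim by linarith
  qed
qed

section \<open>The tail at the threshold\<close>

text \<open>Removing \<open>c\<close> candidate vertices or lowering the level by \<open>c'\<close>
  moves x^2 / 2 by a bounded multiple of \<open>tilt\<close> plus o(1), hence by o(1). The limit
  being the same for all \<open>c\<close> and \<open>c'\<close> is what makes the differences of
  tails in the pair estimates negligible.\<close>

lemma binomial_threshold_tail:
  fixes c c' :: nat
  shows "(\<lambda>n. real n ^ k * measure_pmf.prob (binomial_pmf (n - c) (q n)) {i. real i > b n - real c'})
           \<longlonglongrightarrow> fact k * exp (- y)"
proof -
  define N where "N n = n - c" for n
  \<comment> \<open>The least integer strictly above \<open>b n - c'\<close>, hence floor plus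
    one.\<close>
  define j where "j n = nat (\<lfloor>b n - real c'\<rfloor> + 1)" for n
  define x where "x n = (real (j n) - real (N n) * q n) / sqrt (real (N n) * q n * (1 - q n))" for n
  \<comment> \<open>The combined effect of rounding, of \<open>c'\<close> and of the removed
    vertices on the centred threshold; it stays bounded.\<close>
  define th where "th n = real (j n) - real (N n) * q n - (b n - real n * q n)" for n
  define ell where "ell n = tilt n * s n" for n
  define w where "w n = ell n - rho n / ell n + th n / s n" for n
  have k: "real k > 0" using k1 by simp
  have N_eq: "\<forall>\<^sub>F n in sequentially. real (N n) = real n - real c \<and> N n > 0"
    using eventually_gt_at_top[of c] by eventually_elim (auto simp: N_def)
  have Nlim: "(\<lambda>n. real n / real (N n)) \<longlonglongrightarrow> 1"
  proof -
    have "(\<lambda>n. real n / (real n - real c)) \<longlonglongrightarrow> 1" by real_asymp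
    moreover have "\<forall>\<^sub>F n in sequentially. real n / (real n - real c) = real n / real (N n)"
      using N_eq by eventually_elim simp
    ultimately show ?thesis by (rule Lim_transform_eventually[THEN tendsto_eq_rhs]) simp
  qed
  have ell_top: "filterlim ell at_top sequentially" using ell_lims(1) by (simp add: ell_def[abs_def])
  have rho_ell: "(\<lambda>n. rho n / ell n) \<longlonglongrightarrow> 0" using ell_lims(2) by (simp add: ell_def[abs_def])
  have ell_inv: "(\<lambda>n. 1 / ell n) \<longlonglongrightarrow> 0"
    by (intro tendsto_divide_0[OF tendsto_const] filterlim_at_top_imp_at_infinity ell_top)
  have ell_pos: "\<forall>\<^sub>F n in sequentially. ell n > 0"
    using basic unfolding ell_def by eventually_elim (intro mult_pos_pos, auto)
  have th_bd: "\<forall>\<^sub>F n in sequentially. \<bar>th n\<bar> \<le> 1 + real c + real c'"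
    using b_large[of "real c'"] N_eq basic
  proof eventually_elim
    case (elim n)
    have j: "real (j n) = real_of_int \<lfloor>b n - real c'\<rfloor> + 1"
      using elim by (simp add: j_def)
    have "th n = (real (j n) - (b n - real c')) - real c' + real c * q n"
    proof -
      have Nn: "real (N n) = real n - real c" using elim by blast
      show ?thesis unfolding th_def Nn by (simp add: algebra_simps)
    qed
    moreover have "0 \<le> real (j n) - (b n - real c')" "real (j n) - (b n - real c') \<le> 1"
      unfolding j by linarith+
    moreover have "0 \<le> real c * q n" "real c * q n \<le> real c"
      using elim by (auto intro!: mult_left_le)
    ultimately show ?case by linarith
  qed
  have th_mult: "(\<lambda>n. th n * f n) \<longlonglongrightarrow> 0" if "f \<longlonglongrightarrow> 0" for f
  proof (rule Lim_null_le)
    have "(\<lambda>n. (1 + real c + real c') * \<bar>f n\<bar>) \<longlonglongrightarrow> (1 + real c + real c') * \<bar>0\<bar>"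
      by (intro tendsto_intros that)
    then show "(\<lambda>n. (1 + real c + real c') * \<bar>f n\<bar>) \<longlonglongrightarrow> 0" by simp
    show "\<forall>\<^sub>F n in sequentially. \<bar>th n * f n\<bar> \<le> (1 + real c + real c') * \<bar>f n\<bar>"
      using th_bd by eventually_elim (auto simp: abs_mult intro!: mult_right_mono)
  qed
  have ths: "(\<lambda>n. th n / s n) \<longlonglongrightarrow> 0" using th_mult[OF ell_lims(3)] by simp
  have x_eq: "\<forall>\<^sub>F n in sequentially. x n = sqrt (real n / real (N n)) * w n"
    using basic b_eq N_eq
  proof eventually_elim
    case (elim n)
    have s0: "s n > 0" and q0: "0 < q n" "q n < 1" and N0: "real (N n) > 0" and n0: "real n > 0"
      using elim by auto
    have s2: "s n ^ 2 = real n * q n * (1 - q n)" using elim by blast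
    have "real (j n) - real (N n) * q n = tilt n * s n ^ 2 - rho n / tilt n + th n"
      using elim by (simp add: th_def s2)
    also have "\<dots> = s n * w n"
      using s0 by (simp add: w_def ell_def right_diff_distrib distrib_left power2_eq_square)
    finally have "x n = w n * (s n / sqrt (real (N n) * q n * (1 - q n)))"
      by (simp add: x_def)
    also have "s n / sqrt (real (N n) * q n * (1 - q n)) = sqrt (real n / real (N n))"
      using N0 q0 by (simp add: s_def real_sqrt_divide[symmetric])
    finally show ?case by simp
  qed
  have w_ell: "(\<lambda>n. w n / ell n) \<longlonglongrightarrow> 1"
  proof -
    have "(\<lambda>n. 1 - rho n / ell n * (1 / ell n) + th n / s n * (1 / ell n)) \<longlonglongrightarrow> 1 - 0 * 0 + 0 * 0"
      by (intro tendsto_intros rho_ell ell_inv ths)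
    moreover have "\<forall>\<^sub>F n in sequentially. 1 - rho n / ell n * (1 / ell n) + th n / s n * (1 / ell n) = w n / ell n"
      using ell_pos by eventually_elim (simp add: w_def diff_divide_distrib add_divide_distrib)
    ultimately show ?thesis by (rule Lim_transform_eventually[THEN tendsto_eq_rhs]) simp
  qed
  have x_ell: "(\<lambda>n. x n / ell n) \<longlonglongrightarrow> 1"
  proof -
    have "(\<lambda>n. sqrt (real n / real (N n)) * (w n / ell n)) \<longlonglongrightarrow> sqrt 1 * 1"
      by (intro tendsto_intros Nlim w_ell)
    moreover have "\<forall>\<^sub>F n in sequentially. sqrt (real n / real (N n)) * (w n / ell n) = x n / ell n"
      using x_eq by eventually_elim simp
    ultimately show ?thesis by (rule Lim_transform_eventually[THEN tendsto_eq_rhs]) simp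
  qed
  have x_top: "filterlim x at_top sequentially"
  proof -
    have "filterlim (\<lambda>n. x n / ell n * ell n) at_top sequentially"
      by (rule filterlim_tendsto_pos_mult_at_top[OF x_ell _ ell_top]) simp
    moreover have "\<forall>\<^sub>F n in sequentially. x n / ell n * ell n = x n"
      using ell_pos by eventually_elim auto
    ultimately show ?thesis
      by (rule filterlim_cong[OF refl refl, THEN iffD1, rotated])
  qed
  have cube: "(\<lambda>n. x n ^ 3 / sqrt (real (N n) * r n)) \<longlonglongrightarrow> 0"
    if r: "\<forall>\<^sub>F n in sequentially. 0 < r n \<and> q n * (1 - q n) ^ 3 \<le> r n" for r
  proof -
    have "(\<lambda>n. sqrt ((2 * real k) ^ 3 * err n)) \<longlonglongrightarrow> sqrt ((2 * real k) ^ 3 * 0)"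
      by (intro tendsto_intros err_lim)
    then have E: "(\<lambda>n. ell n ^ 3 / sqrt (real n * r n)) \<longlonglongrightarrow> 0"
    proof (rule Lim_null_le[OF tendsto_eq_rhs])
      show "\<forall>\<^sub>F n in sequentially. \<bar>ell n ^ 3 / sqrt (real n * r n)\<bar>
          \<le> sqrt ((2 * real k) ^ 3 * err n)"
        using basic r ell_pos
      proof eventually_elim
        case (elim n)
        have ell: "ell n ^ 2 = 2 * real k * L n" "ell n > 0"
          using elim k by (auto simp: ell_def)
        have "(ell n ^ 3 / sqrt (real n * r n)) ^ 2 = (ell n ^ 2) ^ 3 / (real n * r n)"
          using elim by (simp add: power_divide power2_eq_square power3_eq_cube)
        also have "\<dots> = (2 * real k) ^ 3 * (L n ^ 3 / (real n * r n))"
          unfolding ell(1) by (simp add: power_mult_distrib)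
        also have "\<dots> \<le> (2 * real k) ^ 3 * err n"
          unfolding err_def
        proof (intro mult_left_mono divide_left_mono)
          show "real n * q n * (1 - q n) ^ 3 \<le> real n * r n"
            unfolding mult.assoc using elim by (intro mult_left_mono) auto
        qed (use elim in auto)
        finally show ?case using elim ell by (intro real_le_rsqrt) auto
      qed
    qed simp
    have "(\<lambda>n. (x n / ell n) ^ 3 * (sqrt (real n / real (N n)) * (ell n ^ 3 / sqrt (real n * r n)))) \<longlonglongrightarrow> 1 ^ 3 * (sqrt 1 * 0)"
      by (intro tendsto_intros x_ell E Nlim)
    moreover have "\<forall>\<^sub>F n in sequentially. (x n / ell n) ^ 3 * (sqrt (real n / real (N n)) * (ell n ^ 3 / sqrt (real n * r n)))
        = x n ^ 3 / sqrt (real (N n) * r n)"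
      using ell_pos eventually_gt_at_top[of 0]
    proof eventually_elim
      case (elim n)
      then have "ell n \<noteq> 0" "sqrt (real n) \<noteq> 0" by auto
      then show ?case by (simp add: power_divide real_sqrt_divide real_sqrt_mult)
    qed
    ultimately show ?thesis by (rule Lim_transform_eventually[THEN tendsto_eq_rhs]) simp
  qed
  have "binomial_moderate N j q"
    unfolding binomial_moderate_def x_def[symmetric]
  proof (intro conjI x_top cube)
    show "\<forall>\<^sub>F n in sequentially. 0 < q n \<and> q n < 1"
      using basic by eventually_elim auto
    show "\<forall>\<^sub>F n in sequentially. 0 < q n \<and> q n * (1 - q n) ^ 3 \<le> q n"
      using basic by eventually_elim (auto intro!: mult_left_le power_le_one)
    show "\<forall>\<^sub>F n in sequentially. 0 < 1 - q n \<and> q n * (1 - q n) ^ 3 \<le> 1 - q n"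
      using basic
    proof eventually_elim
      case (elim n)
      have "q n * (1 - q n) ^ 3 \<le> 1 * (1 - q n) ^ 1"
        using elim by (intro mult_mono power_decreasing) auto
      then show ?case using elim by simp
    qed
  qed
  note bm = binomial_moderate.binomial_tail_asymp[OF this, folded x_def]
  \<comment> \<open>In w^2 the square of \<open>ell\<close> gives 2 k L and the cross terms give -2
    rho and 2 th tilt; the rest vanishes. The factor n / (n - c) changes this by c / (n - c) times
    O(L).\<close>
  have "(\<lambda>n. x n ^ 2 / 2 - (real k * L n - rho n)) \<longlonglongrightarrow> 0"
  proof -
    have W: "(\<lambda>n. th n * tilt n + (th n / s n - rho n / ell n) ^ 2 / 2) \<longlonglongrightarrow> 0 + (0 - 0) ^ 2 / 2"
      by (intro tendsto_intros th_mult[OF tilt_lim] ths rho_ell) simp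
    define K where "K = ln (fact k) + ln (4 * pi * real k) / 2 - y"
    have W2: "(\<lambda>n. real c / (real n - real c)) \<longlonglongrightarrow> 0" by real_asymp
    have W3: "(\<lambda>n. real c / (real n - real c) * (real k * L n - (ln (L n) / 2 + K))) \<longlonglongrightarrow> 0"
      unfolding L_def using k by real_asymp
    have "(\<lambda>n. (th n * tilt n + (th n / s n - rho n / ell n) ^ 2 / 2)
        + real c / (real n - real c) * (th n * tilt n + (th n / s n - rho n / ell n) ^ 2 / 2)
        + real c / (real n - real c) * (real k * L n - (ln (L n) / 2 + K))) \<longlonglongrightarrow>
        (0 + (0 - 0) ^ 2 / 2) + 0 * (0 + (0 - 0) ^ 2 / 2) + 0"
      by (intro tendsto_add tendsto_mult W W2 W3)
    moreover have "\<forall>\<^sub>F n in sequentially. (th n * tilt n + (th n / s n - rho n / ell n) ^ 2 / 2)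
        + real c / (real n - real c) * (th n * tilt n + (th n / s n - rho n / ell n) ^ 2 / 2)
        + real c / (real n - real c) * (real k * L n - (ln (L n) / 2 + K)) = x n ^ 2 / 2 - (real k * L n - rho n)"
      using basic N_eq x_eq rho_eq
    proof eventually_elim
      case (elim n)
      define g where "g = th n * tilt n + (th n / s n - rho n / ell n) ^ 2 / 2"
      have s0: "s n \<noteq> 0" "tilt n \<noteq> 0" using elim by auto
      have ell: "ell n ^ 2 = 2 * real k * L n"
        using elim k by (auto simp: ell_def)
      have "w n ^ 2 = ell n ^ 2 - 2 * (ell n * (rho n / ell n)) + 2 * th n * (ell n / s n) + (th n / s n - rho n / ell n) ^ 2"
        by (simp add: w_def power2_eq_square algebra_simps)
      also have "ell n * (rho n / ell n) = rho n" using s0 by (auto simp: ell_def)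
      also have "ell n / s n = tilt n" using s0 by (auto simp: ell_def)
      finally have w2: "w n ^ 2 / 2 = (real k * L n - rho n) + g"
        by (simp add: g_def ell)
      have N1: "real n / real (N n) = 1 + real c / (real n - real c)"
        using elim by (simp add: field_simps)
      have "x n ^ 2 / 2 = real n / real (N n) * (w n ^ 2 / 2)"
        using elim by (simp add: power_mult_distrib)
      also have "\<dots> = (real k * L n - rho n) + g + real c / (real n - real c) * g + real c / (real n - real c) * (real k * L n - rho n)"
        unfolding N1 w2 by (simp only: distrib_left distrib_right mult_1_left)
      finally have X: "x n ^ 2 / 2 = \<dots>" .
      have "ln (L n) / 2 + K = rho n" using elim by (simp add: K_def)
      then show ?case unfolding g_def[symmetric] X by simp
    qed
    ultimately show ?thesis by (rule Lim_transform_eventually[THEN tendsto_eq_rhs]) simp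
  qed
  then have "(\<lambda>n. measure_pmf.prob (binomial_pmf (N n) (q n)) {i. i \<ge> j n} * (x n * sqrt (2 * pi) * exp (x n ^ 2 / 2))
      * (exp (- (x n ^ 2 / 2 - (real k * L n - rho n))) / (x n / ell n)) * (fact k * exp (- y))) \<longlonglongrightarrow>
      1 * (exp (- 0) / 1) * (fact k * exp (- y))"
    by (intro tendsto_mult tendsto_divide tendsto_exp tendsto_minus bm x_ell tendsto_const) auto
  moreover have "\<forall>\<^sub>F n in sequentially. measure_pmf.prob (binomial_pmf (N n) (q n)) {i. i \<ge> j n} * (x n * sqrt (2 * pi) * exp (x n ^ 2 / 2))
      * (exp (- (x n ^ 2 / 2 - (real k * L n - rho n))) / (x n / ell n)) * (fact k * exp (- y))
     = real n ^ k * measure_pmf.prob (binomial_pmf (n - c) (q n)) {i. real i > b n - real c'}"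
    using basic ell_pos filterlim_at_top[THEN iffD1, OF x_top, rule_format, of 1]
  proof eventually_elim
    case (elim n)
    have set: "{i. real i > b n - real c'} = {i. i \<ge> j n}"
      unfolding j_def nat_le_iff by (auto simp: zle_add1_eq_le floor_less_iff int_less_real_le algebra_simps) linarith+
    have L0: "L n > 0" "real n > 0" using elim by auto
    define z where "z = 4 * pi * real k * L n"
    have z: "z > 0" using L0 k by (simp add: z_def)
    have "exp (rho n) = exp (ln (fact k)) * exp (ln z / 2) / exp y"
      unfolding rho_def z_def[symmetric] by (simp add: exp_diff exp_add)
    also have "exp (ln z / 2) = sqrt z" using z by (simp flip: ln_sqrt)
    \<comment> \<open>As ell^2 = 2 k L, the number 4 pi k L is 2 pi ell^2: the logarithm in
      \<open>a_seq\<close> is there to cancel the Gaussian prefactor.\<close>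
    also have "sqrt z = ell n * sqrt (2 * pi)"
      using elim by (simp add: z_def ell_def flip: real_sqrt_mult)
    finally have er: "exp (rho n) = fact k * (ell n * sqrt (2 * pi)) * exp (- y)"
      by (simp add: exp_minus field_simps)
    have ek: "exp (real k * L n) = real n ^ k"
      using L0 by (simp add: L_def exp_of_nat_mult)
    have "exp (- (x n ^ 2 / 2 - (real k * L n - rho n))) = exp (real k * L n) / (exp (rho n) * exp (x n ^ 2 / 2))"
      by (simp add: exp_diff exp_minus exp_add[symmetric])
    then have ex: "exp (- (x n ^ 2 / 2 - (real k * L n - rho n))) = real n ^ k / (fact k * (ell n * sqrt (2 * pi)) * exp (- y) * exp (x n ^ 2 / 2))"
      unfolding ek er .
    have pos: "x n > 0" "ell n > 0" using elim by auto
    have alg: "P * (x * r * e) * (m / (f * (l * r) * t * e) / (x / l)) * (f * t) = m * P"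
      if "x > 0" "l > 0" "r > 0" "e > 0" "f > 0" "t > 0" for P x r e m f l t :: real
      using that by (simp add: field_simps)
    show ?case
      unfolding set ex N_def[symmetric] by (rule alg) (use pos in auto)
  qed
  ultimately show ?thesis by (rule Lim_transform_eventually[THEN tendsto_eq_rhs]) simp
qed

text \<open>The first two terms of \<open>cut\<close> are the mean number of common neighbours of a \<open>j\<close>-subset once a \<open>k\<close>-superset is
  tilted to the level \<open>b\<close>. The slack is such that exceeding \<open>cut\<close> costs \<open>(1 - p)^2 ln n\<close> in the exponent, while
  below \<open>cut\<close> the second \<open>k\<close>-set still has a gain of order \<open>(1 - p) ln n\<close>; the optimal \<open>codeg_tilt\<close> is not needed.\<close>

definition cut :: "nat \<Rightarrow> nat \<Rightarrow> real" where
  "cut j n = real n * p n ^ j + tilt n * (real n * q n * (1 - p n ^ j))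
     + (1 - p n) * L n / (2 * real k * tilt n * p n ^ (k - j))"

definition codeg_tilt :: "nat \<Rightarrow> nat \<Rightarrow> real" where
  "codeg_tilt j n = p n ^ (k - j) * (1 - p n) * tilt n / (4 * real k ^ 2)"

section \<open>Exponential moments for overlapping exceptional sets\<close>

lemma powers:
  assumes "0 < j" "j < k" "0 < p n" "p n < 1"
  shows "0 < p n ^ j" "p n ^ j < 1" "0 < p n ^ (k - j)" "p n ^ (k - j) < 1" "p n ^ j * p n ^ (k - j) = q n"
    "1 - p n ^ j \<le> 1 - q n"
proof -
  show "0 < p n ^ j" "0 < p n ^ (k - j)" using assms by auto
  show "p n ^ j < 1" "p n ^ (k - j) < 1" using assms by (auto simp: power_less_one_iff)
  show "p n ^ j * p n ^ (k - j) = q n" using assms by (simp add: q_def flip: power_add)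
  show "1 - p n ^ j \<le> 1 - q n" using assms by (auto simp: q_def intro!: power_decreasing)
qed

lemma tilt_small: "\<forall>\<^sub>F n in sequentially. tilt n \<le> 1 / 20"
  using order_tendstoD(2)[OF tilt_lim, of "1/20"] by (auto elim: eventually_mono)

lemma exp_kL: "n > 0 \<Longrightarrow> exp (real i * L n) = real n ^ i"
  by (simp add: L_def exp_of_nat_mult)

text \<open>In the exponent the terms linear in \<open>codeg_tilt\<close> cancel, as the first two
  terms of \<open>cut\<close> are the mean codegree under the main tilt. Only the slack of
  \<open>cut\<close> gains and only the square of \<open>codeg_tilt\<close> loses.\<close>

lemma large_codegree_bound:
  assumes j: "0 < j" "j < k"
  shows "(\<lambda>n. real n ^ k * (exp (tilt n) powr (- b n) * exp (codeg_tilt j n) powr (- cut j n)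
      * (1 + p n ^ j * (exp (codeg_tilt j n) * (1 + p n ^ (k - j) * (exp (tilt n) - 1)) - 1)) ^ (n - k))) \<longlonglongrightarrow> 0"
    (is "?f \<longlonglongrightarrow> 0")
proof (rule exp_decay)
  have k: "real k > 0" using k1 by simp
  show "1 / (16 * real k ^ 3) > 0" using k by simp
  have "(\<lambda>n. 10 * (real n * q n * tilt n ^ 3)) \<longlonglongrightarrow> 10 * 0"
    by (intro tendsto_intros cubic_lim)
  then show "(\<lambda>n. 10 * (real n * q n * tilt n ^ 3)) \<longlonglongrightarrow> 0" by simp
  show "\<forall>\<^sub>F n in sequentially. 0 \<le> ?f n \<and> ?f n
     \<le> exp (rho n - 1 / (16 * real k ^ 3) * ((1 - p n)^2 * L n) + 10 * (real n * q n * tilt n ^ 3))"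
    using basic tilt_small b_eq
  proof eventually_elim
    case (elim n)
    define P S a c where "P = p n ^ j" and "S = p n ^ (k - j)" and "a = tilt n" and "c = codeg_tilt j n"
    define nq where "nq = real n * q n"
    have n: "n > 0" "real n > 0" and p: "0 < p n" "p n < 1" using elim by auto
    note pw = powers[OF j p, folded P_def S_def]
    have a: "0 < a" "a \<le> 1 / 20" using elim by (auto simp: a_def)
    have c_eq: "c = S * a * ((1 - p n) / (4 * real k ^ 2))" by (simp add: c_def codeg_tilt_def S_def a_def)
    have small: "0 \<le> (1 - p n) / (4 * real k ^ 2)" "(1 - p n) / (4 * real k ^ 2) \<le> 1"
    proof -
      have "1 \<le> real k ^ 2" using k1 by simp
      then show "(1 - p n) / (4 * real k ^ 2) \<le> 1" using p by (simp add: divide_le_eq)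
      show "0 \<le> (1 - p n) / (4 * real k ^ 2)" using p by simp
    qed
    have c: "0 \<le> c" "c \<le> S * a"
    proof -
      show "0 \<le> c" unfolding c_eq by (rule mult_nonneg_nonneg[OF _ small(1)]) (use pw a in auto)
      show "c \<le> S * a" unfolding c_eq by (rule mult_left_le[OF small(2)]) (use pw a in auto)
    qed
    define Lam where "Lam = a * (P * S) + c * P
         + (a^2 * (P * S) * (1 - P * S) + 2 * a * c * (P * S) * (1 - P) + c^2 * P * (1 - P)) / 2
         + 10 * a^3 * (P * S)"
    define mg where "mg = 1 + P * (exp c * (1 + S * (exp a - 1)) - 1)"
    have PS: "P * S \<le> 1" using pw by (intro mult_le_one) auto
    have Lam0: "Lam \<ge> 0"
      unfolding Lam_def using a c pw PS by (intro add_nonneg_nonneg divide_nonneg_nonneg mult_nonneg_nonneg) auto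
    have mg0: "mg \<ge> 0"
    proof -
      have "1 * 1 \<le> exp c * (1 + S * (exp a - 1))"
        using a c pw by (intro mult_mono) auto
      then show ?thesis unfolding mg_def using pw by simp
    qed
    have "mg \<le> exp Lam"
      unfolding mg_def Lam_def by (rule mgf_two_level) (use pw a c in auto)
    then have "mg ^ (n - k) \<le> exp Lam ^ (n - k)" using mg0 by (rule power_mono)
    also have "\<dots> \<le> exp Lam ^ n" using Lam0 by (intro power_increasing) auto
    also have "\<dots> = exp (real n * Lam)" by (simp add: exp_of_nat_mult)
    finally have mgn: "mg ^ (n - k) \<le> exp (real n * Lam)" .
    have rw: "exp a powr (- b n) = exp (- (a * b n))" "exp c powr (- cut j n) = exp (- (c * cut j n))"
      by (simp_all add: powr_def mult.commute)
    have "real n ^ k * (exp a powr (- b n) * exp c powr (- cut j n) * mg ^ (n - k))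
        \<le> real n ^ k * (exp a powr (- b n) * exp c powr (- cut j n) * exp (real n * Lam))"
      by (intro mult_left_mono mgn) auto
    also have "\<dots> = exp (real k * L n - a * b n - c * cut j n + real n * Lam)"
      unfolding rw exp_kL[OF n(1), symmetric] by (simp add: exp_add[symmetric])
    also have "\<dots> \<le> exp (rho n - 1 / (16 * real k ^ 3) * ((1 - p n)^2 * L n) + 10 * (nq * a ^ 3))"
    proof -
      define e where "e = (1 - p n) * L n / (2 * real k * a * S)"
      have ab: "a * b n = a * nq + a^2 * nq * (1 - q n) - rho n"
      proof -
        have bq: "b n = nq + a * (nq * (1 - q n)) - rho n / a"
          using elim unfolding a_def nq_def by blast
        show ?thesis unfolding bq using a by (simp add: algebra_simps power2_eq_square)
      qed
      have kL: "a^2 * nq * (1 - q n) = 2 * real k * L n"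
        using elim unfolding a_def nq_def by simp
      have ct: "cut j n = real n * P + a * (nq * (1 - P)) + e"
        by (simp add: cut_def P_def S_def a_def nq_def e_def)
      have nL: "real n * Lam = a * nq + c * (real n * P)
          + (a^2 * nq * (1 - q n) + 2 * a * c * nq * (1 - P) + c^2 * (real n * P) * (1 - P)) / 2 + 10 * (nq * a^3)"
        unfolding Lam_def pw(5) nq_def by (simp add: algebra_simps add_divide_distrib diff_divide_distrib)
      have ce: "c * e = (1 - p n)^2 * L n / (8 * real k ^ 3)"
        unfolding c_eq e_def using a pw k by (simp add: field_simps power2_eq_square power3_eq_cube)
      have "c^2 * (real n * P) * (1 - P) \<le> c^2 * (real n * P) * (1 - q n)"
        using pw n by (intro mult_left_mono) auto
      also have "\<dots> = S * ((1 - p n) / (4 * real k ^ 2))^2 * (a^2 * nq * (1 - q n))"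
        unfolding c_eq nq_def pw(5)[symmetric] by (simp add: power2_eq_square mult_ac)
      also have "\<dots> \<le> 1 * ((1 - p n) / (4 * real k ^ 2))^2 * (a^2 * nq * (1 - q n))"
        using pw elim by (intro mult_right_mono) (auto simp: kL)
      also have "\<dots> = (1 - p n)^2 * L n / (8 * real k ^ 3)"
        unfolding kL using k by (simp add: field_simps power2_eq_square power3_eq_cube power4_eq_xxxx)
      finally have c2: "c^2 * (real n * P) * (1 - P) \<le> (1 - p n)^2 * L n / (8 * real k ^ 3)" .
      \<comment> \<open>The slack gains \<open>c * e = 2 * D\<close>, and half of the bound
        \<open>c2\<close> costs at most \<open>D\<close>; the 4 k^2 in \<open>codeg_tilt\<close>
        balances the two so that a net \<open>D\<close> remains.\<close>
      define D where "D = (1 - p n)^2 * L n / (16 * real k ^ 3)"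
      have D2: "(1 - p n)^2 * L n / (8 * real k ^ 3) = 2 * D" by (simp add: D_def)
      have "real k * L n - a * b n - c * cut j n + real n * Lam
         = real k * L n + rho n - c * e - (a^2 * nq * (1 - q n)) / 2 + (c^2 * (real n * P) * (1 - P)) / 2 + 10 * (nq * a^3)"
        unfolding ab ct nL by (simp add: algebra_simps add_divide_distrib diff_divide_distrib)
      also have "\<dots> \<le> rho n - D + 10 * (nq * a^3)"
        using c2 unfolding kL ce D2 by simp
      finally show ?thesis by (simp add: D_def)
    qed
    finally have "real n ^ k * (exp a powr (- b n) * exp c powr (- cut j n) * mg ^ (n - k))
        \<le> exp (rho n - 1 / (16 * real k ^ 3) * ((1 - p n)^2 * L n) + 10 * (nq * a ^ 3))" .
    moreover have "0 \<le> real n ^ k * (exp a powr (- b n) * exp c powr (- cut j n) * mg ^ (n - k))"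
      using mg0 by simp
    ultimately show ?case
      unfolding mg_def P_def S_def a_def c_def nq_def by blast
  qed
qed

text \<open>The n^(k-j) sets through S are beaten because, with the codegree at most
  \<open>cut\<close>, the exponent is at most -k L (1 - p^(k-j)) / (1 - p^k) up to the slack, and
  \<open>geom_sum_gap\<close> leaves (1-p) L / k to spare. The level is \<open>b - k\<close> since
  up to k common neighbours of the second set may lie in the first.\<close>

lemma overlap_bound:
  assumes j: "0 < j" "j < k"
  shows "(\<lambda>n. real n ^ (k - j) * (exp (tilt n) powr (- (b n - real k))
      * (1 + p n ^ (k - j) * (exp (tilt n) - 1)) powr cut j n)) \<longlonglongrightarrow> 0"
    (is "?f \<longlonglongrightarrow> 0")
proof (rule exp_decay)
  have k: "real k > 0" using k1 by simp
  show "1 / (4 * real k) > 0" using k by simp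
  have "(\<lambda>n. real k * tilt n + 11 * (real n * q n * tilt n ^ 3)) \<longlonglongrightarrow> real k * 0 + 11 * 0"
    by (intro tendsto_intros cubic_lim tilt_lim)
  then show "(\<lambda>n. real k * tilt n + 11 * (real n * q n * tilt n ^ 3)) \<longlonglongrightarrow> 0" by simp
  show "\<forall>\<^sub>F n in sequentially. 0 \<le> ?f n \<and> ?f n
     \<le> exp (rho n - 1 / (4 * real k) * ((1 - p n)^2 * L n) + (real k * tilt n + 11 * (real n * q n * tilt n ^ 3)))"
    using basic tilt_small b_eq
  proof eventually_elim
    case (elim n)
    define P S a where "P = p n ^ j" and "S = p n ^ (k - j)" and "a = tilt n"
    define nq where "nq = real n * q n"
    define e where "e = (1 - p n) * L n / (2 * real k * a * S)"
    have n: "n > 0" "real n > 0" and p: "0 < p n" "p n < 1" using elim by auto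
    note pw = powers[OF j p, folded P_def S_def]
    have a: "0 < a" "a \<le> 1 / 20" using elim by (auto simp: a_def)
    have L0: "L n > 0" using elim by simp
    have nq0: "nq \<ge> 0" using elim by (simp add: nq_def)
    have e0: "e \<ge> 0" unfolding e_def using p L0 k a pw by (intro divide_nonneg_nonneg mult_nonneg_nonneg) auto
    have ct: "cut j n = real n * P + a * (nq * (1 - P)) + e"
      by (simp add: cut_def P_def S_def a_def nq_def e_def)
    have ct0: "cut j n \<ge> 0" unfolding ct using e0 nq0 a pw by (intro add_nonneg_nonneg mult_nonneg_nonneg) auto
    define mg where "mg = 1 + S * (exp a - 1)"
    have mg0: "mg > 0"
      unfolding mg_def using pw a by (intro add_pos_nonneg mult_nonneg_nonneg) auto
    \<comment> \<open>The one-level case \<open>P = 1\<close>, \<open>c = 0\<close>: the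
      neighbourhood of S is already known here.\<close>
    have "1 + 1 * (exp 0 * mg - 1) \<le> exp (a * (1 * S) + 0 * 1
         + (a^2 * (1 * S) * (1 - 1 * S) + 2 * a * 0 * (1 * S) * (1 - 1) + 0^2 * 1 * (1 - 1)) / 2
         + 10 * a^3 * (1 * S))"
      unfolding mg_def by (rule mgf_two_level) (use pw a in auto)
    then have mg: "mg \<le> exp (a * S + a^2 * S * (1 - S) / 2 + 10 * a^3 * S)" by simp
    have "mg powr cut j n \<le> exp (a * S + a^2 * S * (1 - S) / 2 + 10 * a^3 * S) powr cut j n"
      using mg mg0 ct0 by (intro powr_mono2) auto
    also have "\<dots> = exp (cut j n * (a * S + a^2 * S * (1 - S) / 2 + 10 * a^3 * S))"
      by (simp add: powr_def)
    finally have mgn: "mg powr cut j n \<le> \<dots>" .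
    have rw: "exp a powr (- (b n - real k)) = exp (- (a * b n) + real k * a)"
      by (simp add: powr_def algebra_simps)
    have "real n ^ (k - j) * (exp a powr (- (b n - real k)) * mg powr cut j n)
        \<le> real n ^ (k - j) * (exp a powr (- (b n - real k)) * exp (cut j n * (a * S + a^2 * S * (1 - S) / 2 + 10 * a^3 * S)))"
      by (intro mult_left_mono mgn) auto
    also have "\<dots> = exp (real (k - j) * L n - a * b n + real k * a + cut j n * (a * S + a^2 * S * (1 - S) / 2 + 10 * a^3 * S))"
      unfolding rw exp_kL[OF n(1), symmetric] by (simp add: exp_add[symmetric] algebra_simps)
    also have "\<dots> \<le> exp (rho n - 1 / (4 * real k) * ((1 - p n)^2 * L n) + (real k * a + 11 * (nq * a ^ 3)))"
    proof -
      \<comment> \<open>A quarter of the gain from \<open>geom_sum_gap\<close>: the slack of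
        \<open>cut\<close> takes \<open>2 * X\<close>, its second-order effect at most another
        \<open>X\<close>, and one \<open>X\<close> remains.\<close>
      define X where "X = (1 - p n) * L n / (4 * real k)"
      have X0: "X \<ge> 0" using p L0 k by (simp add: X_def)
      have ab: "a * b n = a * nq + a^2 * nq * (1 - q n) - rho n"
      proof -
        have bq: "b n = nq + a * (nq * (1 - q n)) - rho n / a"
          using elim unfolding a_def nq_def by blast
        show ?thesis unfolding bq using a by (simp add: algebra_simps power2_eq_square)
      qed
      have kL: "a^2 * nq * (1 - q n) = 2 * real k * L n"
        using elim unfolding a_def nq_def by simp
      have aSe: "a * S * e = 2 * X"
        unfolding e_def X_def using a pw k by (simp add: field_simps)
      define D where "D = a * (nq * (1 - P)) + e"
      have SD: "S * (real n * P) = nq" using pw(5) by (simp add: nq_def mult_ac)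
      have D0: "D \<ge> 0" unfolding D_def using e0 nq0 a pw by (intro add_nonneg_nonneg mult_nonneg_nonneg) auto
      have h1: "real n * P * (a * S + a^2 * S * (1 - S) / 2 + 10 * a^3 * S)
          = a * nq + a^2 * nq * (1 - S) / 2 + 10 * (nq * a^3)"
        unfolding SD[symmetric] by (simp add: algebra_simps)
      have h2: "a * S * D = a^2 * nq * (S * (1 - P)) + 2 * X"
        unfolding D_def aSe[symmetric] by (simp add: algebra_simps power2_eq_square)
      have SP: "S * (1 - P) = S - q n" using pw(5) by (simp add: algebra_simps)
      have "D * (a^2 * S * (1 - S) / 2 + 10 * a^3 * S) = (a * (a * S * D)) * ((1 - S) / 2 + 10 * a)"
        by (simp add: algebra_simps power2_eq_square power3_eq_cube)
      also have "\<dots> \<le> (a * (a * S * D)) * 1"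
      proof (rule mult_left_mono)
        have "(1 - S) / 2 \<le> 1 / 2" using pw(3) by simp
        then show "(1 - S) / 2 + 10 * a \<le> 1" using a(2) by linarith
      qed (use a pw D0 in auto)
      also have "\<dots> = nq * a^3 * (S * (1 - P)) + a * (2 * X)"
        unfolding h2 by (simp add: algebra_simps power2_eq_square power3_eq_cube)
      also have "\<dots> \<le> nq * a^3 * 1 + 1 / 2 * (2 * X)"
      proof (intro add_mono mult_left_mono mult_right_mono)
        show "S * (1 - P) \<le> 1" using pw by (intro mult_le_one) auto
      qed (use nq0 a X0 in auto)
      finally have h3: "D * (a^2 * S * (1 - S) / 2 + 10 * a^3 * S) \<le> nq * a^3 + X" by simp
      have gap: "real (k - j) + (1 - p n) / real k \<le> real k * (1 - S) / (1 - q n)"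
        unfolding S_def q_def by (rule geom_sum_gap) (use p j in auto)
      have q1: "1 - q n > 0" using elim by simp
      have main: "a^2 * nq * (1 - S) / 2 \<ge> (real (k - j) + (1 - p n) / real k) * L n"
      proof -
        have "a^2 * nq = 2 * real k * L n / (1 - q n)"
          using kL q1 by (simp add: nonzero_eq_divide_eq)
        moreover have "2 * x * l / d * u / 2 = x * u / d * l" for x l d u :: real by simp
        ultimately have "a^2 * nq * (1 - S) / 2 = real k * (1 - S) / (1 - q n) * L n" by presburger
        moreover have "(real (k - j) + (1 - p n) / real k) * L n \<le> real k * (1 - S) / (1 - q n) * L n"
          using gap L0 by (intro mult_right_mono) auto
        ultimately show ?thesis by presburger
      qed
      have X4: "(1 - p n) / real k * L n = 4 * X" by (simp add: X_def)
      have "real (k - j) * L n - a * b n + real k * a + cut j n * (a * S + a^2 * S * (1 - S) / 2 + 10 * a^3 * S)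
        = real (k - j) * L n + rho n + real k * a - a^2 * nq * (1 - q n) + a^2 * nq * (1 - S) / 2
          + 10 * (nq * a^3) + a * S * D + D * (a^2 * S * (1 - S) / 2 + 10 * a^3 * S) "
      proof -
        have "cut j n * (a * S + a^2 * S * (1 - S) / 2 + 10 * a^3 * S)
           = real n * P * (a * S + a^2 * S * (1 - S) / 2 + 10 * a^3 * S)
             + (a * S * D + D * (a^2 * S * (1 - S) / 2 + 10 * a^3 * S))"
        proof -
          have "(u + D) * (a * S + v + w) = u * (a * S + v + w) + (a * S * D + D * (v + w))" for u v w
            by (simp add: algebra_simps)
          moreover have "cut j n = real n * P + D" unfolding ct D_def by simp
          ultimately show ?thesis by simp
        qed
        then show ?thesis unfolding ab h1 by simp
      qed
      also have "\<dots> \<le> real (k - j) * L n + rho n + real k * a - a^2 * nq * (1 - S) / 2 + 11 * (nq * a^3) + 3 * X"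
      proof -
        have "- (a^2 * nq * (1 - q n)) + a^2 * nq * (1 - S) / 2 + a * S * D = - (a^2 * nq * (1 - S) / 2) + 2 * X"
          unfolding h2 SP by (simp add: algebra_simps)
        then show ?thesis using h3 by linarith
      qed
      also have "\<dots> \<le> rho n - X + (real k * a + 11 * (nq * a^3))"
        using main unfolding distrib_right X4 by linarith
      also have "\<dots> \<le> rho n - 1 / (4 * real k) * ((1 - p n)^2 * L n) + (real k * a + 11 * (nq * a^3))"
      proof -
        have "(1 - p n)^2 * L n \<le> (1 - p n) * L n"
          using p L0 by (intro mult_right_mono) (auto simp: power2_eq_square mult_left_le)
        then have "1 / (4 * real k) * ((1 - p n)^2 * L n) \<le> 1 / (4 * real k) * ((1 - p n) * L n)"
          using k by (intro mult_left_mono) auto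
        then show ?thesis by (simp add: X_def)
      qed
      finally show ?thesis by simp
    qed
    finally have "real n ^ (k - j) * (exp a powr (- (b n - real k)) * mg powr cut j n)
       \<le> exp (rho n - 1 / (4 * real k) * ((1 - p n)^2 * L n) + (real k * a + 11 * (nq * a ^ 3)))" .
    moreover have "0 \<le> real n ^ (k - j) * (exp a powr (- (b n - real k)) * mg powr cut j n)" by simp
    ultimately show ?case
      unfolding mg_def S_def a_def nq_def by blast
  qed
qed

end

section \<open>Counting exceptional vertex sets\<close>

lemma nbrs_in_mono: "U \<subseteq> U' \<Longrightarrow> nbrs_in U B E \<subseteq> nbrs_in U' B E"
  by (auto simp: nbrs_in_def)

lemma nbrs_in_Un: "nbrs_in U (A \<union> B) E = nbrs_in U A E \<inter> nbrs_in U B E"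
  by (auto simp: nbrs_in_def)

lemma finite_nbrs_in: "finite U \<Longrightarrow> finite (nbrs_in U B E)"
  by (simp add: nbrs_in_def)

lemma card_nbrs_in_le_add:
  assumes "finite U" "finite K" "U \<subseteq> U' \<union> K" "finite U'"
  shows "card (nbrs_in U B E) \<le> card (nbrs_in U' B E) + card K"
proof -
  have "card (nbrs_in U B E) \<le> card (nbrs_in U' B E \<union> K)"
    using assms by (intro card_mono) (auto simp: nbrs_in_def)
  also have "\<dots> \<le> card (nbrs_in U' B E) + card K" by (rule card_Un_le)
  finally show ?thesis .
qed

lemma common_nbrs_eq: "common_nbrs n E V = nbrs_in ({1..n} - V) V E"
  by (simp add: common_nbrs_def nbrs_in_def)

lemma finite_all_edges: "finite (all_edges n)"
  by (rule finite_subset[of _ "Pow {1..n}"]) (auto simp: all_edges_def)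

lemma edges_between_subset:
  "U \<subseteq> {1..n} \<Longrightarrow> B \<subseteq> {1..n} \<Longrightarrow> U \<inter> B = {} \<Longrightarrow> edges_between U B \<subseteq> all_edges n"
proof (clarsimp simp: edges_between_def all_edges_def)
  fix u v assume "U \<subseteq> {Suc 0..n}" "B \<subseteq> {Suc 0..n}" "U \<inter> B = {}" "u \<in> U" "v \<in> B"
  then show "Suc 0 \<le> u \<and> u \<le> n \<and> Suc 0 \<le> v \<and> v \<le> n \<and> card {u, v} = 2"
    by (auto simp: card_insert_if)
qed

lemma edges_between_disjoint:
  "U \<inter> A = {} \<Longrightarrow> U \<inter> B = {} \<Longrightarrow> A \<inter> B = {} \<Longrightarrow> edges_between U A \<inter> edges_between U B = {}"
  by (auto simp: edges_between_def doubleton_eq_iff)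

definition ksets :: "nat \<Rightarrow> nat \<Rightarrow> nat set set" where
  "ksets n k = {V. V \<subseteq> {1..n} \<and> card V = k}"

lemma finite_ksets: "finite (ksets n k)"
  by (rule finite_subset[of _ "Pow {1..n}"]) (auto simp: ksets_def)

lemma card_ksets: "card (ksets n k) = n choose k"
  using n_subsets[of "{1..n}" k] by (simp add: ksets_def)

lemma card_ksets_le: "real (card (ksets n k)) \<le> real n ^ k"
proof -
  have "n choose k \<le> n ^ k"
    by (cases "k \<le> n") (auto simp: binomial_le_pow binomial_eq_0)
  then show ?thesis unfolding card_ksets by (metis of_nat_le_iff of_nat_power)
qed

text \<open>Once the intersection with \<open>V\<close> is prescribed, \<open>V'\<close> is
  determined by \<open>V' - V\<close>.\<close>

lemma card_ksets_Int_eq_le: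
  assumes V: "V \<in> ksets n k" and S: "S \<subseteq> V"
  shows "real (card {V' \<in> ksets n k. V \<inter> V' = S}) \<le> real n ^ (k - card S)"
proof -
  let ?X = "{V' \<in> ksets n k. V \<inter> V' = S}"
  have fV: "finite V" using V finite_subset by (auto simp: ksets_def)
  have "card ?X \<le> card (ksets n (k - card S))"
  proof (rule card_inj_on_le)
    show "inj_on (\<lambda>V'. V' - V) ?X"
      by (rule inj_onI) blast
    show "(\<lambda>V'. V' - V) ` ?X \<subseteq> ksets n (k - card S)"
    proof clarsimp
      fix V' assume V': "V' \<in> ksets n k" "S = V \<inter> V'"
      then have "finite V'" using finite_subset by (auto simp: ksets_def)
      then have "card (V' - V) = card V' - card (V \<inter> V')"
        by (metis card_Diff_subset_Int Int_commute finite_Int)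
      then show "V' - V \<in> ksets n (k - card (V \<inter> V'))" using V' by (auto simp: ksets_def)
    qed
  qed (rule finite_ksets)
  then have "real (card ?X) \<le> real (card (ksets n (k - card S)))" by simp
  also have "\<dots> \<le> real n ^ (k - card S)" by (rule card_ksets_le)
  finally show ?thesis .
qed

lemma card_ksets_meet_le:
  assumes V: "V \<in> ksets n k"
  shows "real (card {V' \<in> ksets n k. V \<inter> V' \<noteq> {}}) \<le> 2 ^ k * (\<Sum>j\<in>{1..k}. real n ^ (k - j))"
proof -
  let ?X = "{V' \<in> ksets n k. V \<inter> V' \<noteq> {}}" and ?S = "{S. S \<subseteq> V \<and> S \<noteq> {}}"
  let ?I = "\<lambda>S. {V' \<in> ksets n k. V \<inter> V' = S}" and ?c = "\<Sum>j\<in>{1..k}. real n ^ (k - j)"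
  have fV: "finite V" and cV: "card V = k" using V finite_subset by (auto simp: ksets_def)
  have "?X \<subseteq> (\<Union>S\<in>?S. ?I S)"
    by auto
  then have "card ?X \<le> card (\<Union>S\<in>?S. ?I S)"
    by (rule card_mono[rotated]) (use fV finite_ksets in auto)
  also have "\<dots> \<le> (\<Sum>S\<in>?S. card (?I S))"
    by (rule card_UN_le) (use fV in auto)
  finally have "real (card ?X) \<le> (\<Sum>S\<in>?S. real (card (?I S)))"
    by (simp flip: of_nat_sum)
  also have "\<dots> \<le> (\<Sum>S\<in>?S. ?c)"
  proof (rule sum_mono)
    fix S assume S: "S \<in> ?S"
    then have "card S \<in> {1..k}"
      using fV cV card_mono[of V S] finite_subset[of S V] by (auto simp: Suc_le_eq card_gt_0_iff)
    then have "real n ^ (k - card S) \<le> ?c"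
      by (intro member_le_sum) auto
    then show "real (card (?I S)) \<le> ?c"
      using order_trans[OF card_ksets_Int_eq_le[OF V, of S]] S by blast
  qed
  also have "\<dots> = real (card ?S) * ?c" by simp
  also have "\<dots> \<le> 2 ^ k * ?c"
  proof (rule mult_right_mono)
    have "card ?S \<le> card (Pow V)" by (rule card_mono) (use fV in auto)
    also have "\<dots> = 2 ^ k" using fV cV by (simp add: card_Pow)
    finally show "real (card ?S) \<le> 2 ^ k" by (metis of_nat_le_iff of_nat_numeral of_nat_power)
  qed (auto intro: sum_nonneg)
  finally show ?thesis .
qed

context
  fixes n k :: nat and p b :: real
begin

abbreviation pr :: "(nat set set \<Rightarrow> bool) \<Rightarrow> real" where
  "pr Q \<equiv> measure_pmf.prob (random_subset (all_edges n) p) {E. Q E}"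

definition big :: "nat set \<Rightarrow> nat set set \<Rightarrow> bool" where
  "big V E \<longleftrightarrow> real (card (nbrs_in ({1..n} - V) V E)) > b"

text \<open>Common neighbours in \<open>V\<close> are ignored, so that \<open>big_off V V'\<close> depends only on edges avoiding \<open>V\<close>.\<close>

definition big_off :: "nat set \<Rightarrow> nat set \<Rightarrow> nat set set \<Rightarrow> bool" where
  "big_off V V' E \<longleftrightarrow> real (card (nbrs_in ({1..n} - V - V') V' E)) > b"

definition num_big :: "nat set set \<Rightarrow> nat" where
  "num_big E = card {V \<in> ksets n k. big V E}"

definition num_big_off :: "nat set \<Rightarrow> nat set set \<Rightarrow> nat" where
  "num_big_off V E = card {V' \<in> ksets n k. V \<inter> V' = {} \<and> big_off V V' E}"

text \<open>\<open>c\<close> counts the vertices that cannot serve as common neighbours,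
  \<open>d\<close> the possible common neighbours that were ignored and must be given back.\<close>

definition tail_prob :: "nat \<Rightarrow> real \<Rightarrow> real" where
  "tail_prob c d = measure_pmf.prob (binomial_pmf (n - c) (p ^ k)) {i. real i > b - d}"

text \<open>All of \<open>V\<close> is excluded, not only \<open>S\<close>, so that
  \<open>codeg V S\<close> and \<open>big V\<close> use the same candidate vertices and read only
  edges that meet \<open>V\<close>.\<close>

definition codeg :: "nat set \<Rightarrow> nat set \<Rightarrow> nat set set \<Rightarrow> real" where
  "codeg V S E = real (card (nbrs_in ({1..n} - V) S E))"

text \<open>The factors \<open>z\<close> and \<open>v\<close>, exponentials of the tilts, and the
  cutoffs \<open>t\<close> stay free in the counting argument, which holds for every
  \<open>n\<close>; they are chosen only in the limit.\<close>

definition codeg_tail_bound :: "real \<Rightarrow> (nat \<Rightarrow> real) \<Rightarrow> (nat \<Rightarrow> real) \<Rightarrow> nat \<Rightarrow> real" where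
  "codeg_tail_bound z v t j = z powr (- b) * v j powr (- t j) * (1 + p ^ j * (v j * (1 + p ^ (k - j) * (z - 1)) - 1)) ^ (n - k)"

definition overlap_factor :: "real \<Rightarrow> (nat \<Rightarrow> real) \<Rightarrow> nat \<Rightarrow> real" where
  "overlap_factor z t j = z powr (- (b - real k)) * (1 + p ^ (k - j) * (z - 1)) powr t j"

context
  assumes p: "p \<in> {0..1}"
begin

lemma prob_nbrs_in:
  assumes "U \<subseteq> {1..n}" "B \<subseteq> {1..n}" "U \<inter> B = {}"
  shows "pr (\<lambda>E. real (card (nbrs_in U B E)) > c)
     = measure_pmf.prob (binomial_pmf (card U) (p ^ card B)) {i. real i > c}"
proof -
  have fin: "finite U" "finite B" using assms by (auto dest: finite_subset)
  have q: "p ^ card B \<in> {0..1}" using p by (auto simp: power_le_one)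
  have "binomial_pmf (card U) (p ^ card B)
      = map_pmf card (map_pmf (nbrs_in U B) (random_subset (all_edges n) p))"
    using random_subset_nbrs_in[OF fin assms(3) p finite_all_edges edges_between_subset[OF assms]]
      card_random_subset[OF fin(1) q] by simp
  then show ?thesis by (simp add: map_pmf_comp vimage_def)
qed

lemma big_off_imp: "big_off V V' E \<Longrightarrow> big V' E"
proof -
  have "card (nbrs_in ({1..n} - V - V') V' E) \<le> card (nbrs_in ({1..n} - V') V' E)"
    by (intro card_mono finite_nbrs_in nbrs_in_mono) auto
  then show "big_off V V' E \<Longrightarrow> big V' E" by (simp add: big_def big_off_def)
qed

text \<open>The partition behind all independence statements: edges meeting \<open>V\<close> decide
  \<open>big V\<close> and \<open>codeg V S\<close>, edges avoiding \<open>V\<close> decide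
  \<open>big_off V\<close>.\<close>

lemma touching:
  fixes V :: "nat set"
  defines "A \<equiv> {e \<in> all_edges n. e \<inter> V \<noteq> {}}" and "B \<equiv> {e \<in> all_edges n. e \<inter> V = {}}"
  assumes V: "V \<subseteq> {1..n}"
  shows "A \<subseteq> all_edges n" "B \<subseteq> all_edges n" "A \<inter> B = {}"
    "S \<subseteq> V \<Longrightarrow> U \<subseteq> {1..n} - V \<Longrightarrow> nbrs_in U S (E \<inter> A) = nbrs_in U S E"
    "V' \<subseteq> {1..n} \<Longrightarrow> V \<inter> V' = {} \<Longrightarrow> nbrs_in ({1..n} - V - V') V' (E \<inter> B) = nbrs_in ({1..n} - V - V') V' E"
proof -
  show "A \<subseteq> all_edges n" "B \<subseteq> all_edges n" "A \<inter> B = {}" by (auto simp: A_def B_def)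
  show "nbrs_in U S (E \<inter> A) = nbrs_in U S E" if "S \<subseteq> V" "U \<subseteq> {1..n} - V"
  proof (rule nbrs_in_cong)
    have "edges_between U S \<subseteq> all_edges n" using that V by (intro edges_between_subset) auto
    then show "edges_between U S \<subseteq> A" using that by (auto simp: A_def edges_between_def)
  qed
  show "nbrs_in ({1..n} - V - V') V' (E \<inter> B) = nbrs_in ({1..n} - V - V') V' E" if "V' \<subseteq> {1..n}" "V \<inter> V' = {}"
  proof (rule nbrs_in_cong)
    have "edges_between ({1..n} - V - V') V' \<subseteq> all_edges n" using that V by (intro edges_between_subset) auto
    then show "edges_between ({1..n} - V - V') V' \<subseteq> B" using that by (auto simp: B_def edges_between_def)
  qed
qed

lemma indep_off:
  assumes V: "V \<subseteq> {1..n}" and Q: "\<And>E. Q (E \<inter> {e \<in> all_edges n. e \<inter> V = {}}) = Q E"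
  shows "pr (\<lambda>E. big V E \<and> Q E) = pr (big V) * pr Q"
proof -
  let ?A = "{e \<in> all_edges n. e \<inter> V \<noteq> {}}" and ?B = "{e \<in> all_edges n. e \<inter> V = {}}"
  have "pr (\<lambda>E. big V (E \<inter> ?A) \<and> Q (E \<inter> ?B)) = pr (\<lambda>E. big V (E \<inter> ?A)) * pr (\<lambda>E. Q (E \<inter> ?B))"
    by (rule random_subset_indep) (auto simp: finite_all_edges)
  moreover have "big V (E \<inter> ?A) = big V E" for E
    unfolding big_def by (subst touching(4)[OF V]) auto
  ultimately show ?thesis by (simp only: Q)
qed

lemma big_off_Int:
  assumes "V \<subseteq> {1..n}" "V' \<subseteq> {1..n}" "V \<inter> V' = {}"
  shows "big_off V V' (E \<inter> {e \<in> all_edges n. e \<inter> V = {}}) = big_off V V' E"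
  unfolding big_off_def using touching(5)[OF assms] by simp

lemma indep_num_big_off:
  assumes "V \<in> ksets n k"
  shows "pr (\<lambda>E. big V E \<and> num_big_off V E = i) = pr (big V) * pr (\<lambda>E. num_big_off V E = i)"
proof (rule indep_off)
  show V: "V \<subseteq> {1..n}" using assms by (simp add: ksets_def)
  fix E
  have "{V' \<in> ksets n k. V \<inter> V' = {} \<and> big_off V V' (E \<inter> {e \<in> all_edges n. e \<inter> V = {}})}
      = {V' \<in> ksets n k. V \<inter> V' = {} \<and> big_off V V' E}"
    using big_off_Int[OF V] by (auto simp: ksets_def)
  then show "(num_big_off V (E \<inter> {e \<in> all_edges n. e \<inter> V = {}}) = i) = (num_big_off V E = i)"
    unfolding num_big_off_def by simp
qed

lemma pr_big:
  assumes "V \<in> ksets n k"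
  shows "pr (big V) = tail_prob k 0"
proof -
  have V: "V \<subseteq> {1..n}" "card V = k" "finite V" using assms finite_subset by (auto simp: ksets_def)
  have "card ({1..n} - V) = n - k" using V by (simp add: card_Diff_subset)
  then show ?thesis
    using prob_nbrs_in[of "{1..n} - V" V b] V by (auto simp: big_def tail_prob_def)
qed

lemma card_off:
  assumes "V \<in> ksets n k" "V' \<in> ksets n k" "V \<inter> V' = {}"
  shows "card ({1..n} - V - V') = n - 2 * k"
proof -
  have "finite V" "finite V'" using assms finite_subset by (auto simp: ksets_def)
  then have "card ({1..n} - (V \<union> V')) = n - card (V \<union> V')"
    using assms by (subst card_Diff_subset) (auto simp: ksets_def)
  moreover have "card (V \<union> V') = 2 * k"
    using assms \<open>finite V\<close> \<open>finite V'\<close> by (subst card_Un_disjoint) (auto simp: ksets_def)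
  ultimately show ?thesis by (simp add: Diff_Un Diff_Diff_Int set_diff_eq Int_def conj_assoc)
qed

lemma pr_big_off:
  assumes "V \<in> ksets n k" "V' \<in> ksets n k" "V \<inter> V' = {}"
  shows "pr (big_off V V') = tail_prob (2 * k) 0"
  using prob_nbrs_in[of "{1..n} - V - V'" V' b] assms card_off[OF assms]
  by (auto simp: big_off_def tail_prob_def ksets_def)

lemma pr_diff_eq:
  assumes "\<And>E. R E \<Longrightarrow> Q E"
  shows "pr (\<lambda>E. Q E \<and> \<not> R E) = pr Q - pr R"
proof -
  have "{E. Q E \<and> \<not> R E} = {E. Q E} - {E. R E}" by auto
  then show ?thesis using assms by (simp add: measure_pmf.finite_measure_Diff subset_eq)
qed

lemma pr_big_not_off:
  assumes "V \<in> ksets n k" "V' \<in> ksets n k" "V \<inter> V' = {}"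
  shows "pr (\<lambda>E. big V' E \<and> \<not> big_off V V' E) = tail_prob k 0 - tail_prob (2 * k) 0"
  using pr_diff_eq[of "big_off V V'" "big V'"] big_off_imp pr_big assms pr_big_off by simp

text \<open>There are about n^(2k) disjoint pairs, so a bound of order n^(-2k) would not do. The
  estimate is a difference of two nearly equal products: both sets exceptional forces two
  independent events at level \<open>b - k\<close>, while \<open>big V\<close> and
  \<open>big_off V V'\<close> are exactly independent.\<close>

lemma pr_big_big_not_off:
  assumes V: "V \<in> ksets n k" "V' \<in> ksets n k" "V \<inter> V' = {}"
  shows "pr (\<lambda>E. big V E \<and> big V' E \<and> \<not> big_off V V' E) \<le> tail_prob (2 * k) (real k) ^ 2 - tail_prob k 0 * tail_prob (2 * k) 0"
proof -
  have sub: "V \<subseteq> {1..n}" "V' \<subseteq> {1..n}" and fin: "finite V" "finite V'" and card: "card V = k" "card V' = k"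
    using V finite_subset by (auto simp: ksets_def)
  let ?R = "{1..n} - V - V'"
  let ?A = "edges_between ?R V" and ?B = "edges_between ?R V'"
  define big' where "big' B E \<longleftrightarrow> real (card (nbrs_in ?R B E)) > b - real k" for B :: "nat set" and E
  have big': "big' V (E \<inter> ?A) = big' V E" "big' V' (E \<inter> ?B) = big' V' E" for E
    by (simp_all add: big'_def nbrs_in_cong)
  have imp: "big' V E" if "big V E" for E
  proof -
    have "card (nbrs_in ({1..n} - V) V E) \<le> card (nbrs_in ?R V E) + card V'"
      using fin by (intro card_nbrs_in_le_add) auto
    then show ?thesis using that card by (simp add: big_def big'_def)
  qed
  have imp': "big' V' E" if "big V' E" for E
  proof -
    have "card (nbrs_in ({1..n} - V') V' E) \<le> card (nbrs_in ?R V' E) + card V"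
      using fin by (intro card_nbrs_in_le_add) auto
    then show ?thesis using that card by (simp add: big_def big'_def)
  qed
  have val: "pr (big' V) = tail_prob (2 * k) (real k)" "pr (big' V') = tail_prob (2 * k) (real k)"
    unfolding big'_def tail_prob_def
    by (subst prob_nbrs_in; use sub card card_off[OF V] in auto)+
  have "pr (\<lambda>E. big V E \<and> big V' E) \<le> pr (\<lambda>E. big' V (E \<inter> ?A) \<and> big' V' (E \<inter> ?B))"
    unfolding big' by (intro measure_pmf.finite_measure_mono) (auto intro: imp imp')
  also have "\<dots> = pr (\<lambda>E. big' V (E \<inter> ?A)) * pr (\<lambda>E. big' V' (E \<inter> ?B))"
  proof (rule random_subset_indep)
    show "?A \<inter> ?B = {}" using V(3) by (intro edges_between_disjoint) auto
    show "?A \<subseteq> all_edges n" "?B \<subseteq> all_edges n"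
      using sub by (intro edges_between_subset; auto)+
  qed (rule finite_all_edges)
  also have "\<dots> = tail_prob (2 * k) (real k) ^ 2" unfolding big' val by (simp add: power2_eq_square)
  finally have 1: "pr (\<lambda>E. big V E \<and> big V' E) \<le> tail_prob (2 * k) (real k) ^ 2" .
  have 2: "pr (\<lambda>E. big V E \<and> big_off V V' E) = tail_prob k 0 * tail_prob (2 * k) 0"
    using indep_off[OF sub(1), where Q = "big_off V V'", OF big_off_Int[OF sub V(3)]] pr_big[OF V(1)] pr_big_off[OF V] by simp
  have "pr (\<lambda>E. (big V E \<and> big V' E) \<and> \<not> (big V E \<and> big_off V V' E))
      = pr (\<lambda>E. big V E \<and> big V' E) - pr (\<lambda>E. big V E \<and> big_off V V' E)"
    by (rule pr_diff_eq) (use big_off_imp in auto)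
  moreover have "{E. (big V E \<and> big V' E) \<and> \<not> (big V E \<and> big_off V V' E)} = {E. big V E \<and> big V' E \<and> \<not> big_off V V' E}"
    by auto
  ultimately show ?thesis using 1 2 by simp
qed

text \<open>Over the common candidate set, the neighbourhoods of \<open>S\<close> and
  \<open>V - S\<close> use disjoint edges and are independent, and their intersection is the
  neighbourhood of \<open>V\<close>.\<close>

lemma pr_big_codeg:
  assumes V: "V \<in> ksets n k" and S: "S \<subseteq> V" "card S = j" and z: "z \<ge> 1" "v \<ge> 1"
  shows "pr (\<lambda>E. big V E \<and> codeg V S E > t)
     \<le> z powr (- b) * v powr (- t) * (1 + p ^ j * (v * (1 + p ^ (k - j) * (z - 1)) - 1)) ^ (n - k)"
proof -
  let ?U = "{1..n} - V" and ?D = "V - S"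
  have sub: "V \<subseteq> {1..n}" and fin: "finite V" "finite S" "finite ?U" "finite ?D" and card: "card V = k"
    using V S finite_subset[of V "{1..n}"] finite_subset[of S V] by (auto simp: ksets_def)
  have cD: "card ?D = k - j" using card S fin by (simp add: card_Diff_subset)
  have cU: "card ?U = n - k" using sub card fin by (simp add: card_Diff_subset)
  let ?A = "edges_between ?U S" and ?B = "edges_between ?U ?D"
  have sA: "?A \<subseteq> all_edges n" "?B \<subseteq> all_edges n" using sub S by (intro edges_between_subset; auto)+
  have disj: "?A \<inter> ?B = {}" using S by (intro edges_between_disjoint) auto
  have law: "map_pmf (\<lambda>E. (nbrs_in ?U S E, nbrs_in ?U ?D E)) (random_subset (all_edges n) p)
     = pair_pmf (random_subset ?U (p ^ j)) (random_subset ?U (p ^ (k - j)))"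
  proof -
    have "map_pmf (\<lambda>E. (nbrs_in ?U S E, nbrs_in ?U ?D E)) (random_subset (all_edges n) p)
       = map_pmf (map_prod (nbrs_in ?U S) (nbrs_in ?U ?D)) (map_pmf (\<lambda>E. (E \<inter> ?A, E \<inter> ?B)) (random_subset (all_edges n) p))"
      by (simp add: map_pmf_comp nbrs_in_cong)
    also have "\<dots> = pair_pmf (map_pmf (nbrs_in ?U S) (random_subset ?A p)) (map_pmf (nbrs_in ?U ?D) (random_subset ?B p))"
      unfolding random_subset_Int_pair[OF finite_all_edges sA disj] map_prod_def by (rule map_pair)
    also have "\<dots> = pair_pmf (random_subset ?U (p ^ j)) (random_subset ?U (p ^ (k - j)))"
      using S cD fin p by (subst (1 2) random_subset_nbrs_in_aux) auto
    finally show ?thesis .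
  qed
  have VS: "nbrs_in ?U V E = nbrs_in ?U S E \<inter> nbrs_in ?U ?D E" for E
    using nbrs_in_Un[of ?U S ?D E] S by (simp add: Un_absorb1)
  have "pr (\<lambda>E. big V E \<and> codeg V S E > t)
     = measure_pmf.prob (map_pmf (\<lambda>E. (nbrs_in ?U S E, nbrs_in ?U ?D E)) (random_subset (all_edges n) p))
         {x. real (card (fst x \<inter> snd x)) > b \<and> real (card (fst x)) > t}"
    unfolding big_def codeg_def VS by (simp add: vimage_def)
  also have "\<dots> \<le> z powr (- b) * v powr (- t) * (1 + p ^ j * (v * (1 + p ^ (k - j) * (z - 1)) - 1)) ^ card ?U"
    unfolding law by (rule prob_two_level_Markov) (use fin p z in \<open>auto simp: power_le_one\<close>)
  finally show ?thesis unfolding cU .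
qed

text \<open>Reveal the edges meeting \<open>V\<close>: they determine the neighbourhood of
  \<open>S\<close>, of size at most \<open>t\<close>. Edges from \<open>V' - V\<close> to vertices
  outside both sets are still fresh, so a one-level Markov bound applies inside that
  neighbourhood.\<close>

lemma pr_big_overlap:
  assumes V: "V \<in> ksets n k" "V' \<in> ksets n k" and S: "V \<inter> V' = S" "card S = j" and z: "z \<ge> 1"
  shows "pr (\<lambda>E. (big V E \<and> codeg V S E \<le> t) \<and> big V' E)
     \<le> tail_prob k 0 * (z powr (- (b - real k)) * (1 + p ^ (k - j) * (z - 1)) powr t)"
proof -
  let ?F = "{e \<in> all_edges n. e \<inter> V \<noteq> {}}" and ?D = "V' - V" and ?U = "{1..n} - V - V'"
  let ?K = "edges_between ?U ?D"
  have sub: "V \<subseteq> {1..n}" "V' \<subseteq> {1..n}" and fin: "finite V" "finite V'" and card: "card V = k" "card V' = k"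
    using V finite_subset by (auto simp: ksets_def)
  have cD: "card ?D = k - j"
  proof -
    have "V' - V = V' - S" using S by auto
    moreover have "S \<subseteq> V'" using S by auto
    ultimately show ?thesis using S(2) fin card by (simp add: card_Diff_subset finite_subset)
  qed
  have sK: "?K \<subseteq> all_edges n" using sub by (intro edges_between_subset) auto
  have disj: "?F \<inter> ?K = {}" by (auto simp: edges_between_def)
  define Q where "Q E \<longleftrightarrow> big V E \<and> codeg V S E \<le> t" for E
  have SV: "S \<subseteq> V" using S by auto
  have QF: "Q (E \<inter> ?F) = Q E" for E
    unfolding Q_def big_def codeg_def using touching(4)[OF sub(1)] SV by simp
  have SF: "nbrs_in ?U S (E \<inter> ?F) = nbrs_in ?U S E" for E
    by (rule touching(4)[OF sub(1) SV]) auto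
  let ?w = "1 + p ^ (k - j) * (z - 1)"
  let ?c = "z powr (- (b - real k)) * ?w powr t"
  have w1: "?w \<ge> 1" using p z by simp
  have imp: "real (card (nbrs_in ?U S E \<inter> nbrs_in ?U ?D E)) > b - real k" if "big V' E" for E
  proof -
    have "card (nbrs_in ({1..n} - V') V' E) \<le> card (nbrs_in ?U V' E) + card V"
      using fin by (intro card_nbrs_in_le_add) auto
    moreover have "V' = S \<union> ?D" using S by auto
    then have "nbrs_in ?U V' E = nbrs_in ?U S E \<inter> nbrs_in ?U ?D E" using nbrs_in_Un by metis
    ultimately show ?thesis using that card by (simp add: big_def)
  qed
  have law: "map_pmf (\<lambda>E. (E \<inter> ?F, nbrs_in ?U ?D E)) (random_subset (all_edges n) p)
     = pair_pmf (random_subset ?F p) (random_subset ?U (p ^ (k - j)))"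
  proof -
    have "map_pmf (\<lambda>E. (E \<inter> ?F, nbrs_in ?U ?D E)) (random_subset (all_edges n) p)
       = map_pmf (\<lambda>(X, Y). (X, nbrs_in ?U ?D Y)) (map_pmf (\<lambda>E. (E \<inter> ?F, E \<inter> ?K)) (random_subset (all_edges n) p))"
      by (simp add: map_pmf_comp nbrs_in_cong)
    also have "\<dots> = pair_pmf (random_subset ?F p) (map_pmf (nbrs_in ?U ?D) (random_subset ?K p))"
      by (subst random_subset_Int_pair[OF finite_all_edges _ sK disj]) (auto simp: pair_map_pmf2 apsnd_def map_prod_def)
    also have "map_pmf (nbrs_in ?U ?D) (random_subset ?K p) = random_subset ?U (p ^ (k - j))"
      using cD fin p by (subst random_subset_nbrs_in_aux) auto
    finally show ?thesis .
  qed
  have "pr (\<lambda>E. Q E \<and> big V' E) \<le> pr (\<lambda>E. Q (E \<inter> ?F) \<and> real (card (nbrs_in ?U S (E \<inter> ?F) \<inter> nbrs_in ?U ?D E)) > b - real k)"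
    unfolding QF SF by (intro measure_pmf.finite_measure_mono) (auto dest: imp)
  also have "\<dots> = measure_pmf.prob (map_pmf (\<lambda>E. (E \<inter> ?F, nbrs_in ?U ?D E)) (random_subset (all_edges n) p))
      {x. Q (fst x) \<and> real (card (nbrs_in ?U S (fst x) \<inter> snd x)) > b - real k}"
    by (simp add: vimage_def)
  also have "\<dots> \<le> measure_pmf.prob (random_subset ?F p) {E. Q E} * ?c"
    unfolding law
  proof (rule prob_pair_pmf_le)
    fix E assume E: "E \<in> set_pmf (random_subset ?F p)" "Q E"
    let ?M = "nbrs_in ?U S E"
    have M: "?M \<subseteq> ?U" by (auto simp: nbrs_in_def)
    have "card ?M \<le> card (nbrs_in ({1..n} - V) S E)"
      by (intro card_mono finite_nbrs_in nbrs_in_mono) auto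
    then have cM: "real (card ?M) \<le> t" using E(2) by (simp add: Q_def codeg_def)
    have "measure_pmf.prob (random_subset ?U (p ^ (k - j))) {Y. real (card (?M \<inter> Y)) > b - real k}
       = measure_pmf.prob (map_pmf (\<lambda>Y. Y \<inter> ?M) (random_subset ?U (p ^ (k - j)))) {Y. real (card Y) > b - real k}"
      by (simp add: vimage_def Int_commute)
    also have "\<dots> \<le> z powr (- (b - real k)) * ?w ^ card ?M"
      using random_subset_Int[of ?U ?M "p ^ (k - j)"] M prob_random_subset_Markov[of ?M "p ^ (k - j)" z "b - real k"] p z
      by (auto simp: power_le_one finite_nbrs_in)
    also have "\<dots> \<le> ?c"
    proof (rule mult_left_mono)
      have "?w ^ card ?M = ?w powr real (card ?M)" using w1 by (simp add: powr_realpow)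
      also have "\<dots> \<le> ?w powr t" using cM w1 by (intro powr_mono) auto
      finally show "?w ^ card ?M \<le> ?w powr t" .
    qed simp
    finally show "measure_pmf.prob (random_subset ?U (p ^ (k - j))) {Y. real (card (?M \<inter> Y)) > b - real k} \<le> ?c" .
  qed simp
  also have "measure_pmf.prob (random_subset ?F p) {E. Q E} = pr Q"
  proof -
    have "random_subset ?F p = map_pmf (\<lambda>E. E \<inter> ?F) (random_subset (all_edges n) p)"
      by (rule random_subset_Int[symmetric]) (auto simp: finite_all_edges)
    then show ?thesis by (simp add: vimage_def QF)
  qed
  also have "pr Q * ?c \<le> tail_prob k 0 * ?c"
  proof (rule mult_right_mono)
    have "pr Q \<le> pr (big V)" by (rule measure_pmf.finite_measure_mono) (auto simp: Q_def)
    then show "pr Q \<le> tail_prob k 0" using pr_big[OF V(1)] by simp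
  qed simp
  finally show ?thesis by (simp add: Q_def)
qed

section \<open>Union bounds and the recursion error\<close>

lemma pr_Bex_le:
  assumes "finite X"
  shows "pr (\<lambda>E. \<exists>x\<in>X. Q x E) \<le> (\<Sum>x\<in>X. pr (Q x))"
proof -
  have "{E. \<exists>x\<in>X. Q x E} = (\<Union>x\<in>X. {E. Q x E})" by auto
  then show ?thesis
    using measure_pmf.finite_measure_subadditive_finite[OF assms, of "\<lambda>x. {E. Q x E}"] by simp
qed

lemma sum_disjoint_le:
  assumes "\<And>V'. V' \<in> ksets n k \<Longrightarrow> V \<inter> V' = {} \<Longrightarrow> f V' \<le> c"
  shows "(\<Sum>V'\<in>{V' \<in> ksets n k. V \<inter> V' = {}}. f V') \<le> real n ^ k * \<bar>c\<bar>"
proof -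
  let ?Y = "{V' \<in> ksets n k. V \<inter> V' = {}}"
  have "(\<Sum>V'\<in>?Y. f V') \<le> (\<Sum>V'\<in>?Y. \<bar>c\<bar>)"
    using assms by (intro sum_mono) (auto intro: order_trans[OF _ abs_ge_self])
  also have "\<dots> = real (card ?Y) * \<bar>c\<bar>" by simp
  also have "\<dots> \<le> real n ^ k * \<bar>c\<bar>"
  proof (rule mult_right_mono)
    have "card ?Y \<le> card (ksets n k)"
      by (rule card_mono[OF finite_ksets]) auto
    then show "real (card ?Y) \<le> real n ^ k"
      using card_ksets_le[of n k] by linarith
  qed simp
  finally show ?thesis .
qed

text \<open>This probability is later multiplied by that of \<open>big V\<close>, so o(1) is enough:
  a first-moment bound handles the O(n^(k-1)) sets meeting \<open>V\<close> without any study of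
  dependence.\<close>

lemma pr_num_big_neq:
  assumes V: "V \<in> ksets n k"
  shows "pr (\<lambda>E. num_big E \<noteq> num_big_off V E)
     \<le> 2 ^ k * (\<Sum>j\<in>{1..k}. real n ^ (k - j)) * tail_prob k 0 + real n ^ k * \<bar>tail_prob k 0 - tail_prob (2 * k) 0\<bar>"
proof -
  let ?X = "{V' \<in> ksets n k. V \<inter> V' \<noteq> {}}" and ?Y = "{V' \<in> ksets n k. V \<inter> V' = {}}"
  have fin: "finite ?X" "finite ?Y" using finite_ksets by auto
  have "num_big E = num_big_off V E" if "\<not> (\<exists>V'\<in>?X. big V' E)" "\<not> (\<exists>V'\<in>?Y. big V' E \<and> \<not> big_off V V' E)" for E
  proof -
    have "{V' \<in> ksets n k. big V' E} = {V' \<in> ksets n k. V \<inter> V' = {} \<and> big_off V V' E}"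
      using that big_off_imp by blast
    then show ?thesis by (simp add: num_big_def num_big_off_def)
  qed
  then have "pr (\<lambda>E. num_big E \<noteq> num_big_off V E)
      \<le> pr (\<lambda>E. \<exists>V'\<in>?X. big V' E) + pr (\<lambda>E. \<exists>V'\<in>?Y. big V' E \<and> \<not> big_off V V' E)"
    by (intro prob_le_prob_plus) blast
  also have "\<dots> \<le> (\<Sum>V'\<in>?X. pr (big V')) + (\<Sum>V'\<in>?Y. pr (\<lambda>E. big V' E \<and> \<not> big_off V V' E))"
    by (intro add_mono pr_Bex_le fin)
  also have "(\<Sum>V'\<in>?X. pr (big V')) = real (card ?X) * tail_prob k 0"
    by (simp add: pr_big)
  also have "\<dots> \<le> 2 ^ k * (\<Sum>j\<in>{1..k}. real n ^ (k - j)) * tail_prob k 0"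
    by (intro mult_right_mono card_ksets_meet_le[OF V]) (simp add: tail_prob_def)
  also have "(\<Sum>V'\<in>?Y. pr (\<lambda>E. big V' E \<and> \<not> big_off V V' E)) \<le> real n ^ k * \<bar>tail_prob k 0 - tail_prob (2 * k) 0\<bar>"
    by (rule sum_disjoint_le) (simp add: pr_big_not_off[OF V])
  finally show ?thesis by simp
qed

lemma overlap_factor_nonneg: "overlap_factor z t j \<ge> 0"
  by (simp add: overlap_factor_def)

lemma codeg_tail_bound_nonneg:
  assumes "z \<ge> 1" "\<And>j. v j \<ge> 1"
  shows "codeg_tail_bound z v t j \<ge> 0"
proof -
  have "1 * 1 \<le> v j * (1 + p ^ (k - j) * (z - 1))"
    using assms p order_trans[OF zero_le_one assms(2)] by (intro mult_mono) auto
  then show ?thesis unfolding codeg_tail_bound_def using p by (intro mult_nonneg_nonneg zero_le_power add_nonneg_nonneg) auto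
qed

text \<open>Here o(n^(-k)) is required. Given \<open>big V\<close>, the counts can differ by other
  than 1 only through a disjoint set that needs neighbours in \<open>V\<close>, or through a set
  meeting \<open>V\<close> in a proper nonempty \<open>S\<close>. For each of the at most 2^k such
  \<open>S\<close> either the codegree exceeds \<open>t\<close>, or a union bound over the sets
  through \<open>S\<close> is affordable.\<close>

lemma pr_big_num_big_neq:
  assumes V: "V \<in> ksets n k" and k: "k \<ge> 1" and z: "z \<ge> 1" "\<And>j. v j \<ge> 1"
  shows "pr (\<lambda>E. big V E \<and> num_big E \<noteq> num_big_off V E + 1)
     \<le> 2 ^ k * (\<Sum>j\<in>{1..<k}. codeg_tail_bound z v t j + real n ^ (k - j) * (tail_prob k 0 * overlap_factor z t j))
        + real n ^ k * \<bar>tail_prob (2 * k) (real k) ^ 2 - tail_prob k 0 * tail_prob (2 * k) 0\<bar>"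
proof -
  let ?S = "{S. S \<subseteq> V \<and> S \<noteq> {} \<and> S \<noteq> V}" and ?Y = "{V' \<in> ksets n k. V \<inter> V' = {}}"
  let ?I = "\<lambda>S. {V' \<in> ksets n k. V \<inter> V' = S}"
  let ?bad = "\<lambda>S E. big V E \<and> codeg V S E > t (card S) \<or> (\<exists>V'\<in>?I S. (big V E \<and> codeg V S E \<le> t (card S)) \<and> big V' E)"
  let ?h = "\<lambda>j. codeg_tail_bound z v t j + real n ^ (k - j) * (tail_prob k 0 * overlap_factor z t j)"
  have fV: "finite V" and cV: "card V = k" and sub: "V \<subseteq> {1..n}" using V finite_subset by (auto simp: ksets_def)
  have fin: "finite ?S" "finite ?Y" "finite (?I S)" for S using finite_ksets fV by auto
  have T0: "tail_prob k 0 \<ge> 0" by (simp add: tail_prob_def)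
  note OV0 = overlap_factor_nonneg[of z t] and LC0 = codeg_tail_bound_nonneg[OF z]
  have good: "num_big E = num_big_off V E + 1"
    if g1: "big V E" and g2: "\<And>S. S \<in> ?S \<Longrightarrow> \<not> ?bad S E"
      and g3: "\<And>V'. V' \<in> ?Y \<Longrightarrow> \<not> (big V E \<and> big V' E \<and> \<not> big_off V V' E)" for E
  proof -
    have "V' = V \<or> V \<inter> V' = {}" if V': "V' \<in> ksets n k" "big V' E" for V'
    proof (rule ccontr)
      assume c: "\<not> (V' = V \<or> V \<inter> V' = {})"
      have "finite V'" "card V' = k" using V' finite_subset by (auto simp: ksets_def)
      then have "V \<inter> V' \<noteq> V" using c cV card_subset_eq[of V' V] by auto
      then have "V \<inter> V' \<in> ?S" using c by auto
      then have "\<not> ?bad (V \<inter> V') E" by (rule g2)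
      then show False using g1 V' by (auto simp: not_less)
    qed
    then have "{V' \<in> ksets n k. big V' E} = insert V {V' \<in> ksets n k. V \<inter> V' = {} \<and> big_off V V' E}"
    proof (intro equalityI subsetI)
      fix V' assume "V' \<in> insert V {V' \<in> ksets n k. V \<inter> V' = {} \<and> big_off V V' E}"
      then show "V' \<in> {V' \<in> ksets n k. big V' E}" using V g1 big_off_imp by auto
    next
      fix V' assume V': "V' \<in> {V' \<in> ksets n k. big V' E}"
        and *: "\<And>V'. V' \<in> ksets n k \<Longrightarrow> big V' E \<Longrightarrow> V' = V \<or> V \<inter> V' = {}"
      show "V' \<in> insert V {V' \<in> ksets n k. V \<inter> V' = {} \<and> big_off V V' E}"
        using *[of V'] V' g1 g3[of V'] by auto
    qed
    moreover have "V \<notin> {V' \<in> ksets n k. V \<inter> V' = {} \<and> big_off V V' E}"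
    proof
      assume "V \<in> {V' \<in> ksets n k. V \<inter> V' = {} \<and> big_off V V' E}"
      then have "V = {}" by auto
      then show False using cV k by simp
    qed
    ultimately show ?thesis
      using finite_ksets[of n k] by (simp add: num_big_def num_big_off_def)
  qed
  have "pr (\<lambda>E. big V E \<and> num_big E \<noteq> num_big_off V E + 1)
      \<le> pr (\<lambda>E. \<exists>S\<in>?S. ?bad S E) + pr (\<lambda>E. \<exists>V'\<in>?Y. big V E \<and> big V' E \<and> \<not> big_off V V' E)"
  proof (rule prob_le_prob_plus)
    fix E assume E: "big V E \<and> num_big E \<noteq> num_big_off V E + 1"
    show "(\<exists>S\<in>?S. ?bad S E) \<or> (\<exists>V'\<in>?Y. big V E \<and> big V' E \<and> \<not> big_off V V' E)"
    proof (rule ccontr)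
      assume n: "\<not> ((\<exists>S\<in>?S. ?bad S E) \<or> (\<exists>V'\<in>?Y. big V E \<and> big V' E \<and> \<not> big_off V V' E))"
      have "num_big E = num_big_off V E + 1"
      proof (rule good)
        show "big V E" using E ..
        show "\<not> ?bad S E" if "S \<in> ?S" for S
          using n that unfolding de_Morgan_disj Bex_def not_ex by (elim conjE) (drule spec[of _ S], simp)
        show "\<not> (big V E \<and> big V' E \<and> \<not> big_off V V' E)" if "V' \<in> ?Y" for V'
          using n that unfolding de_Morgan_disj by (elim conjE) blast
      qed
      then show False using E by simp
    qed
  qed
  also have "\<dots> \<le> (\<Sum>S\<in>?S. pr (?bad S)) + (\<Sum>V'\<in>?Y. pr (\<lambda>E. big V E \<and> big V' E \<and> \<not> big_off V V' E))"
    by (intro add_mono pr_Bex_le fin)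
  also have "(\<Sum>V'\<in>?Y. pr (\<lambda>E. big V E \<and> big V' E \<and> \<not> big_off V V' E)) \<le> real n ^ k * \<bar>tail_prob (2 * k) (real k) ^ 2 - tail_prob k 0 * tail_prob (2 * k) 0\<bar>"
    by (rule sum_disjoint_le) (simp add: pr_big_big_not_off[OF V])
  also have "(\<Sum>S\<in>?S. pr (?bad S)) \<le> (\<Sum>S\<in>?S. \<Sum>j\<in>{1..<k}. ?h j)"
  proof (rule sum_mono)
    fix S assume S: "S \<in> ?S"
    then have "card S < k" using psubset_card_mono[OF fV, of S] cV by auto
    moreover have "card S > 0" using S fV finite_subset[of S V] by (auto simp: card_gt_0_iff)
    ultimately have cS: "card S \<in> {1..<k}" by auto
    have "pr (?bad S) \<le> pr (\<lambda>E. big V E \<and> codeg V S E > t (card S))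
        + pr (\<lambda>E. \<exists>V'\<in>?I S. (big V E \<and> codeg V S E \<le> t (card S)) \<and> big V' E)"
      by (rule prob_le_prob_plus)
    also have "\<dots> \<le> codeg_tail_bound z v t (card S) + (\<Sum>V'\<in>?I S. pr (\<lambda>E. (big V E \<and> codeg V S E \<le> t (card S)) \<and> big V' E))"
      unfolding codeg_tail_bound_def by (intro add_mono pr_Bex_le fin pr_big_codeg V z) (use S in auto)
    also have "(\<Sum>V'\<in>?I S. pr (\<lambda>E. (big V E \<and> codeg V S E \<le> t (card S)) \<and> big V' E)) \<le> (\<Sum>V'\<in>?I S. tail_prob k 0 * overlap_factor z t (card S))"
      unfolding overlap_factor_def by (intro sum_mono pr_big_overlap V z) auto
    also have "\<dots> = real (card (?I S)) * (tail_prob k 0 * overlap_factor z t (card S))" by simp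
    also have "\<dots> \<le> real n ^ (k - card S) * (tail_prob k 0 * overlap_factor z t (card S))"
      using S T0 OV0 by (intro mult_right_mono card_ksets_Int_eq_le[OF V]) auto
    also have "codeg_tail_bound z v t (card S) + \<dots> \<le> (\<Sum>j\<in>{1..<k}. ?h j)"
      by (rule member_le_sum[OF cS, of ?h]) (use T0 OV0 LC0 in auto)
    finally show "pr (?bad S) \<le> (\<Sum>j\<in>{1..<k}. ?h j)" by simp
  qed
  also have "\<dots> = real (card ?S) * (\<Sum>j\<in>{1..<k}. ?h j)" by simp
  also have "\<dots> \<le> 2 ^ k * (\<Sum>j\<in>{1..<k}. ?h j)"
  proof (rule mult_right_mono)
    have "card ?S \<le> card (Pow V)" by (rule card_mono) (use fV in auto)
    also have "\<dots> = 2 ^ k" using fV cV by (simp add: card_Pow)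
    finally show "real (card ?S) \<le> 2 ^ k" by (metis of_nat_le_iff of_nat_numeral of_nat_power)
  qed (use T0 OV0 LC0 in \<open>auto intro!: sum_nonneg\<close>)
  finally show ?thesis by simp
qed

lemma recursion_error:
  assumes k: "k \<ge> 1" and z: "z \<ge> 1" "\<And>j. v j \<ge> 1" and i: "i \<ge> 1"
  shows "\<bar>real i * pr (\<lambda>E. num_big E = i) - real (n choose k) * tail_prob k 0 * pr (\<lambda>E. num_big E = i - 1)\<bar>
     \<le> real n ^ k * (2 ^ k * (\<Sum>j\<in>{1..<k}. codeg_tail_bound z v t j + real n ^ (k - j) * (tail_prob k 0 * overlap_factor z t j))
          + real n ^ k * \<bar>tail_prob (2 * k) (real k) ^ 2 - tail_prob k 0 * tail_prob (2 * k) 0\<bar>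
          + tail_prob k 0 * (2 ^ k * (\<Sum>j\<in>{1..k}. real n ^ (k - j)) * tail_prob k 0 + real n ^ k * \<bar>tail_prob k 0 - tail_prob (2 * k) 0\<bar>))"
    (is "_ \<le> real n ^ k * ?B")
proof -
  have sum: "(\<Sum>V\<in>ksets n k. pr (big V)) = real (n choose k) * tail_prob k 0"
    by (simp add: pr_big card_ksets)
  have "\<bar>real i * pr (\<lambda>E. num_big E = i) - (\<Sum>V\<in>ksets n k. pr (big V)) * pr (\<lambda>E. num_big E = i - 1)\<bar>
      \<le> (\<Sum>V\<in>ksets n k. pr (\<lambda>E. big V E \<and> num_big E \<noteq> num_big_off V E + 1) + pr (big V) * pr (\<lambda>E. num_big E \<noteq> num_big_off V E))"
    unfolding num_big_def by (rule card_prob_recursion_error) (use finite_ksets indep_num_big_off i in auto)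
  also have "\<dots> \<le> (\<Sum>V\<in>ksets n k. ?B)"
  proof (rule sum_mono)
    fix V assume V: "V \<in> ksets n k"
    show "pr (\<lambda>E. big V E \<and> num_big E \<noteq> num_big_off V E + 1) + pr (big V) * pr (\<lambda>E. num_big E \<noteq> num_big_off V E) \<le> ?B"
      unfolding pr_big[OF V]
      by (intro add_mono[OF pr_big_num_big_neq[OF V k z]] mult_left_mono pr_num_big_neq[OF V]) (simp add: tail_prob_def)
  qed
  also have "\<dots> = real (card (ksets n k)) * ?B" by simp
  also have "\<dots> \<le> real n ^ k * ?B"
  proof (intro mult_right_mono card_ksets_le add_nonneg_nonneg mult_nonneg_nonneg sum_nonneg)
  qed (use codeg_tail_bound_nonneg[OF z] overlap_factor_nonneg in \<open>auto simp: tail_prob_def\<close>)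
  finally show ?thesis unfolding sum .
qed

lemma pr_num_big_ge:
  assumes "i > 0"
  shows "pr (\<lambda>E. num_big E \<ge> i) \<le> real (n choose k) * tail_prob k 0 / real i"
proof -
  have "pr (\<lambda>E. num_big E \<ge> i) = measure_pmf.prob (random_subset (all_edges n) p) {E \<in> space (random_subset (all_edges n) p). real i \<le> real (num_big E)}"
    by simp
  also have "\<dots> \<le> measure_pmf.expectation (random_subset (all_edges n) p) (\<lambda>E. real (num_big E)) / real i"
    by (rule integral_Markov_inequality_measure[where A = "{}"])
      (use assms in \<open>auto intro!: integrable_measure_pmf_finite finite_set_random_subset finite_all_edges\<close>)
  also have "measure_pmf.expectation (random_subset (all_edges n) p) (\<lambda>E. real (num_big E)) = (\<Sum>V\<in>ksets n k. pr (big V))"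
    unfolding num_big_def by (rule expectation_card_eq_sum_prob[OF finite_ksets])
  also have "\<dots> = real (n choose k) * tail_prob k 0" by (simp add: pr_big card_ksets)
  finally show ?thesis .
qed

end

end

section \<open>The limit law\<close>

text \<open>In ascending order the entries above \<open>c\<close> form a final segment, and the m-th
  highest has index \<open>l - m\<close>, counting from 0. It is above \<open>c\<close> exactly when
  that segment has at least \<open>m\<close> members; \<open>m <= size M\<close> keeps the index
  meaningful.\<close>

lemma mth_highest_le_iff:
  fixes M :: "nat multiset" and c :: real
  assumes m: "1 \<le> m" "m \<le> size M"
  shows "real (mth_highest m M) \<le> c \<longleftrightarrow> size (filter_mset (\<lambda>x. real x > c) M) < m"
proof -
  define xs where "xs = sorted_list_of_multiset M"
  define l where "l = length xs"
  have M: "M = mset xs" and sorted: "sorted xs" and len: "l = size M"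
    by (simp_all add: xs_def l_def flip: size_mset)
  have sz: "size (filter_mset (\<lambda>x. real x > c) M) = card {i. i < l \<and> real (xs ! i) > c}"
    unfolding M l_def mset_filter[symmetric] size_mset length_filter_conv_card by simp
  have hi: "mth_highest m M = xs ! (l - m)"
    using m len by (simp add: mth_highest_def rev_nth l_def xs_def Suc_diff_le)
  show ?thesis
  proof
    assume le: "real (mth_highest m M) \<le> c"
    have "{i. i < l \<and> real (xs ! i) > c} \<subseteq> {l - m<..<l}"
    proof clarsimp
      fix i assume i: "i < l" "c < real (xs ! i)"
      show "l - m < i"
      proof (rule ccontr)
        assume "\<not> l - m < i"
        then have "xs ! i \<le> xs ! (l - m)"
          using sorted m len by (intro sorted_nth_mono) (auto simp: l_def)
        then show False using i le hi by simp
      qed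
    qed
    then have "card {i. i < l \<and> real (xs ! i) > c} \<le> card {l - m<..<l}" by (intro card_mono) auto
    also have "\<dots> < m" using m len by simp
    finally show "size (filter_mset (\<lambda>x. real x > c) M) < m" unfolding sz .
  next
    assume lt: "size (filter_mset (\<lambda>x. real x > c) M) < m"
    show "real (mth_highest m M) \<le> c"
    proof (rule ccontr)
      assume "\<not> real (mth_highest m M) \<le> c"
      then have gt: "real (xs ! (l - m)) > c" by (simp add: hi)
      have "{l - m..<l} \<subseteq> {i. i < l \<and> real (xs ! i) > c}"
      proof clarsimp
        fix i assume "l - m \<le> i" "i < l"
        then have "xs ! (l - m) \<le> xs ! i" using sorted by (intro sorted_nth_mono) (auto simp: l_def)
        then show "c < real (xs ! i)" using gt by simp
      qed
      then have "card {l - m..<l} \<le> card {i. i < l \<and> real (xs ! i) > c}" by (intro card_mono) auto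
      then show False using lt m len unfolding sz by simp
    qed
  qed
qed

lemma Delta_le_iff:
  assumes m: "1 \<le> m" "m \<le> n choose k"
  shows "real (Delta m k n E) \<le> c \<longleftrightarrow> num_big n k c E < m"
proof -
  let ?M = "image_mset (\<lambda>V. card (common_nbrs n E V)) (mset_set (ksets n k))"
  have "size ?M = n choose k" using finite_ksets card_ksets by simp
  then have "real (mth_highest m ?M) \<le> c \<longleftrightarrow> size (filter_mset (\<lambda>x. real x > c) ?M) < m"
    using m by (intro mth_highest_le_iff) auto
  also have "size (filter_mset (\<lambda>x. real x > c) ?M) = num_big n k c E"
    using finite_ksets by (simp add: filter_mset_image_mset num_big_def big_def common_nbrs_eq)
  finally show ?thesis by (simp add: Delta_def ksets_def)
qed

text \<open>A crude bound which ensures that there are at least \<open>m\<close> values to rank once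
  \<open>n >= m + k\<close>.\<close>

lemma choose_gt:
  assumes "1 \<le> k" "k \<le> n"
  shows "n - k < n choose k"
  using assms(2)
proof (induction n rule: dec_induct)
  case (step n)
  obtain k' where k': "k = Suc k'" using assms(1) by (cases k) auto
  have "n choose k' > 0" using step k' by (simp add: zero_less_binomial)
  moreover have "Suc n choose k = (n choose k') + (n choose k)" by (simp add: k')
  moreover have "Suc n - k \<le> Suc (n - k)" by simp
  ultimately show ?case using step.IH by linarith
qed simp

lemma choose_asymp: "(\<lambda>n. real (n choose k) / real n ^ k) \<longlonglongrightarrow> 1 / fact k"
proof -
  have "(\<lambda>n. \<Prod>i<k. (real n - real i) / real n) \<longlonglongrightarrow> (\<Prod>i<k. 1)"
    by (intro tendsto_prod) real_asymp
  then have "(\<lambda>n. (\<Prod>i<k. (real n - real i) / real n) / fact k) \<longlonglongrightarrow> 1 / fact k"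
    by (intro tendsto_divide) auto
  moreover have "(\<Prod>i<k. (real n - real i) / real n) / fact k = real (n choose k) / real n ^ k" for n
    by (simp add: binomial_gbinomial gbinomial_prod_rev prod_dividef atLeast0LessThan)
  ultimately show ?thesis by simp
qed

context threshold
begin

lemma recursion_limit:
  assumes i: "i \<ge> 1"
  shows "(\<lambda>n. real i * pr n (p n) (\<lambda>E. num_big n k (b n) E = i)
      - real (n choose k) * tail_prob n k (p n) (b n) k 0
        * pr n (p n) (\<lambda>E. num_big n k (b n) E = i - 1)) \<longlonglongrightarrow> 0"
proof (rule Lim_null_le)
  \<comment> \<open>The tails rescaled by n^k have one common limit, so |t1^2 - t0 t2| and |t0 - t2|
    vanish. \<open>?B\<close> is n^k times the bound of \<open>recursion_error\<close> with these
    powers distributed.\<close>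
  define t0 t1 t2 where "t0 n = real n ^ k * tail_prob n k (p n) (b n) k 0"
    and "t1 n = real n ^ k * tail_prob n k (p n) (b n) (2 * k) (real k)"
    and "t2 n = real n ^ k * tail_prob n k (p n) (b n) (2 * k) 0" for n
  define tau where "tau = fact k * exp (- y)"
  have t: "t0 \<longlonglongrightarrow> tau" "t1 \<longlonglongrightarrow> tau" "t2 \<longlonglongrightarrow> tau"
    using binomial_threshold_tail[of k 0] binomial_threshold_tail[of "2 * k" k] binomial_threshold_tail[of "2 * k" 0]
    by (simp_all add: t0_def[abs_def] t1_def[abs_def] t2_def[abs_def] tail_prob_def tau_def q_def)
  let ?LC = "\<lambda>n. codeg_tail_bound n k (p n) (b n) (exp (tilt n)) (\<lambda>j. exp (codeg_tilt j n)) (\<lambda>j. cut j n)"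
  let ?OV = "\<lambda>n. overlap_factor k (p n) (b n) (exp (tilt n)) (\<lambda>j. cut j n)"
  let ?B = "\<lambda>n. 2 ^ k * (\<Sum>j\<in>{1..<k}. real n ^ k * ?LC n j + t0 n * (real n ^ (k - j) * ?OV n j))
     + \<bar>t1 n ^ 2 - t0 n * t2 n\<bar> + t0 n * (2 ^ k * (\<Sum>j\<in>{1..k}. 1 / real n ^ j) * t0 n + \<bar>t0 n - t2 n\<bar>)"
  have "?B \<longlonglongrightarrow> 2 ^ k * (\<Sum>j\<in>{1..<k}. 0 + tau * 0) + \<bar>tau ^ 2 - tau * tau\<bar>
     + tau * (2 ^ k * (\<Sum>j\<in>{1..k}. 0) * tau + \<bar>tau - tau\<bar>)"
  proof (intro tendsto_add tendsto_mult tendsto_const tendsto_sum tendsto_rabs tendsto_diff tendsto_power t)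
    fix j assume j: "j \<in> {1..<k}"
    show "(\<lambda>n. real n ^ k * ?LC n j) \<longlonglongrightarrow> 0"
      unfolding codeg_tail_bound_def by (rule large_codegree_bound) (use j in auto)
    show "(\<lambda>n. real n ^ (k - j) * ?OV n j) \<longlonglongrightarrow> 0"
      unfolding overlap_factor_def by (rule overlap_bound) (use j in auto)
  next
    fix j assume j: "j \<in> {1..k}"
    then have "j > 0" by auto
    then show "(\<lambda>n. 1 / real n ^ j) \<longlonglongrightarrow> 0" by real_asymp
  qed
  then show "?B \<longlonglongrightarrow> 0" by (simp add: power2_eq_square)
  show "\<forall>\<^sub>F n in sequentially. \<bar>real i * pr n (p n) (\<lambda>E. num_big n k (b n) E = i)
      - real (n choose k) * tail_prob n k (p n) (b n) k 0
        * pr n (p n) (\<lambda>E. num_big n k (b n) E = i - 1)\<bar> \<le> ?B n"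
    using basic
  proof eventually_elim
    case (elim n)
    have n: "real n > 0" using elim by simp
    have p: "p n \<in> {0..1}" using elim by simp
    have z: "exp (tilt n) \<ge> 1" using elim by simp
    have v: "exp (codeg_tilt j n) \<ge> 1" for j
    proof -
      have "0 \<le> codeg_tilt j n" unfolding codeg_tilt_def using elim by (intro divide_nonneg_nonneg mult_nonneg_nonneg) auto
      then show ?thesis by simp
    qed
    let ?T0 = "tail_prob n k (p n) (b n) k 0" and ?T1 = "tail_prob n k (p n) (b n) (2 * k) (real k)" and ?T2 = "tail_prob n k (p n) (b n) (2 * k) 0"
    have e1: "real n ^ k * (\<Sum>j\<in>{1..<k}. ?LC n j + real n ^ (k - j) * (?T0 * ?OV n j))
       = (\<Sum>j\<in>{1..<k}. real n ^ k * ?LC n j + t0 n * (real n ^ (k - j) * ?OV n j))"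
      unfolding sum_distrib_left by (intro sum.cong) (auto simp: t0_def algebra_simps)
    have e2: "real n ^ k * (real n ^ k * \<bar>?T1 ^ 2 - ?T0 * ?T2\<bar>) = \<bar>t1 n ^ 2 - t0 n * t2 n\<bar>"
    proof -
      have "t1 n ^ 2 - t0 n * t2 n = (real n ^ k * real n ^ k) * (?T1 ^ 2 - ?T0 * ?T2)"
        by (simp add: t0_def t1_def t2_def power2_eq_square algebra_simps)
      then show ?thesis by (simp add: abs_mult)
    qed
    have e3: "(\<Sum>j\<in>{1..k}. real n ^ (k - j)) = real n ^ k * (\<Sum>j\<in>{1..k}. 1 / real n ^ j)"
      unfolding sum_distrib_left using n by (intro sum.cong) (auto simp: power_diff)
    have e4: "real n ^ k * \<bar>?T0 - ?T2\<bar> = \<bar>t0 n - t2 n\<bar>"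
      by (simp add: t0_def t2_def abs_mult right_diff_distrib[symmetric])
    let ?C = "2 ^ k * (\<Sum>j\<in>{1..<k}. ?LC n j + real n ^ (k - j) * (?T0 * ?OV n j))
          + real n ^ k * \<bar>?T1 ^ 2 - ?T0 * ?T2\<bar>
          + ?T0 * (2 ^ k * (\<Sum>j\<in>{1..k}. real n ^ (k - j)) * ?T0 + real n ^ k * \<bar>?T0 - ?T2\<bar>)"
    have "real n ^ k * ?C
      = 2 ^ k * (real n ^ k * (\<Sum>j\<in>{1..<k}. ?LC n j + real n ^ (k - j) * (?T0 * ?OV n j)))
          + real n ^ k * (real n ^ k * \<bar>?T1 ^ 2 - ?T0 * ?T2\<bar>)
          + t0 n * (2 ^ k * (\<Sum>j\<in>{1..k}. real n ^ (k - j)) * ?T0 + real n ^ k * \<bar>?T0 - ?T2\<bar>)"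
      by (simp only: t0_def distrib_left mult_ac)
    also have "\<dots> = ?B n"
      unfolding e1 e2 e3 e4 by (simp add: t0_def mult_ac)
    finally have "real n ^ k * ?C = ?B n" .
    moreover have "\<bar>real i * pr n (p n) (\<lambda>E. num_big n k (b n) E = i)
      - real (n choose k) * ?T0 * pr n (p n) (\<lambda>E. num_big n k (b n) E = i - 1)\<bar> \<le> real n ^ k * ?C"
      by (rule recursion_error[OF p k1 z v i])
    ultimately show ?case by (simp only:)
  qed
qed

lemma Delta_limit:
  assumes m: "m \<ge> 1"
  shows "(\<lambda>n. measure_pmf.prob (binomial_graph n (p n))
            {E. (Delta m k n E - a_seq k n (p n)) / sigma_seq k n (p n) \<le> y})
         \<longlonglongrightarrow> exp (- exp (- y)) * (\<Sum>i<m. exp (- y) ^ i / fact i)"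
proof (rule Lim_transform_eventually)
  have l: "(\<lambda>n. real (n choose k) * tail_prob n k (p n) (b n) k 0) \<longlonglongrightarrow> exp (- y)"
  proof -
    have "(\<lambda>n. real (n choose k) / real n ^ k * (real n ^ k * tail_prob n k (p n) (b n) k 0)) \<longlonglongrightarrow> 1 / fact k * (fact k * exp (- y))"
    proof (rule tendsto_mult[OF choose_asymp])
      show "(\<lambda>n. real n ^ k * tail_prob n k (p n) (b n) k 0) \<longlonglongrightarrow> fact k * exp (- y)"
        using binomial_threshold_tail[of k 0] by (simp add: tail_prob_def q_def)
    qed
    then have "(\<lambda>n. real (n choose k) / real n ^ k * (real n ^ k * tail_prob n k (p n) (b n) k 0)) \<longlonglongrightarrow> exp (- y)" by simp
    then show ?thesis
    proof (rule Lim_transform_eventually)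
      show "\<forall>\<^sub>F n in sequentially. real (n choose k) / real n ^ k * (real n ^ k * tail_prob n k (p n) (b n) k 0)
          = real (n choose k) * tail_prob n k (p n) (b n) k 0"
        using eventually_gt_at_top[of 0] by eventually_elim simp
    qed
  qed
  show "(\<lambda>n. pr n (p n) (\<lambda>E. num_big n k (b n) E < m))
       \<longlonglongrightarrow> exp (- exp (- y)) * (\<Sum>i<m. exp (- y) ^ i / fact i)"
  proof (rule Poisson_limit_of_recursion[OF recursion_limit _ l])
    show "\<forall>\<^sub>F n in sequentially. \<forall>J>0. pr n (p n) (\<lambda>E. J \<le> num_big n k (b n) E)
        \<le> real (n choose k) * tail_prob n k (p n) (b n) k 0 / real J"
      using basic by eventually_elim (auto intro!: pr_num_big_ge)
  qed
  have "\<forall>\<^sub>F n in sequentially. n \<ge> m + k" by (rule eventually_ge_at_top)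
  then show "\<forall>\<^sub>F n in sequentially. pr n (p n) (\<lambda>E. num_big n k (b n) E < m)
      = measure_pmf.prob (binomial_graph n (p n)) {E. (Delta m k n E - a_seq k n (p n)) / sigma_seq k n (p n) \<le> y}"
    using basic sigma_eq
  proof eventually_elim
    case (elim n)
    have "m \<le> n choose k"
      using choose_gt[OF k1, of n] elim(1) by linarith
    then have "num_big n k (b n) E < m \<longleftrightarrow> (Delta m k n E - a_seq k n (p n)) / sigma_seq k n (p n) \<le> y" for E
    proof -
      have "sigma_seq k n (p n) > 0" using elim by simp
      then have "(Delta m k n E - a_seq k n (p n)) / sigma_seq k n (p n) \<le> y \<longleftrightarrow> real (Delta m k n E) \<le> b n"
        by (simp add: b_def pos_divide_le_eq algebra_simps)
      then show ?thesis using Delta_le_iff[OF m \<open>m \<le> n choose k\<close>] by simp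
    qed
    then show ?case by (simp add: binomial_graph_eq)
  qed
qed

end

theorem theorem1:
  fixes y :: real and k m :: nat and p :: "nat \<Rightarrow> real"
  assumes "k \<ge> 1" and "m \<ge> 1"
    and "\<And>n. n \<ge> 1 \<Longrightarrow> 0 < p n \<and> p n < 1"
    and "much_greater (\<lambda>n. p n ^ k) (\<lambda>n. ln n ^ 3 / n)"
    and "much_greater (\<lambda>n. 1 - p n) (\<lambda>n. sqrt (ln (ln n) / ln n))"
  shows "(\<lambda>n. measure_pmf.prob (binomial_graph n (p n))
            {E. (Delta m k n E - a_seq k n (p n)) / sigma_seq k n (p n) \<le> y})
         \<longlonglongrightarrow> exp (- exp (- y)) * (\<Sum>i<m. exp (- y * i) / fact i)"
proof -
  interpret threshold k y p by unfold_locales fact+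
  have "exp (- y) ^ i = exp (- y * real i)" for i
    by (simp add: mult.commute flip: exp_of_nat_mult)
  then show ?thesis using Delta_limit[OF assms(2)] by simp
qed

end
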